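(* Let $m_1,m_2,m_3\in\mathbb N$ and $m=m_1+m_2+m_3$. Let $\mathcal{UL}_{2,4}$ be the set of partitions $\pi$ of $[m]$ such that $T^\pi_{m_1,m_2,m_3}$ is of $2$-$4$ uniloop type. Then $$|\mathcal{UL}_{2,4}|=|\mathcal{PS}^{(1,1,1)}_{NC_{2,1,1}}(m_1,m_2,m_3)|=|\mathcal{PS}^{(1,1)(t)}_{NC_2}(m_1,m_2,m_3)|.$$
   Context: **Graphs.** $\gamma=\gamma_{m_1,m_2,m_3}$ is the permutation of $[m]$ with three cycles, the $j$-th being $[\![m_j]\!]=(m_1+\cdots+m_{j-1}+1,\dots,m_1+\cdots+m_j)$. $T_{m_1,m_2,m_3}$ is the oriented graph with vertex set $[m]$ and edges $e_1,\dots,e_m$, $e_i$ going from $\gamma(i)$ to $i$; it is the disjoint union of basic cycles $T_{m_1},T_{m_2},T_{m_3}$, and $E_j=\{e_i:i\in[\![m_j]\!]\}$. For a partition $\pi$ of $[m]$, the quotient graph $T^\pi_{m_1,m_2,m_3}$ has the blocks of $\pi$ as vertices and edges $e_1,\dots,e_m$, $e_i$ going from the block of $\gamma(i)$ to the block of $i$; for $J\subset\{1,2,3\}$, $T^\pi_{m_j,\,j\in J}$ is the quotient of $\bigcup_{j\in J}T_{m_j}$ by the restriction of $\pi$. Two edges are equivalent if they join the same unordered pair of vertices; the elementarization (denoted by an overline) is the unoriented graph on the same vertices whose edges are the equivalence classes; multiplicity is the cardinality of the class. Equivalent edges have opposite orientations if the source of each is the target of the other (two loops at a vertex satisfy this).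 A double tree is a graph whose elementarization is a tree with every edge of multiplicity 2 consisting of two edges with opposite orientations (a single vertex without edges counts as a double tree). A circuit is a connected subgraph all of whose vertices have degree 2 (a loop contributes 2). $T^\pi_{m_j,m_k}$ is a double unicircuit graph if its elementarization is connected with exactly one circuit, every edge has multiplicity 2 and consists of two edges with opposite orientations, and every edge of the circuit consists of one edge from $E_j$ and one from $E_k$. $T^\pi_{m_1,m_2,m_3}$ is of $2$-$4$ uniloop type if for some $\{i,j,k\}=\{1,2,3\}$: $T^\pi_{m_i}$ has two loops at the same vertex and removing them leaves a double tree; $T^\pi_{m_j,m_k}$ is a double unicircuit graph whose circuit is a loop; and $T^\pi_{m_1,m_2,m_3}$ is obtained by joining $T^\pi_{m_i}$ and $T^\pi_{m_j,m_k}$ at the vertices carrying the loops (no other vertex identifications between them). **Partitioned permutations.** For a permutation $\tau$ of an $n$-element set, $|\tau|=n$ minus the number of cycles. $NC(m_i)$ is the set of non-crossing permutations $\tau$ of $[\![m_i]\!]$ ($|\tau|+|\tau^{-1}\gamma_{m_i}|=|\gamma_{m_i}|$, with $\gamma_{m_i}$ the $i$-th cycle of $\gamma$); $NC_2(m_i)$ are those with all cycles of size 2. $NC_2(m_{i_1},m_{i_2})$ is the set of permutations $\tau$ of $[\![m_{i_1}]\!]\cup[\![m_{i_2}]\!]$ with all cycles of size 2, $|\tau|+|\tau^{-1}\gamma'|=|\gamma'|+2$ and $\tau\vee\gamma'$ the one-block partition, where $\gamma'$ is the product of the cycles $[\![m_{i_1}]\!],[\![m_{i_2}]\!]$; a through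 string of $\tau$ is a cycle meeting both cycles of $\gamma'$. - $\mathcal{PS}^{(1,1,1)}_{NC_{2,1,1}}(m_1,m_2,m_3)$: pairs $(\mathcal V,\pi)$ with $\pi=\pi_1\times\pi_2\times\pi_3$, $\pi_i\in NC(m_i)$, such that for some permutation $(i_1,i_2,i_3)$ of $(1,2,3)$, $\pi_{i_1}$ and $\pi_{i_2}$ each have all cycles of size 2 except exactly one of size 1, $\pi_{i_3}\in NC_2(m_{i_3})$, and $\mathcal V$ is a partition of $[m]$ each of whose blocks is a cycle of $\pi$ except one block which is the union of the two cycles of size 1 and one cycle of $\pi_{i_3}$. - $\mathcal{PS}^{(1,1)(t)}_{NC_2}(m_1,m_2,m_3)$: pairs $(\mathcal V,\pi)$ such that for some permutation $(i_1,i_2,i_3)$ of $(1,2,3)$, $\pi=\pi_1\times\pi_2$ with $\pi_1\in NC_2(m_{i_1},m_{i_2})$ having exactly one through string, $\pi_2\in NC_2(m_{i_3})$, and $\mathcal V$ is a partition of $[m]$ each of whose blocks is a cycle of $\pi$ except one block which is the union of the through string of $\pi_1$ and one cycle of $\pi_2$. *)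

theory Defs
  imports
    "HOL-Library.Disjoint_Sets"
    "HOL-Combinatorics.Cycles"
    "HOL-Combinatorics.Orbits"
    "Graph_Theory.Digraph"
begin

text \<open>
  Cycle lengths are given by a list \<open>ms = [m\<^sub>1, m\<^sub>2, m\<^sub>3]\<close>; the three cycles are therefore
  numbered 0, 1, 2, while the permuted points are \<open>1, \<dots>, m\<close>.
\<close>

definition seg_list :: "nat list \<Rightarrow> nat \<Rightarrow> nat list" where
  "seg_list ms j = [sum_list (take j ms) + 1 ..< sum_list (take (Suc j) ms) + 1]"

definition seg :: "nat list \<Rightarrow> nat \<Rightarrow> nat set" where
  "seg ms j = set (seg_list ms j)"

definition gamma_cyc :: "nat list \<Rightarrow> nat \<Rightarrow> nat \<Rightarrow> nat" where
  "gamma_cyc ms j = cycle_of_list (seg_list ms j)"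

definition gamma :: "nat list \<Rightarrow> nat \<Rightarrow> nat" where
  "gamma ms = gamma_cyc ms 0 \<circ> gamma_cyc ms 1 \<circ> gamma_cyc ms 2"

text \<open>\<open>uends H e\<close> is the set of endpoints of \<open>e\<close>; it is a singleton exactly if \<open>e\<close> is a loop.\<close>

record ('v, 'e) ugraph =
  uverts :: "'v set"
  uedges :: "'e set"
  uends :: "'e \<Rightarrow> 'v set"

definition udegree :: "('v, 'e) ugraph \<Rightarrow> 'v \<Rightarrow> nat" where
  "udegree H v = card {e \<in> uedges H. v \<in> uends H e} + card {e \<in> uedges H. uends H e = {v}}"

definition uconnected :: "('v, 'e) ugraph \<Rightarrow> bool" where
  "uconnected H \<longleftrightarrow> uverts H \<noteq> {} \<and>
     (\<forall>u\<in>uverts H. \<forall>v\<in>uverts H. (u, v) \<in> {(x, y). \<exists>e\<in>uedges H. uends H e = {x, y}}\<^sup>*)"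

definition usubgraph :: "('v, 'e) ugraph \<Rightarrow> ('v, 'e) ugraph \<Rightarrow> bool" where
  "usubgraph K H \<longleftrightarrow> uverts K \<subseteq> uverts H \<and> uedges K \<subseteq> uedges H \<and> uends K = uends H \<and>
     (\<forall>e\<in>uedges K. uends K e \<subseteq> uverts K)"

definition circuit :: "('v, 'e) ugraph \<Rightarrow> ('v, 'e) ugraph \<Rightarrow> bool" where
  "circuit H K \<longleftrightarrow> usubgraph K H \<and> uconnected K \<and> (\<forall>v\<in>uverts K. udegree K v = 2)"

definition utree :: "('v, 'e) ugraph \<Rightarrow> bool" where
  "utree H \<longleftrightarrow> uconnected H \<and> (\<nexists>K. circuit H K)"

definition equiv_arcs :: "('v, 'e) pre_digraph \<Rightarrow> ('e \<times> 'e) set" where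
  "equiv_arcs G = {(e, f). e \<in> arcs G \<and> f \<in> arcs G \<and>
     {tail G e, head G e} = {tail G f, head G f}}"

definition elementarization :: "('v, 'e) pre_digraph \<Rightarrow> ('v, 'e set) ugraph" where
  "elementarization G = \<lparr>uverts = verts G, uedges = arcs G // equiv_arcs G,
     uends = (\<lambda>C. \<Union>e\<in>C. {tail G e, head G e})\<rparr>"

definition opposite :: "('v, 'e) pre_digraph \<Rightarrow> 'e \<Rightarrow> 'e \<Rightarrow> bool" where
  "opposite G e f \<longleftrightarrow> tail G e = head G f \<and> tail G f = head G e"

definition double_opposite :: "('v, 'e) pre_digraph \<Rightarrow> bool" where
  "double_opposite G \<longleftrightarrow> (\<forall>C\<in>uedges (elementarization G). card C = 2 \<and>
     (\<forall>e\<in>C. \<forall>f\<in>C. e \<noteq> f \<longrightarrow> opposite G e f))"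

definition double_tree :: "('v, 'e) pre_digraph \<Rightarrow> bool" where
  "double_tree G \<longleftrightarrow> utree (elementarization G) \<and> double_opposite G"

text \<open>The edge \<open>e\<^sub>i\<close> is represented by its index \<open>i\<close>; in particular \<open>E\<^sub>j\<close> is \<open>seg ms j\<close>.\<close>

definition T_graph :: "nat list \<Rightarrow> nat set \<Rightarrow> (nat, nat) pre_digraph" where
  "T_graph ms J = \<lparr>verts = (\<Union>j\<in>J. seg ms j), arcs = (\<Union>j\<in>J. seg ms j),
     tail = gamma ms, head = (\<lambda>i. i)\<rparr>"

definition block_of :: "'a set set \<Rightarrow> 'a \<Rightarrow> 'a set" where
  "block_of P x = (THE B. B \<in> P \<and> x \<in> B)"

definition quotient_graph :: "('v, 'e) pre_digraph \<Rightarrow> 'v set set \<Rightarrow> ('v set, 'e) pre_digraph" where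
  "quotient_graph G P = \<lparr>verts = P, arcs = arcs G,
     tail = (\<lambda>e. block_of P (tail G e)), head = (\<lambda>e. block_of P (head G e))\<rparr>"

definition restrict_partition :: "'a set set \<Rightarrow> 'a set \<Rightarrow> 'a set set" where
  "restrict_partition P S = (\<inter>) S ` P - {{}}"

definition T_quot :: "nat list \<Rightarrow> nat set set \<Rightarrow> nat set \<Rightarrow> (nat set, nat) pre_digraph" where
  "T_quot ms P J = quotient_graph (T_graph ms J) (restrict_partition P (\<Union>j\<in>J. seg ms j))"

definition double_tree_with_two_loops :: "('v, 'e) pre_digraph \<Rightarrow> 'v \<Rightarrow> bool" where
  "double_tree_with_two_loops G v \<longleftrightarrow>
     (\<exists>e\<in>arcs G. \<exists>f\<in>arcs G. e \<noteq> f \<and>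
        tail G e = v \<and> head G e = v \<and> tail G f = v \<and> head G f = v \<and>
        double_tree (G\<lparr>arcs := arcs G - {e, f}\<rparr>))"

definition double_unicircuit :: "nat list \<Rightarrow> nat set set \<Rightarrow> nat \<Rightarrow> nat \<Rightarrow> bool" where
  "double_unicircuit ms P j k \<longleftrightarrow>
     (let G = T_quot ms P {j, k}; H = elementarization G in
        uconnected H \<and> (\<exists>!K. circuit H K) \<and> double_opposite G \<and>
        (\<forall>K. circuit H K \<longrightarrow>
           (\<forall>C\<in>uedges K. \<exists>a\<in>seg ms j. \<exists>b\<in>seg ms k. C = {a, b})))"

definition circuit_is_loop_at :: "('v, 'e) ugraph \<Rightarrow> 'v \<Rightarrow> bool" where
  "circuit_is_loop_at H w \<longleftrightarrow>
     (\<exists>K c. circuit H K \<and> uverts K = {w} \<and> uedges K = {c} \<and> uends K c = {w})"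

text \<open>
  The vertices of a quotient graph are blocks, so gluing two quotient graphs on disjoint point
  sets at the vertices \<open>v\<close> and \<open>w\<close> only means merging the blocks \<open>v\<close> and \<open>w\<close>. The edges are
  determined by the resulting partition.
\<close>

definition join_at :: "'a set set \<Rightarrow> 'a set \<Rightarrow> 'a set set \<Rightarrow> 'a set \<Rightarrow> 'a set set" where
  "join_at P v Q w = (P - {v}) \<union> (Q - {w}) \<union> {v \<union> w}"

definition uniloop_24 :: "nat list \<Rightarrow> nat set set \<Rightarrow> bool" where
  "uniloop_24 ms P \<longleftrightarrow>
     (\<exists>i j k v w. {i, j, k} = {0, 1, 2} \<and>
        double_tree_with_two_loops (T_quot ms P {i}) v \<and>
        double_unicircuit ms P j k \<and>
        circuit_is_loop_at (elementarization (T_quot ms P {j, k})) w \<and>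
        verts (T_quot ms P {0, 1, 2}) =
          join_at (verts (T_quot ms P {i})) v (verts (T_quot ms P {j, k})) w)"

definition UL_24 :: "nat \<Rightarrow> nat \<Rightarrow> nat \<Rightarrow> nat set set set" where
  "UL_24 m1 m2 m3 = {P. partition_on {1..m1 + m2 + m3} P \<and> uniloop_24 [m1, m2, m3] P}"

definition cycles_on :: "'a set \<Rightarrow> ('a \<Rightarrow> 'a) \<Rightarrow> 'a set set" where
  "cycles_on S t = orbit t ` S"

definition perm_length :: "'a set \<Rightarrow> ('a \<Rightarrow> 'a) \<Rightarrow> nat" where
  "perm_length S t = card S - card (cycles_on S t)"

definition partition_join :: "'a set set \<Rightarrow> 'a set set \<Rightarrow> 'a set set" where
  "partition_join P Q = (\<Union>P \<union> \<Union>Q) // {(x, y). \<exists>B\<in>P \<union> Q. x \<in> B \<and> y \<in> B}\<^sup>+"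

definition NC :: "nat list \<Rightarrow> nat \<Rightarrow> (nat \<Rightarrow> nat) set" where
  "NC ms i = {t. t permutes seg ms i \<and>
     perm_length (seg ms i) t + perm_length (seg ms i) (inv t \<circ> gamma_cyc ms i) =
       perm_length (seg ms i) (gamma_cyc ms i)}"

definition NC2 :: "nat list \<Rightarrow> nat \<Rightarrow> (nat \<Rightarrow> nat) set" where
  "NC2 ms i = {t \<in> NC ms i. \<forall>C\<in>cycles_on (seg ms i) t. card C = 2}"

definition NC21 :: "nat list \<Rightarrow> nat \<Rightarrow> (nat \<Rightarrow> nat) set" where
  "NC21 ms i = {t \<in> NC ms i.
     \<exists>A\<in>cycles_on (seg ms i) t. card A = 1 \<and> (\<forall>C\<in>cycles_on (seg ms i) t - {A}. card C = 2)}"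

definition NC2_annular :: "nat list \<Rightarrow> nat \<Rightarrow> nat \<Rightarrow> (nat \<Rightarrow> nat) set" where
  "NC2_annular ms i j =
     (let S = seg ms i \<union> seg ms j; g = gamma_cyc ms i \<circ> gamma_cyc ms j in
       {t. t permutes S \<and> (\<forall>C\<in>cycles_on S t. card C = 2) \<and>
          perm_length S t + perm_length S (inv t \<circ> g) = perm_length S g + 2 \<and>
          partition_join (cycles_on S t) (cycles_on S g) = {S}})"

definition through_strings :: "nat list \<Rightarrow> nat \<Rightarrow> nat \<Rightarrow> (nat \<Rightarrow> nat) \<Rightarrow> nat set set" where
  "through_strings ms i j t =
     {C \<in> cycles_on (seg ms i \<union> seg ms j) t. C \<inter> seg ms i \<noteq> {} \<and> C \<inter> seg ms j \<noteq> {}}"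

definition one_merged_block :: "'a set \<Rightarrow> 'a set set \<Rightarrow> ('a \<Rightarrow> 'a) \<Rightarrow> 'a set \<Rightarrow> bool" where
  "one_merged_block S V t B \<longleftrightarrow>
     partition_on S V \<and> B \<in> V \<and> (\<forall>D\<in>V - {B}. D \<in> cycles_on S t)"

definition PS_111_NC211 :: "nat \<Rightarrow> nat \<Rightarrow> nat \<Rightarrow> (nat set set \<times> (nat \<Rightarrow> nat)) set" where
  "PS_111_NC211 m1 m2 m3 = (let ms = [m1, m2, m3] in
     {(V, t). \<exists>q. t = q 0 \<circ> q 1 \<circ> q 2 \<and> (\<forall>i\<in>{0, 1, 2}. q i \<in> NC ms i) \<and>
        (\<exists>i1 i2 i3. {i1, i2, i3} = {0, 1, 2} \<and>
           q i1 \<in> NC21 ms i1 \<and> q i2 \<in> NC21 ms i2 \<and> q i3 \<in> NC2 ms i3 \<and>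
           (\<exists>A1\<in>cycles_on (seg ms i1) (q i1). \<exists>A2\<in>cycles_on (seg ms i2) (q i2).
            \<exists>C\<in>cycles_on (seg ms i3) (q i3). card A1 = 1 \<and> card A2 = 1 \<and>
              one_merged_block {1..m1 + m2 + m3} V t (A1 \<union> A2 \<union> C)))})"

definition PS_11t_NC2 :: "nat \<Rightarrow> nat \<Rightarrow> nat \<Rightarrow> (nat set set \<times> (nat \<Rightarrow> nat)) set" where
  "PS_11t_NC2 m1 m2 m3 = (let ms = [m1, m2, m3] in
     {(V, t). \<exists>i1 i2 i3 p1 p2. {i1, i2, i3} = {0, 1, 2} \<and> t = p1 \<circ> p2 \<and>
        p1 \<in> NC2_annular ms i1 i2 \<and> card (through_strings ms i1 i2 p1) = 1 \<and>
        p2 \<in> NC2 ms i3 \<and>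
        (\<exists>A\<in>through_strings ms i1 i2 p1. \<exists>C\<in>cycles_on (seg ms i3) p2.
           one_merged_block {1..m1 + m2 + m3} V t (A \<union> C))})"

end

theory Submission
  imports Defs
begin

text \<open>
  Everything is reduced to counting cycles of permutations. In a double edge the two arcs \<open>x\<close> and
  \<open>s x\<close> are opposite, so the block of \<open>\<gamma> (s x)\<close> is the block of \<open>x\<close>: the vertex partition is coarser
  than the cycles of \<open>\<gamma> \<circ> s\<close>, where the involution \<open>s\<close> pairs the arcs and fixes the loops. A tree
  has one more vertex than edges, and the triangle inequality \<open>\<bar>\<gamma>\<bar> \<le> \<bar>\<gamma> \<circ> s\<bar> + \<bar>s\<bar>\<close> says that
  \<open>\<gamma> \<circ> s\<close> has at most that many cycles. Hence equality holds in both places: the vertices are exactly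
  the cycles of \<open>\<gamma> \<circ> s\<close>, and \<open>s\<close> is non-crossing.

  A 2-4 uniloop quotient is therefore the same as an involution \<open>s\<close> with four fixed points, the loops:
  \<open>e\<close>, \<open>f\<close> in one cycle of \<open>\<gamma>\<close> and \<open>a\<close>, \<open>b\<close> in the other two. Pairing \<open>e\<close> with \<open>f\<close> gives the
  elements of the second set, pairing in addition \<open>a\<close> with \<open>b\<close> those of the third; in both, the
  merged block is \<open>{a, b, e, f}\<close>. Composing with a transposition changes the number of cycles by
  one, which matches the counting conditions.
\<close>

section \<open>Cycle counts\<close>

text \<open>On the two cycles of \<gamma> that carry \<open>a\<close> and \<open>b\<close> the count
  does not close by itself. If they have \<open>n\<close> points together,
  \<open>\<gamma> \<circ> s\<close> may have \<open>n/2 + 1\<close> cycles there, while the double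
  tree has only \<open>n/2\<close> vertices, because both loops sit at one vertex. The missing
  vertex is accounted for by the transposition of \<open>a\<close> and \<open>b\<close>: on this
  side the vertices are the cycles of \<open>\<gamma> \<circ> s \<circ> transpose a b\<close>. The
  slack might also hide a pair of \<open>s\<close> joining the two cycles of \<gamma>; such a pair
  costs two cycles of \<open>\<gamma> \<circ> s\<close>, one more than the slack allows. The labels
  are not determined by \<open>s\<close>: \<open>j\<close>, \<open>k\<close> may be exchanged
  together with \<open>a\<close>, \<open>b\<close>, and so may \<open>e\<close>, \<open>f\<close>.
  Hence no bijection is written down. All three sets are images of one set of labelled data, and
  each of the three maps identifies exactly the labellings of the same \<open>s\<close>. That the
  segment with two loops is recognizable at all is a matter of parity: it is the only one of even
  length.\<close>

text \<open>Outside \<open>S\<close> the map only has to be a permutation. One involution of all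
  points can therefore be counted on each segment and on unions of segments without being restricted
  first.\<close>

definition stab :: "('a \<Rightarrow> 'a) \<Rightarrow> 'a set \<Rightarrow> bool" where
  "stab f S \<longleftrightarrow> finite S \<and> permutation f \<and> f ` S \<subseteq> S"

lemma stabD: "stab f S \<Longrightarrow> x \<in> S \<Longrightarrow> f x \<in> S" by (auto simp: stab_def)

lemma stab_finite: "stab f S \<Longrightarrow> finite S" by (simp add: stab_def)

lemma self_in_orbit: "stab f S \<Longrightarrow> x \<in> orbit f x"
  by (simp add: stab_def permutation_self_in_orbit)

lemma orbit_closed_subset:
  assumes "x \<in> U" "\<And>y. y \<in> U \<Longrightarrow> f y \<in> U"
  shows "orbit f x \<subseteq> U"
proof
  fix y assume "y \<in> orbit f x" then show "y \<in> U" by induct (use assms in auto)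
qed

lemma orbit_subset_stab: "stab f S \<Longrightarrow> x \<in> S \<Longrightarrow> orbit f x \<subseteq> S"
  by (rule orbit_closed_subset) (auto dest: stabD)

lemma orbit_eq_stab: "stab f S \<Longrightarrow> y \<in> orbit f x \<Longrightarrow> orbit f y = orbit f x"
  by (metis orbit_swap orbit_trans permutation_self_in_orbit stab_def subsetI subset_antisym)

lemma stab_comp: "stab f S \<Longrightarrow> stab g S \<Longrightarrow> stab (f \<circ> g) S"
  by (auto simp: stab_def permutation_compose)

lemma stab_transpose: "finite S \<Longrightarrow> a \<in> S \<Longrightarrow> b \<in> S \<Longrightarrow> stab (transpose a b) S"
  by (auto simp: stab_def permutation_swap_id transpose_def)

lemma stab_image_eq: "stab f S \<Longrightarrow> f ` S = S"
  unfolding stab_def by (meson bij_is_inj endo_inj_surj inj_on_subset permutation_bijective subset_UNIV)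

lemma partition_cycles_on: assumes "stab f S" shows "partition_on S (cycles_on S f)"
proof (rule partition_onI)
  show "\<Union>(cycles_on S f) = S"
    unfolding cycles_on_def using orbit_subset_stab[OF assms] self_in_orbit[OF assms] by blast
  show "{} \<notin> cycles_on S f"
    using orbit_nonempty by (metis cycles_on_def imageE)
  show "disjnt p p'" if "p \<in> cycles_on S f" "p' \<in> cycles_on S f" "p \<noteq> p'" for p p'
    using that orbit_eq_stab[OF assms] unfolding cycles_on_def disjnt_iff by (metis imageE)
qed

lemma cycles_on_Un: "cycles_on (S \<union> T) f = cycles_on S f \<union> cycles_on T f"
  by (auto simp: cycles_on_def)

lemma cycles_on_cong:
  assumes "stab f S" "\<And>x. x \<in> S \<Longrightarrow> f x = g x"
  shows "cycles_on S f = cycles_on S g"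
  unfolding cycles_on_def using orbit_cong0[of _ S f g] assms stabD[OF assms(1)]
  by (intro image_cong) auto

lemma cycles_on_disjoint:
  assumes "stab f S" "stab f T" "S \<inter> T = {}"
  shows "cycles_on S f \<inter> cycles_on T f = {}"
proof -
  have "C \<subseteq> S \<inter> T \<and> C \<noteq> {}" if "C \<in> cycles_on S f" "C \<in> cycles_on T f" for C
    using that orbit_subset_stab assms(1,2) orbit_nonempty unfolding cycles_on_def by fast
  then show ?thesis using assms(3) by blast
qed

lemma card_cycles_on_Un:
  assumes "stab f S" "stab f T" "S \<inter> T = {}"
  shows "card (cycles_on (S \<union> T) f) = card (cycles_on S f) + card (cycles_on T f)"
proof -
  have "finite (cycles_on S f)" "finite (cycles_on T f)"
    using assms(1,2) by (simp_all add: cycles_on_def stab_finite)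
  then show ?thesis
    using cycles_on_disjoint[OF assms] by (simp add: cycles_on_Un card_Un_disjoint)
qed

section \<open>Multiplication by a transposition\<close>

text \<open>The new map sends \<open>a\<close> to \<open>f b\<close> and then follows
  \<open>f\<close> around the cycle of \<open>b\<close>. Before the return to \<open>b\<close> it
  meets neither \<open>b\<close> nor \<open>a\<close>, so it agrees with \<open>f\<close> all the
  way.\<close>

lemma orbit_merge:
  assumes f: "stab f S" and b: "b \<notin> orbit f a"
  shows "b \<in> orbit (f \<circ> transpose a b) a"
proof -
  let ?h = "f \<circ> transpose a b"
  let ?p = "funpow_dist1 f b b"
  have bb: "b \<in> orbit f b" using self_in_orbit[OF f] .
  have na: "a \<notin> orbit f b" using b orbit_eq_stab[OF f] self_in_orbit[OF f] by metis
  have "(f ^^ Suc k) b \<in> orbit ?h a" if "Suc k \<le> ?p" for k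
    using that
  proof (induction k)
    case 0
    have "?h a = f b" by simp
    with orbit.base[of ?h a] show ?case by (metis funpow_0 funpow_simps_right(1) funpow.simps(2) comp_apply id_apply)
  next
    case (Suc k)
    have "(f ^^ Suc k) b \<noteq> b" using Suc.prems by (intro funpow_dist1_least) auto
    moreover have "(f ^^ Suc k) b \<noteq> a"
      using na funpow_in_orbit[OF bb, of "Suc k"] by metis
    ultimately have "?h ((f ^^ Suc k) b) = (f ^^ Suc (Suc k)) b"
      by (simp add: transpose_def)
    with Suc orbit.step[of "(f ^^ Suc k) b" ?h a] show ?case by (metis Suc_leD)
  qed
  then have "(f ^^ ?p) b \<in> orbit ?h a" by blast
  then show ?thesis using funpow_dist1_prop[OF bb] by simp
qed

lemma cycles_on_merge:
  assumes f: "stab f S" and S: "a \<in> S" "b \<in> S" and b: "b \<notin> orbit f a"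
  shows "cycles_on S (f \<circ> transpose a b) =
    cycles_on S f - {orbit f a, orbit f b} \<union> {orbit f a \<union> orbit f b}"
    and "orbit (f \<circ> transpose a b) a = orbit f a \<union> orbit f b"
proof -
  let ?h = "f \<circ> transpose a b"
  have h: "stab ?h S" using f S by (intro stab_comp stab_transpose) (auto simp: stab_finite)
  have ba: "b \<in> orbit ?h a" using orbit_merge[OF f b] .
  have eq: "orbit ?h b = orbit ?h a" using orbit_eq_stab[OF h ba] .
  \<comment> \<open>An old step is a new step except at \<open>a\<close> and \<open>b\<close>, where
    the images are exchanged. Since \<open>a\<close> and \<open>b\<close> now share an orbit, old
    orbits lie inside new ones.\<close>
  have step: "f x \<in> orbit ?h x" for x
  proof -
    have "f x = ?h x \<or> x = a \<or> x = b" by (auto simp: transpose_def)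
    moreover have "f a = ?h b" "f b = ?h a" by simp_all
    ultimately show ?thesis using eq orbit.base[of ?h] by metis
  qed
  have sub: "orbit f x \<subseteq> orbit ?h x" for x
    using step orbit_trans self_in_orbit[OF h] by (intro orbit_closed_subset) fast+
  have U: "orbit ?h x \<subseteq> orbit f a \<union> orbit f b" if "x \<in> orbit f a \<union> orbit f b" for x
    using that orbit.base[of f] orbit.step[of _ f]
    by (intro orbit_closed_subset) (auto simp: transpose_def)
  have aU: "a \<in> orbit f a" "b \<in> orbit f b" by (simp_all add: self_in_orbit[OF f])
  show 1: "orbit ?h a = orbit f a \<union> orbit f b"
    using U[of a] sub[of a] sub[of b] eq aU by blast
  have 2: "orbit ?h x = orbit f a \<union> orbit f b" if "x \<in> orbit f a \<union> orbit f b" for x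
    using that 1 orbit_eq_stab[OF h] by metis
  have 3: "orbit ?h x = orbit f x" if "x \<notin> orbit f a \<union> orbit f b" for x
  proof
    have "\<And>y. y \<in> orbit f x \<Longrightarrow> y \<noteq> a \<and> y \<noteq> b"
      using that orbit_eq_stab[OF f] self_in_orbit[OF f] by blast
    then show "orbit ?h x \<subseteq> orbit f x"
      using orbit.step[of _ f] self_in_orbit[OF f] 
      by (intro orbit_closed_subset) (auto simp: transpose_def)
  qed (rule sub)
  have 4: "orbit f x \<in> {orbit f a, orbit f b} \<longleftrightarrow> x \<in> orbit f a \<union> orbit f b" for x
    using orbit_eq_stab[OF f] self_in_orbit[OF f] by blast
  show "cycles_on S ?h = cycles_on S f - {orbit f a, orbit f b} \<union> {orbit f a \<union> orbit f b}"
    (is "?L = ?R")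
  proof (intro equalityI subsetI)
    fix C assume "C \<in> ?L"
    then obtain x where "x \<in> S" "C = orbit ?h x" by (auto simp: cycles_on_def)
    then show "C \<in> ?R" using 2[of x] 3[of x] 4[of x] by (auto simp: cycles_on_def)
  next
    fix C assume C: "C \<in> ?R"
    show "C \<in> ?L"
    proof (cases "C = orbit f a \<union> orbit f b")
      case True then show ?thesis using 1 S by (auto simp: cycles_on_def)
    next
      case False
      then obtain x where "x \<in> S" "C = orbit f x" "orbit f x \<notin> {orbit f a, orbit f b}"
        using C by (auto simp: cycles_on_def)
      then show ?thesis using 3[of x] 4[of x] by (auto simp: cycles_on_def)
    qed
  qed
qed

lemma card_cycles_on_merge:
  assumes f: "stab f S" and S: "a \<in> S" "b \<in> S" and b: "b \<notin> orbit f a"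
  shows "card (cycles_on S f) = card (cycles_on S (f \<circ> transpose a b)) + 1"
proof -
  have fin: "finite (cycles_on S f)" using f by (simp add: cycles_on_def stab_finite)
  have aU: "a \<in> orbit f a" "b \<in> orbit f b" by (simp_all add: self_in_orbit[OF f])
  then have ne: "orbit f a \<noteq> orbit f b" using b by auto
  have new: "orbit f a \<union> orbit f b \<notin> cycles_on S f"
  proof
    assume "orbit f a \<union> orbit f b \<in> cycles_on S f"
    then obtain x where "orbit f a \<union> orbit f b = orbit f x" by (auto simp: cycles_on_def)
    then have "orbit f a = orbit f x" "orbit f b = orbit f x"
      using orbit_eq_stab[OF f] aU by blast+
    then show False using ne by simp
  qed
  have mem: "{orbit f a, orbit f b} \<subseteq> cycles_on S f" using S by (auto simp: cycles_on_def)
  have "card {orbit f a, orbit f b} = 2" using ne by simp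
  then have "card (cycles_on S f - {orbit f a, orbit f b}) = card (cycles_on S f) - 2"
    using mem by (simp add: card_Diff_subset)
  moreover have "card (cycles_on S f) \<ge> 2"
    using card_mono[OF fin mem] \<open>card {_,_} = 2\<close> by simp
  ultimately show ?thesis
    unfolding cycles_on_merge(1)[OF assms] using fin new by simp
qed

text \<open>From \<open>b\<close> the new map jumps to \<open>f a\<close> and follows the old cycle
  until it is back at \<open>b\<close>. The arc \<open>?U\<close> from \<open>f a\<close> to
  \<open>b\<close> is thus closed, and it avoids \<open>a\<close>.\<close>

lemma orbit_split:
  assumes f: "stab f S" and b: "b \<in> orbit f a" and ab: "a \<noteq> b"
  shows "b \<notin> orbit (f \<circ> transpose a b) a"
proof -
  let ?h = "f \<circ> transpose a b"
  let ?p = "funpow_dist1 f a b"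
  let ?U = "(\<lambda>k. (f ^^ k) a) ` {1..?p}"
  have pb: "(f ^^ ?p) a = b" using funpow_dist1_prop[OF b] .
  have least: "(f ^^ k) a \<noteq> b" if "0 < k" "k < ?p" for k
    using funpow_dist1_least[OF that] .
  \<comment> \<open>A return to \<open>a\<close> before time \<open>?p\<close> would make
    \<open>b\<close> appear earlier than its first occurrence.\<close>
  have na: "(f ^^ k) a \<noteq> a" if "0 < k" "k \<le> ?p" for k
  proof
    assume eq: "(f ^^ k) a = a"
    then have "k \<noteq> ?p" using pb ab by metis
    then have "?p - k < ?p" "0 < ?p - k" using that by auto
    moreover have "(f ^^ (?p - k)) ((f ^^ k) a) = (f ^^ ?p) a"
      using that by (metis comp_apply funpow_add le_add_diff_inverse2)
    ultimately show False using eq pb least by metis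
  qed
  have "orbit ?h b \<subseteq> ?U"
  proof (rule orbit_closed_subset)
    show "b \<in> ?U" using pb by (intro image_eqI[of _ _ ?p]) auto
    fix y assume "y \<in> ?U"
    then obtain k where k: "1 \<le> k" "k \<le> ?p" "y = (f ^^ k) a" by auto
    show "?h y \<in> ?U"
    proof (cases "k = ?p")
      case True
      then have "?h y = (f ^^ 1) a" using k pb by simp
      then show ?thesis by (intro image_eqI[of _ _ 1]) auto
    next
      case False
      then have "y \<noteq> b" "y \<noteq> a" using k least[of k] na[of k] by auto
      then have "?h y = (f ^^ Suc k) a" using k by (simp add: transpose_def)
      then show ?thesis using k False by (intro image_eqI[of _ _ "Suc k"]) auto
    qed
  qed
  moreover have "a \<notin> ?U"
  proof
    assume "a \<in> ?U"
    then obtain k where "k \<in> {1..?p}" "a = (f ^^ k) a" by (rule imageE)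
    then show False using na[of k] by auto
  qed
  ultimately have "a \<notin> orbit ?h b" by blast
  moreover have "a \<in> orbit ?h a" 
    using f by (auto simp: stab_def intro!: permutation_self_in_orbit permutation_compose permutation_swap_id)
  ultimately show ?thesis using f 
    by (metis orbit_swap)
qed

text \<open>Splitting is merging read backwards: multiplying \<open>?h\<close> by the same
  transposition gives \<open>f\<close> again.\<close>

lemma card_cycles_on_split:
  assumes f: "stab f S" and S: "a \<in> S" "b \<in> S" and b: "b \<in> orbit f a" "a \<noteq> b"
  shows "card (cycles_on S (f \<circ> transpose a b)) = card (cycles_on S f) + 1"
proof -
  let ?h = "f \<circ> transpose a b"
  have h: "stab ?h S" using f S by (intro stab_comp stab_transpose) (auto simp: stab_finite)
  have "?h \<circ> transpose a b = f" by (simp add: comp_assoc)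
  then show ?thesis using card_cycles_on_merge[OF h S orbit_split[OF f b]] by simp
qed

lemma card_cycles_on_comp_transpose_ge:
  assumes "stab f S" "a \<in> S" "b \<in> S"
  shows "card (cycles_on S f) \<le> card (cycles_on S (f \<circ> transpose a b)) + 1"
  using card_cycles_on_merge[OF assms] card_cycles_on_split[OF assms] by (cases "a = b") force+

section \<open>The triangle inequality and the genus bounds\<close>

lemma cycles_on_conj:
  assumes f: "stab f S" and p: "stab p S"
  shows "card (cycles_on S (p \<circ> f \<circ> inv p)) = card (cycles_on S f)"
proof -
  have bp: "bij p" using p by (simp add: stab_def permutation_bijective)
  have orb: "orbit (p \<circ> f \<circ> inv p) (p x) = p ` orbit f x" for x
    using orbit_inverse[of x f "p \<circ> f \<circ> inv p" p] self_in_orbit[OF f, of x] bp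
    by (simp add: bij_is_inj)
  have "cycles_on S (p \<circ> f \<circ> inv p) = orbit (p \<circ> f \<circ> inv p) ` p ` S"
    by (simp add: cycles_on_def stab_image_eq[OF p])
  also have "\<dots> = image p ` cycles_on S f"
    by (simp add: cycles_on_def image_image orb)
  finally show ?thesis using bp
    by (metis bij_is_inj card_image inj_image_eq_iff inj_onI)
qed

text \<open>The two products are conjugate by \<open>g\<close>. This lets transpositions act from
  the left, and it later turns the complement \<open>inv q \<circ> c\<close> of a non-crossing
  permutation into \<open>g \<circ> t\<close>.\<close>

lemma card_cycles_on_comp_commute:
  assumes f: "stab f S" and g: "stab g S"
  shows "card (cycles_on S (f \<circ> g)) = card (cycles_on S (g \<circ> f))"
proof -
  have "bij g" using g by (simp add: stab_def permutation_bijective)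
  then have "g \<circ> (f \<circ> g) \<circ> inv g = g \<circ> f" by (simp add: fun_eq_iff bij_is_surj surj_f_inv_f)
  then show ?thesis using cycles_on_conj[OF stab_comp[OF f g] g] by simp
qed

lemma card_cycles_on_le: "finite S \<Longrightarrow> card (cycles_on S f) \<le> card S"
  by (simp add: cycles_on_def card_image_le)

text \<open>Induction on the length of \<open>f\<close>. A transposition \<open>(x f(x))\<close> is
  moved from \<open>f\<close> to \<open>h\<close>: it splits a cycle of \<open>f\<close>, gaining
  one, and costs at most one cycle of \<open>h\<close>, while the product stays the same.\<close>

lemma card_cycles_on_triangle:
  assumes "stab f S" "stab h S"
  shows "card (cycles_on S f) + card (cycles_on S h) \<le> card S + card (cycles_on S (f \<circ> h))"
  using assms
proof (induction "card S - card (cycles_on S f)" arbitrary: f h rule: less_induct)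
  case less
  note f = less.prems(1) and h = less.prems(2)
  have fS: "finite S" using f by (simp add: stab_finite)
  show ?case
  proof (cases "\<forall>x\<in>S. f x = x")
    case True
    then have "cycles_on S (f \<circ> h) = cycles_on S h"
      using f h stabD[OF h] by (intro cycles_on_cong stab_comp) auto
    then show ?thesis using card_cycles_on_le[OF fS, of f] by simp
  next
    case False
    then obtain x where x: "x \<in> S" "f x \<noteq> x" by blast
    let ?y = "f x" and ?t = "transpose x (f x)"
    have y: "?y \<in> S" using stabD[OF f] x by simp
    have t: "stab ?t S" by (rule stab_transpose[OF fS x(1) y])
    have ft: "stab (f \<circ> ?t) S" and th: "stab (?t \<circ> h) S" using f h t stab_comp by blast+
    have c: "card (cycles_on S (f \<circ> ?t)) = card (cycles_on S f) + 1"
      using card_cycles_on_split[OF f x(1) y] x(2) orbit.base[of f x] by simp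
    have "card (cycles_on S (f \<circ> ?t)) \<le> card S" using card_cycles_on_le[OF fS] .
    then have "card (cycles_on S (f \<circ> ?t)) + card (cycles_on S (?t \<circ> h))
        \<le> card S + card (cycles_on S (f \<circ> ?t \<circ> (?t \<circ> h)))"
      using c ft th by (intro less.hyps) auto
    moreover have "f \<circ> ?t \<circ> (?t \<circ> h) = f \<circ> h" by (simp add: fun_eq_iff)
    moreover have "card (cycles_on S h) \<le> card (cycles_on S (?t \<circ> h)) + 1"
      using card_cycles_on_comp_transpose_ge[OF h x(1) y] card_cycles_on_comp_commute[OF h t]
      by simp
    ultimately show ?thesis using c by simp
  qed
qed

lemma orbit_involution: "s (s x) = x \<Longrightarrow> orbit s x = {x, s x}"
proof
  assume s: "s (s x) = x"
  show "orbit s x \<subseteq> {x, s x}" by (rule orbit_closed_subset) (use s in auto)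
  show "{x, s x} \<subseteq> orbit s x" using orbit.base[of s x] orbit.step[OF orbit.base, of s x] s by simp
qed

lemma card_cycles_on_involution:
  assumes s: "stab s S" and inv: "\<And>x. x \<in> S \<Longrightarrow> s (s x) = x"
  shows "2 * card (cycles_on S s) = card S + card {x \<in> S. s x = x}"
proof -
  let ?F = "{x \<in> S. s x = x}" and ?N = "{x \<in> S. s x \<noteq> x}"
  have fS: "finite S" using s by (simp add: stab_finite)
  have F: "stab s ?F" and N: "stab s ?N" using s inv stabD[OF s] by (auto simp: stab_def)
  have "card (cycles_on ?F s) = card ?F"
  proof -
    have "orbit s ` ?F = (\<lambda>x. {x}) ` ?F" 
      by (intro image_cong) (auto simp: orbit_eq_singleton_iff)
    then show ?thesis by (simp add: cycles_on_def card_image)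
  qed
  moreover have "2 * card (cycles_on ?N s) = card ?N"
  proof -
    have "card C = 2" if "C \<in> cycles_on ?N s" for C
      using that inv by (force simp: cycles_on_def orbit_involution)
    moreover have P: "partition_on ?N (cycles_on ?N s)" by (rule partition_cycles_on[OF N])
    moreover have "finite (cycles_on ?N s)" using fS by (simp add: cycles_on_def)
    ultimately show ?thesis
      using card_partition[of "cycles_on ?N s" 2] fS partition_onD1[OF P] partition_onD2[OF P]
      by (simp add: disjoint_def)
  qed
  moreover have "card (cycles_on S s) = card (cycles_on ?F s) + card (cycles_on ?N s)"
  proof -
    have "?F \<union> ?N = S" by auto
    then show ?thesis using card_cycles_on_Un[OF F N] by auto
  qed
  moreover have "card S = card ?F + card ?N"
  proof -
    have "?F \<union> ?N = S" by auto
    then show ?thesis using card_Un_disjoint[of ?F ?N] fS by auto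
  qed
  ultimately show ?thesis by simp
qed

text \<open>The triangle inequality for \<open>g \<circ> s\<close> and \<open>s\<close>, whose
  product is \<open>g\<close> on \<open>S\<close> because \<open>s\<close> is an involution
  there.\<close>

lemma card_cycles_on_genus:
  assumes g: "stab g S" and s: "stab s S" and inv: "\<And>x. x \<in> S \<Longrightarrow> s (s x) = x"
  shows "card (cycles_on S s) + card (cycles_on S (g \<circ> s)) \<le> card S + card (cycles_on S g)"
proof -
  have "cycles_on S (g \<circ> s \<circ> s) = cycles_on S g"
    using inv by (intro cycles_on_cong stab_comp g s) auto
  then show ?thesis using card_cycles_on_triangle[OF stab_comp[OF g s] s] by simp
qed

text \<open>Compare \<open>g\<close> and \<open>s\<close> after multiplying both by the
  transposition of the crossing pair: it merges two cycles of \<open>g\<close> and breaks one pair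
  of \<open>s\<close>. Each effect improves the genus bound by one.\<close>

lemma card_cycles_on_genus_through:
  assumes g: "stab g S" and s: "stab s S" and inv: "\<And>x. x \<in> S \<Longrightarrow> s (s x) = x"
    and x: "x \<in> S" "s x \<notin> orbit g x"
  shows "card (cycles_on S s) + card (cycles_on S (g \<circ> s)) + 2 \<le> card S + card (cycles_on S g)"
proof -
  let ?t = "transpose x (s x)"
  have y: "s x \<in> S" using stabD[OF s] x by simp
  have ne: "x \<noteq> s x" using x self_in_orbit[OF g] by metis
  have t: "stab ?t S" by (rule stab_transpose[OF stab_finite[OF s] x(1) y])
  have "card (cycles_on S g) = card (cycles_on S (g \<circ> ?t)) + 1"
    using card_cycles_on_merge[OF g x(1) y x(2)] .
  moreover have "card (cycles_on S (s \<circ> ?t)) = card (cycles_on S s) + 1"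
    using card_cycles_on_split[OF s x(1) y orbit.base ne] .
  moreover have "cycles_on S (g \<circ> s \<circ> (s \<circ> ?t)) = cycles_on S (g \<circ> ?t)"
    using inv stabD[OF t] by (intro cycles_on_cong stab_comp g s t) auto
  ultimately show ?thesis
    using card_cycles_on_triangle[OF stab_comp[OF g s] stab_comp[OF s t]] by simp
qed

section \<open>Trees by counting\<close>

definition uwf :: "('v, 'e) ugraph \<Rightarrow> bool" where
  "uwf H \<longleftrightarrow> finite (uverts H) \<and> finite (uedges H) \<and>
     (\<forall>e\<in>uedges H. \<exists>x\<in>uverts H. \<exists>y\<in>uverts H. uends H e = {x, y})"

definition adj :: "('e \<Rightarrow> 'v set) \<Rightarrow> 'e set \<Rightarrow> ('v \<times> 'v) set" where
  "adj ends F = {(x, y). \<exists>e\<in>F. ends e = {x, y}}"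

lemma uconnected_adj:
  "uconnected H \<longleftrightarrow> uverts H \<noteq> {} \<and>
     (\<forall>u\<in>uverts H. \<forall>v\<in>uverts H. (u, v) \<in> (adj (uends H) (uedges H))\<^sup>*)"
  by (simp add: uconnected_def adj_def)

lemma adj_mono: "F \<subseteq> F' \<Longrightarrow> adj ends F \<subseteq> adj ends F'"
  by (auto simp: adj_def)

lemma uwf_ends_subset: "uwf H \<Longrightarrow> e \<in> uedges H \<Longrightarrow> uends H e \<subseteq> uverts H"
  by (force simp: uwf_def)

lemma rtrancl_leaves:
  assumes "(x, y) \<in> r\<^sup>*" "x \<in> W" "y \<notin> W"
  shows "\<exists>u v. (u, v) \<in> r \<and> u \<in> W \<and> v \<notin> W"
  using assms by (induction rule: rtrancl_induct) auto

section \<open>Edge counts of connected graphs\<close>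

text \<open>\<open>W\<close> is enlarged by one vertex at a time along an edge that leaves it. No
  chosen edge lies inside \<open>W\<close>; with \<open>W\<close> the vertices of a circuit, this
  makes the forest disjoint from the edges of the circuit.\<close>

lemma exists_spanning_forest_over:
  assumes wf: "uwf H" and con: "uconnected H" and W: "W \<subseteq> uverts H" "W \<noteq> {}"
  shows "\<exists>F \<subseteq> {e \<in> uedges H. \<not> uends H e \<subseteq> W}. card F + card W = card (uverts H) \<and>
    (\<forall>v\<in>uverts H. \<exists>w\<in>W. (w, v) \<in> (adj (uends H) F)\<^sup>*)"
  using W
proof (induction "card (uverts H - W)" arbitrary: W)
  case 0
  then have "W = uverts H" using wf by (auto simp: uwf_def)
  then show ?case by (intro exI[of _ "{}"]) auto
next
  case (Suc n)
  then have "uverts H - W \<noteq> {}" by force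
  then obtain w v where "w \<in> W" "v \<in> uverts H" "v \<notin> W" using Suc.prems by blast
  then obtain x y where xy: "(x, y) \<in> adj (uends H) (uedges H)" "x \<in> W" "y \<notin> W"
    using con Suc.prems rtrancl_leaves[of w v _ W] unfolding uconnected_adj by blast
  then obtain e where e: "e \<in> uedges H" "uends H e = {x, y}" by (auto simp: adj_def)
  then have y: "y \<in> uverts H" using wf by (fastforce simp: uwf_def)
  have "uverts H - insert y W = (uverts H - W) - {y}" by blast
  then have "n = card (uverts H - insert y W)" using Suc.hyps(2) y xy by simp
  from Suc.hyps(1)[OF this] Suc.prems y obtain F where
    F: "F \<subseteq> {e \<in> uedges H. \<not> uends H e \<subseteq> insert y W}" "card F + card (insert y W) = card (uverts H)"
      "\<forall>v\<in>uverts H. \<exists>w\<in>insert y W. (w, v) \<in> (adj (uends H) F)\<^sup>*"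
    by auto
  have "finite W" "finite F" using Suc.prems F(1) wf by (auto simp: uwf_def intro: finite_subset)
  moreover have "e \<notin> F" using F(1) e xy by auto
  ultimately have "card (insert e F) + card W = card (uverts H)" using F(2) xy by simp
  moreover have "insert e F \<subseteq> {e \<in> uedges H. \<not> uends H e \<subseteq> W}" using F(1) e xy by auto
  moreover have "\<exists>w\<in>W. (w, v) \<in> (adj (uends H) (insert e F))\<^sup>*" if v: "v \<in> uverts H" for v
  proof -
    obtain w where w: "w \<in> insert y W" "(w, v) \<in> (adj (uends H) F)\<^sup>*" using F(3) v by blast
    then have wv: "(w, v) \<in> (adj (uends H) (insert e F))\<^sup>*"
      using rtrancl_mono[OF adj_mono[of F "insert e F"]] by blast
    show ?thesis
    proof (cases "w = y")
      case True
      have "(x, y) \<in> adj (uends H) (insert e F)" using e by (auto simp: adj_def)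
      then show ?thesis using wv True xy(2) by (meson converse_rtrancl_into_rtrancl)
    qed (use w wv in auto)
  qed
  ultimately show ?case by blast
qed

lemma uconnected_card_le:
  assumes "uwf H" "uconnected H"
  shows "card (uverts H) \<le> card (uedges H) + 1"
proof -
  obtain v where "v \<in> uverts H" using assms(2) by (auto simp: uconnected_def)
  then obtain F where "F \<subseteq> uedges H" "card F + card {v} = card (uverts H)"
    using exists_spanning_forest_over[OF assms, of "{v}"] by auto
  then show ?thesis using card_mono[of "uedges H" F] assms(1) by (simp add: uwf_def)
qed

lemma sum_udegree:
  assumes "uwf H"
  shows "(\<Sum>v\<in>uverts H. udegree H v) = 2 * card (uedges H)"
proof -
  let ?V = "uverts H" and ?E = "uedges H"
  have fin: "finite ?V" "finite ?E" using assms by (auto simp: uwf_def)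
  have "udegree H v = (\<Sum>e\<in>?E. of_bool (v \<in> uends H e) + of_bool (uends H e = {v}))" for v
    using fin by (simp add: udegree_def sum.distrib Int_def of_bool_def sum.If_cases)
  then have "(\<Sum>v\<in>?V. udegree H v) =
      (\<Sum>v\<in>?V. \<Sum>e\<in>?E. of_bool (v \<in> uends H e) + of_bool (uends H e = {v}))" by simp
  also have "\<dots> = (\<Sum>e\<in>?E. \<Sum>v\<in>?V. of_bool (v \<in> uends H e) + of_bool (uends H e = {v}))"
    by (rule sum.swap)
  also have "\<dots> = (\<Sum>e\<in>?E. 2)"
  proof (rule sum.cong[OF refl])
    fix e assume "e \<in> ?E"
    then obtain x y where xy: "x \<in> ?V" "y \<in> ?V" "uends H e = {x, y}" using assms by (auto simp: uwf_def)
    have "(\<Sum>v\<in>?V. of_bool (v \<in> uends H e) + of_bool (uends H e = {v})) =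
      card {v \<in> ?V. v \<in> {x, y}} + card {v \<in> ?V. {x, y} = {v}}"
      using fin xy by (simp add: sum.distrib Int_def of_bool_def sum.If_cases)
    also have "\<dots> = 2"
    proof (cases "x = y")
      case True
      then have "{v \<in> ?V. v \<in> {x, y}} = {x}" "{v \<in> ?V. {x, y} = {v}} = {x}" using xy by auto
      then show ?thesis by simp
    next
      case False
      then have "{v \<in> ?V. v \<in> {x, y}} = {x, y}" "{v \<in> ?V. {x, y} = {v}} = {}" using xy by auto
      then show ?thesis using False by simp
    qed
    finally show "(\<Sum>v\<in>?V. of_bool (v \<in> uends H e) + of_bool (uends H e = {v})) = (2::nat)" .
  qed
  finally show ?thesis by simp
qed

lemma usubgraph_verts: "usubgraph K H \<Longrightarrow> uverts K \<subseteq> uverts H"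
  by (simp add: usubgraph_def)

lemma usubgraph_edges: "usubgraph K H \<Longrightarrow> uedges K \<subseteq> uedges H"
  by (simp add: usubgraph_def)

lemma usubgraph_ends: "usubgraph K H \<Longrightarrow> uends K = uends H"
  by (simp add: usubgraph_def)

lemma usubgraph_inc: "usubgraph K H \<Longrightarrow> e \<in> uedges K \<Longrightarrow> uends K e \<subseteq> uverts K"
  unfolding usubgraph_def by metis

lemma uwf_usubgraph: "uwf H \<Longrightarrow> usubgraph K H \<Longrightarrow> uwf K"
proof -
  assume wf: "uwf H" and sub: "usubgraph K H"
  have "\<exists>x\<in>uverts K. \<exists>y\<in>uverts K. uends K e = {x, y}" if e: "e \<in> uedges K" for e
  proof -
    have "e \<in> uedges H" "uends K e \<subseteq> uverts K" "uends K = uends H"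
      using usubgraph_edges[OF sub] usubgraph_inc[OF sub e] usubgraph_ends[OF sub] e by auto
    moreover then obtain x y where "uends H e = {x, y}" using wf by (auto simp: uwf_def)
    ultimately show ?thesis by auto
  qed
  then show ?thesis
    using wf usubgraph_verts[OF sub] usubgraph_edges[OF sub] by (auto simp: uwf_def intro: finite_subset)
qed

lemma circuit_card:
  assumes "uwf H" "circuit H K"
  shows "card (uedges K) = card (uverts K)"
proof -
  have "uwf K" using assms uwf_usubgraph by (auto simp: circuit_def)
  moreover have "(\<Sum>v\<in>uverts K. udegree K v) = (\<Sum>v\<in>uverts K. 2)"
    using assms(2) by (intro sum.cong) (auto simp: circuit_def)
  ultimately show ?thesis using sum_udegree[of K] by simp
qed

text \<open>The circuit has as many edges as vertices, and a forest grown over it brings one further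
  edge for each remaining vertex.\<close>

lemma circuit_imp_card_le:
  assumes wf: "uwf H" and con: "uconnected H" and K: "circuit H K"
  shows "card (uverts H) \<le> card (uedges H)"
proof -
  have sub: "usubgraph K H" and "uconnected K" using K by (simp_all add: circuit_def)
  then have K': "uverts K \<subseteq> uverts H" "uverts K \<noteq> {}" "uedges K \<subseteq> uedges H"
    "\<forall>e\<in>uedges K. uends H e \<subseteq> uverts K"
    using usubgraph_inc[OF sub] usubgraph_ends[OF sub]
    by (simp_all add: usubgraph_verts usubgraph_edges uconnected_def)
  obtain F where F: "F \<subseteq> {e \<in> uedges H. \<not> uends H e \<subseteq> uverts K}"
      "card F + card (uverts K) = card (uverts H)"
    using exists_spanning_forest_over[OF wf con K'(1,2)] by blast
  have fin: "finite (uedges H)" using wf by (simp add: uwf_def)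
  have "F \<inter> uedges K = {}" using F(1) K'(4) by blast
  then have "card F + card (uedges K) = card (F \<union> uedges K)"
    using fin F(1) K'(3) by (intro card_Un_disjoint[symmetric]) (auto intro: finite_subset)
  also have "\<dots> \<le> card (uedges H)" using fin F(1) K'(3) by (intro card_mono) auto
  finally show ?thesis using F(2) circuit_card[OF wf K] by simp
qed

text \<open>The retraction \<open>?r\<close>, which folds the leaf \<open>v\<close> onto its
  neighbour \<open>u\<close>, carries every path to a path that avoids \<open>v\<close>.\<close>

lemma uconnected_remove_leaf:
  assumes con: "uconnected H" and e: "uends H e = {u, v}" "u \<noteq> v" "u \<in> uverts H"
    and leaf: "\<And>f. f \<in> uedges H \<Longrightarrow> v \<in> uends H f \<Longrightarrow> f = e"
  shows "uconnected \<lparr>uverts = uverts H - {v}, uedges = uedges H - {e}, uends = uends H\<rparr>"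
proof -
  let ?r = "\<lambda>x. if x = v then u else x" and ?A = "(adj (uends H) (uedges H - {e}))\<^sup>*"
  have adj_step: "(?r x, ?r y) \<in> ?A" if xy: "(x, y) \<in> adj (uends H) (uedges H)" for x y
  proof -
    obtain f where f: "f \<in> uedges H" "uends H f = {x, y}" using xy by (auto simp: adj_def)
    show ?thesis
    proof (cases "f = e")
      case True
      then have "?r x = ?r y" using f e by (auto simp: doubleton_eq_iff)
      then show ?thesis by simp
    next
      case False
      then have "v \<notin> {x, y}" using leaf[of f] f by metis
      then have "?r x = x" "?r y = y" by auto
      moreover have "(x, y) \<in> adj (uends H) (uedges H - {e})" using f False by (auto simp: adj_def)
      ultimately show ?thesis by (simp only: r_into_rtrancl)
    qed
  qed
  have path: "(?r x, ?r y) \<in> ?A" if "(x, y) \<in> (adj (uends H) (uedges H))\<^sup>*" for x y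
    using that
  proof (induction rule: rtrancl_induct)
    case (step y z)
    show ?case by (rule rtrancl_trans[OF step.IH adj_step[OF step.hyps(2)]])
  qed simp
  have "(x, y) \<in> ?A" if xy: "x \<in> uverts H - {v}" "y \<in> uverts H - {v}" for x y
  proof -
    have "(x, y) \<in> (adj (uends H) (uedges H))\<^sup>*" using con xy by (simp add: uconnected_adj)
    from path[OF this] show ?thesis using xy by simp
  qed
  then show ?thesis using e unfolding uconnected_adj by auto
qed

lemma usubgraph_trans: "usubgraph K H \<Longrightarrow> usubgraph H H' \<Longrightarrow> usubgraph K H'"
  unfolding usubgraph_def by (metis subset_trans)

lemma circuit_usubgraph: "circuit H K \<Longrightarrow> usubgraph H H' \<Longrightarrow> circuit H' K"
  unfolding circuit_def using usubgraph_trans by blast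

text \<open>
  Removing a leaf preserves \<open>|E| = |V|\<close>; without leaves the degree sum \<open>2|V|\<close> forces all degrees to be 2.
\<close>

lemma exists_circuit_card_eq:
  assumes "uwf H" "uconnected H" "card (uedges H) = card (uverts H)"
  shows "\<exists>K. circuit H K"
  using assms
proof (induction "card (uverts H)" arbitrary: H rule: less_induct)
  case less
  note wf = less.prems(1) and con = less.prems(2)
  have fin: "finite (uverts H)" "finite (uedges H)" using wf by (auto simp: uwf_def)
  show ?case
  proof (cases "\<forall>v\<in>uverts H. udegree H v \<ge> 2")
    case True
    have "udegree H v = 2" if v: "v \<in> uverts H" for v
    proof (rule ccontr)
      assume "udegree H v \<noteq> 2"
      then have "(\<Sum>v\<in>uverts H. 2) < (\<Sum>v\<in>uverts H. udegree H v)"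
        using True v fin by (intro sum_strict_mono_ex1) force+
      then show False using sum_udegree[OF wf] less.prems(3) by simp
    qed
    moreover have "usubgraph H H" using uwf_ends_subset[OF wf] by (auto simp: usubgraph_def)
    ultimately show ?thesis using con by (intro exI[of _ H]) (simp add: circuit_def)
  next
    case False
    then obtain v where v: "v \<in> uverts H" "udegree H v < 2" by force
    let ?I = "{e \<in> uedges H. v \<in> uends H e}"
    have finI: "finite ?I" using fin by simp
    \<comment> \<open>An isolated vertex of a connected graph is the whole graph; it would have no
      edge, against the equality of the counts.\<close>
    have "?I \<noteq> {}"
    proof
      assume I: "?I = {}"
      have "uverts H = {v}"
      proof (rule ccontr)
        assume "uverts H \<noteq> {v}"
        then obtain u where "u \<in> uverts H" "u \<noteq> v" using v by blast
        then obtain x y where "(x, y) \<in> adj (uends H) (uedges H)" "x \<in> {v}"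
          using con v rtrancl_leaves[of v u _ "{v}"] unfolding uconnected_adj by blast
        then show False using I by (auto simp: adj_def)
      qed
      then have "uedges H = {}" using I wf by (fastforce simp: uwf_def)
      then show False using \<open>uverts H = {v}\<close> less.prems(3) by simp
    qed
    then obtain e where e: "e \<in> uedges H" "v \<in> uends H e" by blast
    have "card ?I > 0" using \<open>?I \<noteq> {}\<close> finI by (simp add: card_gt_0_iff)
    then have "card ?I = 1" and "card {e \<in> uedges H. uends H e = {v}} = 0"
      using v(2) by (auto simp: udegree_def)
    then have noloop: "uends H e \<noteq> {v}" and leaf: "\<And>f. f \<in> ?I \<Longrightarrow> f = e"
      using fin e by (simp, metis (no_types, lifting) card_1_singletonE mem_Collect_eq singletonD)
    obtain u where u: "u \<in> uverts H" "uends H e = {u, v}"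
      using wf e unfolding uwf_def by (metis insert_commute insert_iff singletonD)
    then have uv: "u \<noteq> v" using noloop by auto
    let ?H = "\<lparr>uverts = uverts H - {v}, uedges = uedges H - {e}, uends = uends H\<rparr>"
    have "uconnected ?H" using uconnected_remove_leaf[OF con u(2) uv u(1)] leaf by blast
    moreover have "\<exists>x\<in>uverts H - {v}. \<exists>y\<in>uverts H - {v}. uends H f = {x, y}"
      if f: "f \<in> uedges H - {e}" for f
    proof -
      obtain x y where xy: "x \<in> uverts H" "y \<in> uverts H" "uends H f = {x, y}"
        using wf f by (auto simp: uwf_def)
      have "v \<notin> uends H f" using leaf[of f] f by blast
      then have "x \<in> uverts H - {v}" "y \<in> uverts H - {v}" using xy by auto
      then show ?thesis using xy(3) by blast
    qed
    then have wf': "uwf ?H" using fin by (simp add: uwf_def)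
    moreover have "card (uedges H - {e}) = card (uverts H - {v})"
      using fin e(1) v(1) less.prems(3) by simp
    moreover have "card (uverts H - {v}) < card (uverts H)" using fin v(1) by (meson card_Diff1_less)
    ultimately obtain K where "circuit ?H K" using less.hyps[of ?H] by auto
    moreover have "usubgraph ?H H" using uwf_ends_subset[OF wf'] by (auto simp: usubgraph_def)
    ultimately show ?thesis using circuit_usubgraph by blast
  qed
qed

text \<open>A spanning tree with one additional edge is a connected subgraph with equally many edges
  and vertices, so the equality case applies to it.\<close>

lemma exists_circuit:
  assumes wf: "uwf H" and con: "uconnected H" and ge: "card (uverts H) \<le> card (uedges H)"
  shows "\<exists>K. circuit H K"
proof -
  obtain v where v: "v \<in> uverts H" using con by (auto simp: uconnected_def)
  then obtain F where F: "F \<subseteq> uedges H" "card F + 1 = card (uverts H)"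
      "\<forall>u\<in>uverts H. (v, u) \<in> (adj (uends H) F)\<^sup>*"
    using exists_spanning_forest_over[OF wf con, of "{v}"] by auto
  have fin: "finite (uedges H)" using wf by (simp add: uwf_def)
  have "F \<noteq> uedges H" using F(2) ge by auto
  then obtain e where e: "e \<in> uedges H" "e \<notin> F" using F(1) by blast
  let ?K = "\<lparr>uverts = uverts H, uedges = insert e F, uends = uends H\<rparr>"
  have sub: "usubgraph ?K H" using F(1) e uwf_ends_subset[OF wf] by (auto simp: usubgraph_def)
  have sym: "sym ((adj (uends H) (insert e F))\<^sup>*)"
    by (intro sym_rtrancl symI) (auto simp: adj_def insert_commute)
  have "(v, u) \<in> (adj (uends H) (insert e F))\<^sup>*" if "u \<in> uverts H" for u
    using F(3) that rtrancl_mono[OF adj_mono[of F "insert e F"]] by blast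
  then have "uconnected ?K"
    using v sym unfolding uconnected_adj by (auto intro: rtrancl_trans dest: symD)
  moreover have "card (insert e F) = card (uverts H)"
    using F e fin by (simp add: finite_subset)
  ultimately show ?thesis
    using exists_circuit_card_eq[OF uwf_usubgraph[OF wf sub]] circuit_usubgraph[OF _ sub] by auto
qed

text \<open>This replaces the search for circuits by arithmetic: connectedness gives one inequality,
  and the other fails exactly if a circuit exists.\<close>

lemma utree_iff_card:
  assumes "uwf H"
  shows "utree H \<longleftrightarrow> uconnected H \<and> card (uverts H) = card (uedges H) + 1"
proof (cases "uconnected H")
  case True
  then show ?thesis
    using uconnected_card_le[OF assms True] exists_circuit[OF assms True]
      circuit_imp_card_le[OF assms True] unfolding utree_def
    by (metis Suc_eq_plus1 le_antisym not_less_eq_eq)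
qed (simp add: utree_def)

section \<open>Graphs with a distinguished loop\<close>

context
  fixes H :: "('v, 'e) ugraph" and c w
  assumes wf: "uwf H" and c: "c \<in> uedges H" "uends H c = {w}"
begin

lemma loop_vertex_in: "w \<in> uverts H"
  using wf c by (auto simp: uwf_def)

lemma uconnected_remove_loop:
  "uconnected (H\<lparr>uedges := uedges H - {c}\<rparr>) \<longleftrightarrow> uconnected H"
proof -
  have "(adj (uends H) (uedges H))\<^sup>* = (adj (uends H) (uedges H - {c}))\<^sup>*"
  proof
    have "adj (uends H) (uedges H) \<subseteq> (adj (uends H) (uedges H - {c}))\<^sup>*"
    proof clarify
      fix x y assume "(x, y) \<in> adj (uends H) (uedges H)"
      then obtain f where f: "f \<in> uedges H" "uends H f = {x, y}" by (auto simp: adj_def)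
      show "(x, y) \<in> (adj (uends H) (uedges H - {c}))\<^sup>*"
      proof (cases "f = c")
        case True
        then have "x = y" using f c by auto
        then show ?thesis by simp
      next
        case False
        then show ?thesis using f by (intro r_into_rtrancl) (auto simp: adj_def)
      qed
    qed
    then show "(adj (uends H) (uedges H))\<^sup>* \<subseteq> (adj (uends H) (uedges H - {c}))\<^sup>*"
      by (rule rtrancl_subset_rtrancl)
    show "(adj (uends H) (uedges H - {c}))\<^sup>* \<subseteq> (adj (uends H) (uedges H))\<^sup>*"
      by (intro rtrancl_mono adj_mono) auto
  qed
  then show ?thesis by (simp add: uconnected_adj)
qed

lemma circuit_loop: "circuit H \<lparr>uverts = {w}, uedges = {c}, uends = uends H\<rparr>" (is "circuit H ?K")
proof -
  have "{e. e = c \<and> w \<in> uends H e} = {c}" "{e. e = c \<and> uends H e = {w}} = {c}" using c by auto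
  then have "udegree ?K w = 2" by (simp add: udegree_def)
  then show ?thesis using c loop_vertex_in by (auto simp: circuit_def usubgraph_def uconnected_def)
qed

lemma circuit_remove_loop:
  "circuit (H\<lparr>uedges := uedges H - {c}\<rparr>) K \<longleftrightarrow> circuit H K \<and> c \<notin> uedges K"
  by (simp add: circuit_def usubgraph_def subset_Diff_insert) argo

text \<open>A loop alone already gives its vertex degree 2. No other edge of the circuit can meet
  \<open>w\<close>, and connectedness leaves no further vertex.\<close>

lemma circuit_contains_loop:
  assumes K: "circuit H K" and cK: "c \<in> uedges K"
  shows "K = \<lparr>uverts = {w}, uedges = {c}, uends = uends H\<rparr>"
proof -
  have K': "usubgraph K H" and con: "uconnected K" and deg: "\<forall>v\<in>uverts K. udegree K v = 2"
    using K by (simp_all add: circuit_def)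
  note ends = usubgraph_ends[OF K'] and sub = usubgraph_edges[OF K']
    and inc = usubgraph_inc[OF K']
  have w: "w \<in> uverts K" using inc cK c ends by force
  let ?I = "{e \<in> uedges K. w \<in> uends K e}" and ?L = "{e \<in> uedges K. uends K e = {w}}"
  have fin: "finite ?I" "finite ?L" using sub wf by (auto simp: uwf_def intro: finite_subset)
  have cI: "c \<in> ?I" "c \<in> ?L" using c cK ends by auto
  then have "card ?I > 0" "card ?L > 0" using fin by (auto simp only: card_gt_0_iff)
  \<comment> \<open>The degree 2 is the sum of two positive cardinalities, so each of them is
    1.\<close>
  then have "card ?I = 1" using deg w by (force simp: udegree_def)
  then have only: "f = c" if "f \<in> ?I" for f using cI that by (metis card_1_singletonE singletonD)
  have V: "uverts K = {w}"
  proof (rule ccontr)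
    assume "uverts K \<noteq> {w}"
    then obtain u where "u \<in> uverts K" "u \<noteq> w" using w by blast
    then obtain x y where "(x, y) \<in> adj (uends K) (uedges K)" "x = w" "y \<noteq> w"
      using con w rtrancl_leaves[of w u _ "{w}"] unfolding uconnected_adj by blast
    then obtain f where "f \<in> uedges K" "uends K f = {w, y}" by (auto simp: adj_def)
    then show False using only[of f] c ends \<open>y \<noteq> w\<close> by auto
  qed
  have "f = c" if f: "f \<in> uedges K" for f
  proof -
    have "uends K f \<noteq> {}" using f sub wf ends by (auto simp: uwf_def)
    then show ?thesis using inc[OF f] f V only[of f] by auto
  qed
  then have "uedges K = {c}" using cK by blast
  then show ?thesis using V ends by (simp add: ugraph.equality)
qed

text \<open>A connected graph whose only circuit is the given loop is a tree with a loop attached.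
  All circuits other than the loop survive its removal.\<close>

lemma unique_circuit_loop_iff:
  "uconnected H \<and> (\<exists>!K. circuit H K) \<longleftrightarrow> utree (H\<lparr>uedges := uedges H - {c}\<rparr>)"
  unfolding utree_def uconnected_remove_loop circuit_remove_loop
  using circuit_loop circuit_contains_loop by (metis select_convs(2) singletonI)

end

section \<open>Double trees as pairings of arcs\<close>

definition arc_class :: "('v, 'e) pre_digraph \<Rightarrow> 'e \<Rightarrow> 'e set" where
  "arc_class G x = {y \<in> arcs G. {tail G y, head G y} = {tail G x, head G x}}"

lemma uedges_elementarization: "uedges (elementarization G) = arc_class G ` arcs G"
  by (auto simp: elementarization_def quotient_def equiv_arcs_def arc_class_def image_iff Image_def)

lemma uverts_elementarization: "uverts (elementarization G) = verts G"
  by (simp add: elementarization_def)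

lemma uends_elementarization:
  "x \<in> arcs G \<Longrightarrow> uends (elementarization G) (arc_class G x) = {tail G x, head G x}"
  by (auto simp: elementarization_def arc_class_def)

lemma in_arc_class: "x \<in> arcs G \<Longrightarrow> x \<in> arc_class G x"
  by (simp add: arc_class_def)

lemma arc_class_eq: "y \<in> arc_class G x \<Longrightarrow> arc_class G y = arc_class G x"
  by (auto simp: arc_class_def)

lemma partition_arc_class: "partition_on (arcs G) (arc_class G ` arcs G)"
proof (rule partition_onI)
  show "\<Union>(arc_class G ` arcs G) = arcs G" by (auto simp: arc_class_def)
  show "{} \<notin> arc_class G ` arcs G" using in_arc_class by fastforce
  show "disjnt p q" if "p \<in> arc_class G ` arcs G" "q \<in> arc_class G ` arcs G" "p \<noteq> q" for p q
    using that arc_class_eq unfolding disjnt_iff by (metis imageE)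
qed

text \<open>The classes of the other arcs are untouched when a whole class disappears. In this way
  one loop of the elementarization corresponds to a pair of loop arcs.\<close>

lemma elementarization_remove_class:
  assumes "x \<in> arcs G"
  shows "elementarization (G\<lparr>arcs := arcs G - arc_class G x\<rparr>) =
    elementarization G\<lparr>uedges := uedges (elementarization G) - {arc_class G x}\<rparr>"
proof -
  let ?G = "G\<lparr>arcs := arcs G - arc_class G x\<rparr>"
  have 1: "arc_class ?G y = arc_class G y" if "y \<in> arcs G - arc_class G x" for y
    using that by (auto simp: arc_class_def)
  have 2: "arc_class G y = arc_class G x \<longleftrightarrow> y \<in> arc_class G x" if "y \<in> arcs G" for y
    using that in_arc_class arc_class_eq by metis
  have "arc_class ?G ` (arcs G - arc_class G x) = arc_class G ` (arcs G - arc_class G x)"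
    using 1 by (intro image_cong) auto
  also have "\<dots> = arc_class G ` arcs G - {arc_class G x}" using 2 by blast
  finally have "uedges (elementarization ?G) = uedges (elementarization G) - {arc_class G x}"
    by (simp add: uedges_elementarization)
  then show ?thesis by (simp add: elementarization_def)
qed

definition dwf :: "('v, 'e) pre_digraph \<Rightarrow> bool" where
  "dwf G \<longleftrightarrow> finite (verts G) \<and> finite (arcs G) \<and> tail G ` arcs G \<subseteq> verts G \<and> head G ` arcs G \<subseteq> verts G"

lemma uwf_elementarization: "dwf G \<Longrightarrow> uwf (elementarization G)"
proof -
  assume wf: "dwf G"
  have "\<exists>x\<in>verts G. \<exists>y\<in>verts G. uends (elementarization G) (arc_class G e) = {x, y}"
    if e: "e \<in> arcs G" for e
    using wf e uends_elementarization[OF e] unfolding dwf_def by blast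
  then show ?thesis
    using wf by (simp add: uwf_def uverts_elementarization uedges_elementarization dwf_def)
qed

definition opposite_pairing :: "('v, 'e) pre_digraph \<Rightarrow> ('e \<Rightarrow> 'e) \<Rightarrow> bool" where
  "opposite_pairing G t \<longleftrightarrow>
     (\<forall>x\<in>arcs G. t x \<in> arcs G \<and> t x \<noteq> x \<and> t (t x) = x \<and> opposite G x (t x))"

lemma double_tree_imp_pairing:
  assumes wf: "dwf G" and dt: "double_tree G"
  shows "2 * card (verts G) = card (arcs G) + 2" "\<exists>t. opposite_pairing G t"
proof -
  have do: "\<forall>C\<in>arc_class G ` arcs G. card C = 2 \<and> (\<forall>e\<in>C. \<forall>f\<in>C. e \<noteq> f \<longrightarrow> opposite G e f)"
    using dt by (simp add: double_tree_def double_opposite_def uedges_elementarization)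
  have c2: "card (arc_class G x) = 2" if "x \<in> arcs G" for x using do that by simp
  have opp: "opposite G x y" if "x \<in> arcs G" "y \<in> arc_class G x" "x \<noteq> y" for x y
    using do that in_arc_class[OF that(1)] by simp
  have "card (arcs G) = (\<Sum>C\<in>arc_class G ` arcs G. card C)"
    using wf by (intro product_partition[OF partition_arc_class]) (auto simp: dwf_def arc_class_def)
  also have "\<dots> = (\<Sum>C\<in>arc_class G ` arcs G. 2)" using c2 by (intro sum.cong) auto
  finally have "card (arcs G) = 2 * card (uedges (elementarization G))"
    by (simp add: uedges_elementarization)
  moreover have "card (uverts (elementarization G)) = card (uedges (elementarization G)) + 1"
    using dt utree_iff_card[OF uwf_elementarization[OF wf]] by (simp add: double_tree_def)
  ultimately show "2 * card (verts G) = card (arcs G) + 2" by (simp add: uverts_elementarization)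
  have "\<forall>x\<in>arcs G. \<exists>y. y \<noteq> x \<and> arc_class G x = {x, y}"
  proof
    fix x assume x: "x \<in> arcs G"
    obtain u v where "arc_class G x = {u, v}" "u \<noteq> v" using c2[OF x] unfolding card_2_iff by metis
    then show "\<exists>y. y \<noteq> x \<and> arc_class G x = {x, y}" using in_arc_class[OF x] by auto
  qed
  then obtain t where t: "\<And>x. x \<in> arcs G \<Longrightarrow> t x \<noteq> x \<and> arc_class G x = {x, t x}" by metis
  have "t x \<in> arcs G \<and> t x \<noteq> x \<and> t (t x) = x \<and> opposite G x (t x)" if x: "x \<in> arcs G" for x
  proof -
    have tx: "t x \<in> arc_class G x" using t[OF x] by blast
    then have tG: "t x \<in> arcs G" by (simp add: arc_class_def)
    have "{t x, t (t x)} = {x, t x}" using t[OF x] t[OF tG] arc_class_eq[OF tx] by simp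
    then have "t (t x) = x" using t[OF tG] by (auto simp: doubleton_eq_iff)
    then show ?thesis using tG t[OF x] opp[OF x tx] by auto
  qed
  then show "\<exists>t. opposite_pairing G t" by (auto simp: opposite_pairing_def)
qed

text \<open>Connectedness forces at least \<open>card (verts G) - 1\<close> classes, and each
  contains a pair of \<open>t\<close>. The number of arcs is only twice that, so the classes are
  exactly the pairs and their number is that of a tree.\<close>

lemma pairing_imp_double_tree:
  assumes wf: "dwf G" and con: "uconnected (elementarization G)"
    and card: "2 * card (verts G) = card (arcs G) + 2" and t: "opposite_pairing G t"
  shows "double_tree G" and "\<And>x. x \<in> arcs G \<Longrightarrow> arc_class G x = {x, t x}"
proof -
  let ?E = "arc_class G ` arcs G"
  have fin: "finite (arcs G)" using wf by (simp add: dwf_def)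
  have sub: "{x, t x} \<subseteq> arc_class G x" if "x \<in> arcs G" for x
    using that t by (auto simp: opposite_pairing_def arc_class_def opposite_def)
  have finC: "finite C" if "C \<in> ?E" for C using that fin by (auto simp: arc_class_def)
  have ge: "2 \<le> card C" if C: "C \<in> ?E" for C
  proof -
    obtain x where x: "x \<in> arcs G" "C = arc_class G x" using C by blast
    have "card {x, t x} = 2" using t x by (auto simp: opposite_pairing_def)
    then show ?thesis using card_mono[OF finC[OF C]] sub[OF x(1)] x(2) by metis
  qed
  have sum: "card (arcs G) = (\<Sum>C\<in>?E. card C)"
    by (intro product_partition[OF partition_arc_class] finC)
  have "card (verts G) \<le> card ?E + 1"
    using uconnected_card_le[OF uwf_elementarization[OF wf] con]
    by (simp add: uverts_elementarization uedges_elementarization)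
  then have le: "card (arcs G) \<le> 2 * card ?E" using card by simp
  have eq: "card C = 2" if C: "C \<in> ?E" for C
  proof (rule ccontr)
    assume "card C \<noteq> 2"
    then have "(\<Sum>C\<in>?E. 2) < (\<Sum>C\<in>?E. card C)"
      using C ge fin by (intro sum_strict_mono_ex1) force+
    then show False using le sum by simp
  qed
  show cls: "arc_class G x = {x, t x}" if "x \<in> arcs G" for x
  proof (rule card_seteq[symmetric])
    show "finite (arc_class G x)" "{x, t x} \<subseteq> arc_class G x" using finC sub that by auto
    show "card (arc_class G x) \<le> card {x, t x}"
      using eq that t by (auto simp: opposite_pairing_def)
  qed
  have "(\<Sum>C\<in>?E. card C) = 2 * card ?E" using eq by simp
  then have "utree (elementarization G)"
    using utree_iff_card[OF uwf_elementarization[OF wf]] con card sum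
    by (simp add: uverts_elementarization uedges_elementarization)
  moreover have "opposite G x y" if "C \<in> ?E" "x \<in> C" "y \<in> C" "x \<noteq> y" for C x y
  proof -
    have "x \<in> arcs G" "arc_class G x = C" using that arc_class_eq by (auto simp: arc_class_def)
    then have "y = t x" using cls[of x] that by auto
    then show ?thesis using t \<open>x \<in> arcs G\<close> by (simp add: opposite_pairing_def)
  qed
  ultimately show "double_tree G"
    using eq by (auto simp: double_tree_def double_opposite_def uedges_elementarization)
qed

lemma double_tree_no_loop:
  assumes wf: "dwf G" and dt: "double_tree G" and x: "x \<in> arcs G"
  shows "tail G x \<noteq> head G x"
proof
  assume "tail G x = head G x"
  then have "uends (elementarization G) (arc_class G x) = {head G x}"
    using uends_elementarization[OF x] by simp
  moreover have "arc_class G x \<in> uedges (elementarization G)"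
    using x by (simp add: uedges_elementarization)
  ultimately show False
    using circuit_loop[OF uwf_elementarization[OF wf]] dt unfolding double_tree_def utree_def by blast
qed

section \<open>Quotient graphs of a permutation\<close>

lemma block_of_eq: "partition_on S P \<Longrightarrow> B \<in> P \<Longrightarrow> x \<in> B \<Longrightarrow> block_of P x = B"
  unfolding block_of_def by (intro the_equality) (auto simp: partition_on_def disjoint_def)

lemma block_of_mem:
  assumes "partition_on S P" "x \<in> S"
  shows "block_of P x \<in> P" "x \<in> block_of P x"
proof -
  obtain B where "B \<in> P" "x \<in> B" using assms by (auto simp: partition_on_def)
  then show "block_of P x \<in> P" "x \<in> block_of P x" using block_of_eq[OF assms(1)] by simp_all
qed

lemma block_of_eq_iff:
  assumes "partition_on S P" "x \<in> S" "y \<in> S"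
  shows "block_of P x = block_of P y \<longleftrightarrow> y \<in> block_of P x"
  using block_of_mem[OF assms(1)] block_of_eq[OF assms(1)] assms(2,3) by metis

lemma partition_eq_blocks: "partition_on S P \<Longrightarrow> P = block_of P ` S"
proof
  assume P: "partition_on S P"
  show "block_of P ` S \<subseteq> P" using block_of_mem[OF P] by blast
  show "P \<subseteq> block_of P ` S"
  proof
    fix B assume B: "B \<in> P"
    then obtain x where "x \<in> B" using P by (metis equals0I partition_onD3)
    then show "B \<in> block_of P ` S"
      using B block_of_eq[OF P] partition_onD1[OF P] by blast
  qed
qed

lemma block_of_cycles_on:
  assumes "stab h S" "x \<in> S"
  shows "block_of (cycles_on S h) x = orbit h x"
  using block_of_eq[OF partition_cycles_on[OF assms(1)], of "orbit h x" x] assms(2)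
    self_in_orbit[OF assms(1)] by (simp add: cycles_on_def)

lemma block_of_orbit:
  assumes h: "stab h S" and inv: "\<And>x. x \<in> S \<Longrightarrow> block_of P (h x) = block_of P x"
    and x: "x \<in> S" and y: "y \<in> orbit h x"
  shows "block_of P y = block_of P x"
proof -
  have "orbit h x \<subseteq> {y \<in> S. block_of P y = block_of P x}"
    using x inv stabD[OF h] by (intro orbit_closed_subset) auto
  then show ?thesis using y by blast
qed

text \<open>Blocks are unions of cycles, so the map from cycles to the blocks containing them is
  onto. If the numbers agree it is injective, and every block is a single cycle.\<close>

lemma card_partition_le_cycles_on:
  assumes P: "partition_on S P" and h: "stab h S"
    and inv: "\<And>x. x \<in> S \<Longrightarrow> block_of P (h x) = block_of P x"
  shows "card P \<le> card (cycles_on S h)"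
    and "card (cycles_on S h) \<le> card P \<Longrightarrow> P = cycles_on S h"
proof -
  let ?f = "\<lambda>C. block_of P (SOME y. y \<in> C)"
  have f: "?f (orbit h x) = block_of P x" if "x \<in> S" for x
  proof -
    have "(SOME y. y \<in> orbit h x) \<in> orbit h x" using self_in_orbit[OF h] by (rule someI)
    then show ?thesis using block_of_orbit[OF h inv that] by simp
  qed
  have "?f ` cycles_on S h = block_of P ` S" using f by (simp add: cycles_on_def image_image)
  then have im: "?f ` cycles_on S h = P" using partition_eq_blocks[OF P] by simp
  have fin: "finite (cycles_on S h)" using h by (simp add: cycles_on_def stab_finite)
  show le: "card P \<le> card (cycles_on S h)" using card_image_le[OF fin, of ?f] im by simp
  assume "card (cycles_on S h) \<le> card P"
  then have inj: "inj_on ?f (cycles_on S h)" using im le fin by (intro eq_card_imp_inj_on) auto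
  have "block_of P x = orbit h x" if x: "x \<in> S" for x
  proof
    show "orbit h x \<subseteq> block_of P x"
      using block_of_orbit[OF h inv x] orbit_subset_stab[OF h x] block_of_mem[OF P] by blast
    show "block_of P x \<subseteq> orbit h x"
    proof
      fix y assume y: "y \<in> block_of P x"
      then have yS: "y \<in> S" using block_of_mem(1)[OF P x] partition_onD1[OF P] by blast
      then have "?f (orbit h x) = ?f (orbit h y)" using f x y block_of_eq_iff[OF P x yS] by simp
      then have "orbit h x = orbit h y"
        using inj x yS by (auto simp: cycles_on_def dest: inj_onD)
      then show "y \<in> orbit h x" using self_in_orbit[OF h] by simp
    qed
  qed
  then show "P = cycles_on S h" using partition_eq_blocks[OF P] by (simp add: cycles_on_def cong: image_cong)
qed

text \<open>The vertex set does not shrink with \<open>A\<close>: deleting the loops must keep the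
  vertex that carries them. With all points as arcs this is the quotient graph
  \<open>T_quot\<close>.\<close>

definition part_graph :: "('a \<Rightarrow> 'a) \<Rightarrow> 'a set set \<Rightarrow> 'a set \<Rightarrow> ('a set, 'a) pre_digraph" where
  "part_graph g P A = \<lparr>verts = P, arcs = A, tail = (\<lambda>x. block_of P (g x)), head = block_of P\<rparr>"

lemma dwf_part_graph:
  assumes "partition_on S P" "stab g S" "A \<subseteq> S"
  shows "dwf (part_graph g P A)"
proof -
  have "finite S" using assms(2) by (rule stab_finite)
  then have "finite P" "finite A" using assms finite_elements finite_subset by auto
  moreover have "block_of P (g x) \<in> P" "block_of P x \<in> P" if "x \<in> A" for x
    using that assms block_of_mem(1)[OF assms(1)] stabD[OF assms(2)] by auto
  ultimately show ?thesis by (auto simp: dwf_def part_graph_def)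
qed

text \<open>Being a permutation is asked globally, the rest only on \<open>S\<close>. The property
  therefore passes to invariant subsets and to unions.\<close>

definition pairing_except :: "'a set \<Rightarrow> 'a set \<Rightarrow> ('a \<Rightarrow> 'a) \<Rightarrow> bool" where
  "pairing_except S F s \<longleftrightarrow>
     permutation s \<and> (\<forall>x\<in>S. s x \<in> S \<and> s (s x) = x) \<and> {x \<in> S. s x = x} = F"

lemma pairing_except_stab: "finite S \<Longrightarrow> pairing_except S F s \<Longrightarrow> stab s S"
  by (auto simp: pairing_except_def stab_def)

lemma pairing_except_subset:
  "pairing_except S F s \<Longrightarrow> s ` T \<subseteq> T \<Longrightarrow> T \<subseteq> S \<Longrightarrow> pairing_except T (F \<inter> T) s"
  by (auto simp: pairing_except_def)

lemma card_cycles_on_pairing_except: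
  assumes "finite S" "pairing_except S F s"
  shows "2 * card (cycles_on S s) = card S + card F"
  using card_cycles_on_involution[OF pairing_except_stab[OF assms]] assms(2)
  by (auto simp: pairing_except_def)

text \<open>The pairing of the arcs is extended by fixing \<open>e\<close> and \<open>f\<close>.
  Opposite orientation of \<open>x\<close> and \<open>s x\<close> says that \<open>g (s x)\<close>
  lies in the block of \<open>x\<close>; at a loop the same equation holds with
  \<open>s x = x\<close>. A double tree with \<open>card P\<close> vertices has
  \<open>2 * card P - 2\<close> arcs, and the two loops complete this to
  \<open>card S\<close>.\<close>

lemma double_tree_imp_pairing_except:
  assumes P: "partition_on S P" and g: "stab g S"
    and e: "e \<in> S" "block_of P (g e) = block_of P e"
    and f: "f \<in> S" "block_of P (g f) = block_of P f" and ne: "e \<noteq> f"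
    and dt: "double_tree (part_graph g P (S - {e, f}))"
  obtains s where "s permutes S" "pairing_except S {e, f} s" "\<forall>x\<in>S. block_of P (g (s x)) = block_of P x"
    "2 * card P = card S"
proof -
  let ?A = "S - {e, f}"
  have wf: "dwf (part_graph g P ?A)" using dwf_part_graph[OF P g] by blast
  have "2 * card P = card ?A + 2"
    using double_tree_imp_pairing(1)[OF wf dt] by (simp add: part_graph_def)
  moreover have "card {e, f} \<le> card S"
    using e f stab_finite[OF g] by (intro card_mono) auto
  ultimately have card: "2 * card P = card S"
    using e f ne stab_finite[OF g] by (simp add: card_Diff_subset)
  obtain t where t: "opposite_pairing (part_graph g P ?A) t"
    using double_tree_imp_pairing(2)[OF wf dt] by blast
  have tA: "t x \<in> ?A" "t x \<noteq> x" "t (t x) = x" "block_of P (g (t x)) = block_of P x" if "x \<in> ?A" for x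
    using t that by (auto simp: opposite_pairing_def part_graph_def opposite_def)
  define s where "s x = (if x \<in> ?A then t x else x)" for x
  have ss: "s (s x) = x" for x using tA[of x] by (simp add: s_def)
  then have perm: "s permutes S" unfolding permutes_def by (metis DiffE s_def)
  moreover have "s x \<in> S" if "x \<in> S" for x using perm that by (simp add: permutes_in_image)
  moreover have "{x \<in> S. s x = x} = {e, f}" using tA(2) e f by (auto simp: s_def)
  ultimately have "pairing_except S {e, f} s"
    using ss stab_finite[OF g] by (auto simp: pairing_except_def permutation_permutes)
  moreover have "block_of P (g (s x)) = block_of P x" if "x \<in> S" for x
    using tA[of x] e f that by (auto simp: s_def)
  ultimately show ?thesis using card perm that by blast
qed

text \<open>Following \<open>g\<close> is walking in the graph, since the deleted arcs are loops.
  The condition on \<open>r\<close> covers a single cycle as well as two cycles that meet in one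
  vertex.\<close>

lemma uconnected_part_graph:
  assumes P: "partition_on S P" and g: "stab g S"
    and loop: "\<And>x. x \<in> S - A \<Longrightarrow> block_of P (g x) = block_of P x" and A: "A \<subseteq> S"
    and r: "r \<in> S" "\<And>y. y \<in> S \<Longrightarrow> \<exists>z\<in>S. block_of P z = block_of P r \<and> y \<in> orbit g z"
  shows "uconnected (elementarization (part_graph g P A))"
proof -
  let ?H = "elementarization (part_graph g P A)"
  let ?R = "(adj (uends ?H) (uedges ?H))\<^sup>*"
  have sym: "sym ?R" by (intro sym_rtrancl symI) (auto simp: adj_def insert_commute)
  have arc: "(block_of P x, block_of P (g x)) \<in> ?R" if x: "x \<in> S" for x
  proof (cases "x \<in> A")
    case True
    then have "arc_class (part_graph g P A) x \<in> uedges ?H"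
      "uends ?H (arc_class (part_graph g P A) x) = {block_of P x, block_of P (g x)}"
      using uends_elementarization[of x "part_graph g P A"]
      by (auto simp: uedges_elementarization part_graph_def)
    then show ?thesis by (intro r_into_rtrancl) (auto simp: adj_def)
  next
    case False
    then show ?thesis using loop x by simp
  qed
  have reach: "(block_of P z, block_of P y) \<in> ?R" if z: "z \<in> S" and "y \<in> orbit g z" for y z
    using that(2)
  proof induct
    case base then show ?case using arc[OF z] .
  next
    case (step y)
    then have "y \<in> S" using orbit_subset_stab[OF g z] by blast
    then show ?case using step(2) arc by (meson rtrancl_trans)
  qed
  have all: "(block_of P r, B) \<in> ?R" if "B \<in> P" for B
  proof -
    have "B \<in> block_of P ` S" using that partition_eq_blocks[OF P] by simp
    then obtain y where y: "y \<in> S" "B = block_of P y" by blast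
    then obtain z where "z \<in> S" "block_of P z = block_of P r" "y \<in> orbit g z" using r(2) by blast
    then show ?thesis using reach[of z y] y(2) by simp
  qed
  have "(B, C) \<in> ?R" if "B \<in> P" "C \<in> P" for B C
    using all[OF that(1)] all[OF that(2)] sym by (meson rtrancl_trans symD)
  moreover have "P \<noteq> {}" using block_of_mem(1)[OF P r(1)] by blast
  moreover have "uverts ?H = P" by (simp add: uverts_elementarization part_graph_def)
  ultimately show ?thesis by (simp add: uconnected_adj)
qed

text \<open>The two further claims let the partition remember \<open>s\<close>: the fixed points are
  the only loops, and two parallel arcs are always partners. Both hold because the remaining graph
  is a double tree.\<close>

lemma pairing_except_imp_double_tree:
  assumes P: "partition_on S P" and g: "stab g S" and s: "pairing_except S {e, f} s"
    and ne: "e \<noteq> f" and inv: "\<forall>x\<in>S. block_of P (g (s x)) = block_of P x"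
    and card: "2 * card P = card S"
    and r: "r \<in> S" "\<forall>y\<in>S. \<exists>z\<in>S. block_of P z = block_of P r \<and> y \<in> orbit g z"
  shows "double_tree (part_graph g P (S - {e, f}))"
    and "\<And>x. x \<in> S \<Longrightarrow> block_of P (g x) = block_of P x \<longleftrightarrow> x \<in> {e, f}"
    and "\<And>x y. x \<in> S - {e, f} \<Longrightarrow> y \<in> S - {e, f} \<Longrightarrow>
      {block_of P (g y), block_of P y} = {block_of P (g x), block_of P x} \<Longrightarrow> y = x \<or> y = s x"
proof -
  let ?A = "S - {e, f}" and ?G = "part_graph g P (S - {e, f})"
  have fin: "finite S" using g by (rule stab_finite)
  have fix_iff: "s x = x \<longleftrightarrow> x \<in> {e, f}" if "x \<in> S" for x
    using s that unfolding pairing_except_def by blast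
  have ef: "e \<in> S" "f \<in> S" using s unfolding pairing_except_def by blast+
  have sS: "s x \<in> S" if "x \<in> S" for x using stabD[OF pairing_except_stab[OF fin s] that] .
  have ss: "s (s x) = x" if "x \<in> S" for x using s that by (simp add: pairing_except_def)
  have loop: "block_of P (g x) = block_of P x" if "x \<in> S - ?A" for x
    using bspec[OF inv, of x] fix_iff[of x] that by auto
  have wf: "dwf ?G" using dwf_part_graph[OF P g] by blast
  have con: "uconnected (elementarization ?G)"
    using uconnected_part_graph[OF P g loop _ r(1)] r(2) by blast
  have "card {e, f} \<le> card S" using ef fin by (intro card_mono) auto
  then have cardG: "2 * card (verts ?G) = card (arcs ?G) + 2"
    using card ef ne fin by (simp add: part_graph_def card_Diff_subset)
  have "s x \<in> ?A \<and> s x \<noteq> x \<and> s (s x) = x \<and> opposite ?G x (s x)" if x: "x \<in> ?A" for x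
  proof -
    have "s x \<noteq> x" using fix_iff x by blast
    moreover then have "s x \<in> ?A" using fix_iff[of "s x"] ss[of x] sS[of x] x by (metis Diff_iff)
    moreover have "block_of P (g x) = block_of P (s x)" using bspec[OF inv, of "s x"] ss[of x] sS[of x] x by simp
    ultimately show ?thesis using ss[of x] inv x by (simp add: opposite_def part_graph_def)
  qed
  then have pair: "opposite_pairing ?G s" by (simp add: opposite_pairing_def part_graph_def)
  show dt: "double_tree ?G" by (rule pairing_imp_double_tree(1)[OF wf con cardG pair])
  show "block_of P (g x) = block_of P x \<longleftrightarrow> x \<in> {e, f}" if "x \<in> S" for x
    using double_tree_no_loop[OF wf dt, of x] loop[of x] that by (auto simp: part_graph_def)
  show "y = x \<or> y = s x" if "x \<in> ?A" "y \<in> ?A"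
    "{block_of P (g y), block_of P y} = {block_of P (g x), block_of P x}" for x y
  proof -
    have "y \<in> arc_class ?G x" using that by (simp add: arc_class_def part_graph_def)
    then show ?thesis
      using pairing_imp_double_tree(2)[OF wf con cardG pair, of x] that by (simp add: part_graph_def)
  qed
qed

text \<open>Loops and parallelism are read off the graph alone. They determine the fixed points and
  the partner of every other point, hence both pairings on \<open>S\<close>.\<close>

lemma pairing_except_unique:
  assumes P: "partition_on S P" and g: "stab g S"
    and s: "pairing_except S {e, f} s" "e \<noteq> f" "\<forall>x\<in>S. block_of P (g (s x)) = block_of P x"
    and s': "pairing_except S {e', f'} s'" "e' \<noteq> f'"
      "\<forall>x\<in>S. block_of P (g (s' x)) = block_of P x"
    and card: "2 * card P = card S"
    and r: "r \<in> S" "\<forall>y\<in>S. \<exists>z\<in>S. block_of P z = block_of P r \<and> y \<in> orbit g z"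
    and x: "x \<in> S"
  shows "s x = s' x"
proof -
  have fin: "finite S" using g by (rule stab_finite)
  note D = pairing_except_imp_double_tree[OF P g s card r]
  note D' = pairing_except_imp_double_tree[OF P g s' card r]
  have fix1: "s y = y \<longleftrightarrow> y \<in> {e, f}" and fix2: "s' y = y \<longleftrightarrow> y \<in> {e', f'}" if "y \<in> S" for y
    using s(1) s'(1) that unfolding pairing_except_def by blast+
  show ?thesis
  proof (cases "x \<in> {e, f}")
    case True
    then have "x \<in> {e', f'}" using D(2)[OF x] D'(2)[OF x] by blast
    then show ?thesis using True fix1[OF x] fix2[OF x] by metis
  next
    case False
    then have x': "x \<notin> {e', f'}" using D(2)[OF x] D'(2)[OF x] by blast
    have sx: "s x \<in> S" using stabD[OF pairing_except_stab[OF fin s(1)] x] .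
    have ss: "s (s x) = x" using s(1) x by (simp add: pairing_except_def)
    have nx: "s x \<noteq> x" using False fix1[OF x] by blast
    then have "s x \<notin> {e, f}" using fix1[OF sx] ss by metis
    then have sx': "s x \<notin> {e', f'}" using D(2)[OF sx] D'(2)[OF sx] by blast
    have "block_of P (g x) = block_of P (s x)" using s(3) sx ss by metis
    then have "{block_of P (g (s x)), block_of P (s x)} = {block_of P (g x), block_of P x}"
      using s(3) x by auto
    then show ?thesis using D'(3)[of x "s x"] x x' sx sx' nx by blast
  qed
qed

section \<open>Three disjoint cycles\<close>

lemma orbit_cong_stab:
  assumes "stab f S" "\<And>y. y \<in> S \<Longrightarrow> f y = f' y" "x \<in> S"
  shows "orbit f x = orbit f' x"
  using orbit_cong0[of x S f f'] assms stabD[OF assms(1)] by auto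

lemma permutes_stab: "finite S \<Longrightarrow> s permutes S \<Longrightarrow> stab s S"
  unfolding stab_def using permutes_image permutation_permutes by blast

lemma orbit_cycle_of_list:
  assumes "distinct cs" "x \<in> set cs"
  shows "orbit (cycle_of_list cs) x = set cs"
proof
  have "stab (cycle_of_list cs) (set cs)" by (rule permutes_stab[OF _ cycle_permutes]) simp
  then show "orbit (cycle_of_list cs) x \<subseteq> set cs" using assms(2) by (rule orbit_subset_stab)
  show "set cs \<subseteq> orbit (cycle_of_list cs) x"
  proof
    fix y assume "y \<in> set cs"
    then obtain j where j: "j < length cs" "y = cs ! j" by (metis in_set_conv_nth)
    obtain i where i: "i < length cs" "x = cs ! i" using assms(2) by (metis in_set_conv_nth)
    \<comment> \<open>Rotation from position \<open>i\<close> to position \<open>j\<close>. The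
      detour through the end of the list keeps the exponent positive, as membership in
      \<open>orbit\<close> requires.\<close>
    let ?n = "j + (length cs - i)"
    have "(cycle_of_list cs ^^ ?n) x = map (cycle_of_list cs ^^ ?n) cs ! i" using i by simp
    also have "\<dots> = rotate ?n cs ! i" using cyclic_rotation[OF assms(1)] by simp
    also have "\<dots> = cs ! ((?n + i) mod length cs)" using i by (simp add: nth_rotate)
    also have "?n + i = j + length cs" using i by simp
    also have "(j + length cs) mod length cs = j" using j by simp
    finally have "(cycle_of_list cs ^^ ?n) x = y" using j by simp
    moreover have "0 < ?n" using i by simp
    ultimately show "y \<in> orbit (cycle_of_list cs) x" unfolding orbit_altdef by blast
  qed
qed

text \<open>Intersecting with \<open>A\<close> erases the blocks of \<open>Y\<close> and cuts
  \<open>v \<union> w\<close> back to \<open>v\<close>. Gluing thus loses no information, which is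
  what injectivity on the graph side rests on.\<close>

lemma restrict_join_at:
  assumes X: "partition_on A X" "v \<in> X" and Y: "partition_on B Y" "w \<in> Y" and AB: "A \<inter> B = {}"
  shows "partition_on (A \<union> B) (join_at X v Y w)"
    and "restrict_partition (join_at X v Y w) A = X"
    and "restrict_partition (join_at X v Y w) B = Y"
proof -
  have XA: "\<And>C. C \<in> X \<Longrightarrow> C \<subseteq> A \<and> C \<noteq> {}" and YB: "\<And>C. C \<in> Y \<Longrightarrow> C \<subseteq> B \<and> C \<noteq> {}"
    using X(1) Y(1) by (auto simp: partition_on_def)
  have dX: "\<And>C D. C \<in> X \<Longrightarrow> D \<in> X \<Longrightarrow> C \<noteq> D \<Longrightarrow> C \<inter> D = {}"
    and dY: "\<And>C D. C \<in> Y \<Longrightarrow> D \<in> Y \<Longrightarrow> C \<noteq> D \<Longrightarrow> C \<inter> D = {}"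
    using X(1) Y(1) by (auto simp: partition_on_def disjoint_def)
  have dXY: "C \<inter> D = {}" if "C \<in> X" "D \<in> Y" for C D using XA[OF that(1)] YB[OF that(2)] AB by blast
  show "partition_on (A \<union> B) (join_at X v Y w)"
  proof (rule partition_onI)
    show "\<Union>(join_at X v Y w) = A \<union> B"
      using X Y by (auto simp: join_at_def partition_on_def)
    show "{} \<notin> join_at X v Y w" using XA YB X(2) by (auto simp: join_at_def)
    show "disjnt p q" if "p \<in> join_at X v Y w" "q \<in> join_at X v Y w" "p \<noteq> q" for p q
    proof -
      have "disjnt p q" if p: "p \<in> X - {v} \<union> (Y - {w})" and q: "q \<in> X - {v} \<union> (Y - {w}) \<union> {v \<union> w}"
        and ne: "p \<noteq> q" for p q
        using p q ne dX[of p q] dY[of p q] dXY[of p q] dXY[of q p] dX[of p v] dY[of p w]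
          dXY[of p w] dXY[of v p] X(2) Y(2)
        unfolding disjnt_def by (elim UnE DiffE) (simp_all add: Int_Un_distrib Int_commute)
      then show ?thesis using that unfolding join_at_def by (metis UnE disjnt_sym singletonD)
    qed
  qed
  have Av: "A \<inter> (v \<union> w) = v" "B \<inter> (v \<union> w) = w" using XA[OF X(2)] YB[OF Y(2)] AB by blast+
  have "A \<inter> C = C" if "C \<in> X" for C using XA[OF that] by blast
  moreover have "A \<inter> C = {}" if "C \<in> Y" for C using YB[OF that] AB by blast
  moreover have "B \<inter> C = C" if "C \<in> Y" for C using YB[OF that] by blast
  moreover have "B \<inter> C = {}" if "C \<in> X" for C using XA[OF that] AB by blast
  ultimately have "(\<inter>) A ` join_at X v Y w - {{}} = X" "(\<inter>) B ` join_at X v Y w - {{}} = Y"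
    using Av XA YB X(2) Y(2) unfolding join_at_def image_Un image_insert image_empty
    by (force simp: image_iff)+
  then show "restrict_partition (join_at X v Y w) A = X" "restrict_partition (join_at X v Y w) B = Y"
    by (simp_all add: restrict_partition_def)
qed

lemma restrict_partition_self:
  assumes "partition_on A P" shows "restrict_partition P A = P"
proof -
  have "A \<inter> B = B" if "B \<in> P" for B using that assms by (auto simp: partition_on_def)
  then have "(\<inter>) A ` P = P" by simp
  then show ?thesis using assms by (simp add: restrict_partition_def partition_on_def)
qed

lemma partition_restrict_partition:
  "partition_on A P \<Longrightarrow> B \<subseteq> A \<Longrightarrow> partition_on B (restrict_partition P B)"
  using partition_on_restrict[of A P B] by (simp add: restrict_partition_def Int_absorb2)

text \<open>Positive lengths make every segment nonempty, so that \<open>gamma\<close> has exactly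
  one cycle on each of them.\<close>

locale three_cycles =
  fixes m1 m2 m3 :: nat
  assumes pos: "m1 \<ge> 1" "m2 \<ge> 1" "m3 \<ge> 1"
begin

abbreviation ms where "ms \<equiv> [m1, m2, m3]"
abbreviation S where "S l \<equiv> seg ms l"
abbreviation g where "g \<equiv> gamma ms"
abbreviation gc where "gc l \<equiv> gamma_cyc ms l"
definition M where "M = {1..m1 + m2 + m3}"

lemma S_eq: "S 0 = {1..m1}" "S 1 = {m1 + 1..m1 + m2}" "S 2 = {m1 + m2 + 1..m1 + m2 + m3}"
  by (auto simp: seg_def seg_list_def eval_nat_numeral)

lemma S_disjoint: "i \<in> {0, 1, 2} \<Longrightarrow> j \<in> {0, 1, 2} \<Longrightarrow> i \<noteq> j \<Longrightarrow> S i \<inter> S j = {}"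
  using S_eq by auto

lemma S_nonempty: "i \<in> {0, 1, 2} \<Longrightarrow> S i \<noteq> {}"
  using S_eq pos by auto

lemma finite_S [simp]: "finite (S i)" by (simp add: seg_def)

lemma M_eq: "M = S 0 \<union> S 1 \<union> S 2"
  using S_eq by (auto simp: M_def)

lemma finite_M [simp]: "finite M" by (simp add: M_def)

lemma distinct3: "{i, j, k} = {0, 1, 2::nat} \<Longrightarrow> i \<noteq> j \<and> i \<noteq> k \<and> j \<noteq> k \<and>
    i \<in> {0, 1, 2} \<and> j \<in> {0, 1, 2} \<and> k \<in> {0, 1, 2}"
proof -
  assume eq: "{i, j, k} = {0, 1, 2}"
  then have "card {i, j, k} = 3" by simp
  then have "i \<noteq> j" "i \<noteq> k" "j \<noteq> k" by (auto simp: card_insert_if split: if_splits)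
  then show ?thesis using eq by blast
qed

lemma M_eq3: "{i, j, k} = {0, 1, 2} \<Longrightarrow> M = S i \<union> (S j \<union> S k)"
proof -
  assume "{i, j, k} = {0, 1, 2::nat}"
  then have "(\<Union>l\<in>{i, j, k}. S l) = (\<Union>l\<in>{0, 1, 2}. S l)" by simp
  then show ?thesis using M_eq by auto
qed

lemma gc_permutes: "gc l permutes S l"
  unfolding gamma_cyc_def seg_def by (rule cycle_permutes)

lemma orbit_gc: "x \<in> S l \<Longrightarrow> orbit (gc l) x = S l"
  unfolding gamma_cyc_def seg_def by (intro orbit_cycle_of_list) (simp_all add: seg_list_def)

lemma gc_outside: "x \<notin> S l \<Longrightarrow> gc l x = x"
  using gc_permutes by (simp add: permutes_def)

lemma gc_in: "x \<in> S l \<Longrightarrow> gc l x \<in> S l"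
  using gc_permutes by (simp add: permutes_in_image)

lemma g_eq: "l \<in> {0, 1, 2} \<Longrightarrow> x \<in> S l \<Longrightarrow> g x = gc l x"
proof -
  assume l: "l \<in> {0, 1, 2}" and x: "x \<in> S l"
  have o: "gc j y = y" if "y \<in> S l" "j \<in> {0, 1, 2}" "j \<noteq> l" for j y
  proof -
    have "S l \<inter> S j = {}" using that l by (intro S_disjoint) auto
    then show ?thesis using that(1) by (intro gc_outside) auto
  qed
  consider "l = 0" | "l = 1" | "l = 2" using l by blast
  then show ?thesis
    using x gc_in[OF x] o[of x] o[of "gc l x"] by cases (simp_all add: gamma_def)
qed

lemma g_permutes: "g permutes M"
proof -
  have "gc l permutes M" if "l \<in> {0, 1, 2}" for l
    using permutes_subset[OF gc_permutes] M_eq that by blast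
  then show ?thesis unfolding gamma_def by (intro permutes_compose) auto
qed

lemma stab_g: "l \<in> {0, 1, 2} \<Longrightarrow> stab g (S l)"
proof -
  assume l: "l \<in> {0, 1, 2}"
  have "permutation g" using g_permutes finite_M unfolding permutation_permutes by blast
  then show ?thesis using g_eq[OF l] gc_in by (auto simp: stab_def)
qed

lemma orbit_g: "l \<in> {0, 1, 2} \<Longrightarrow> x \<in> S l \<Longrightarrow> orbit g x = S l"
  using orbit_cong_stab[OF stab_g, of l "gc l" x] g_eq[of l] orbit_gc[of x l] by metis

lemma cycles_on_g: "l \<in> {0, 1, 2} \<Longrightarrow> cycles_on (S l) g = {S l}"
proof -
  assume l: "l \<in> {0, 1, 2}"
  have "cycles_on (S l) g = (\<lambda>x. S l) ` S l"
    unfolding cycles_on_def using orbit_g[OF l] by (intro image_cong) auto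
  then show ?thesis using S_nonempty[OF l] by auto
qed

lemma stab_g_Un: "j \<in> {0, 1, 2} \<Longrightarrow> k \<in> {0, 1, 2} \<Longrightarrow> stab g (S j \<union> S k)"
  using stab_g[of j] stab_g[of k] by (auto simp: stab_def)

lemma card_cycles_on_g_Un:
  assumes "j \<in> {0, 1, 2}" "k \<in> {0, 1, 2}" "j \<noteq> k"
  shows "card (cycles_on (S j \<union> S k) g) = 2"
  using card_cycles_on_Un[OF stab_g[OF assms(1)] stab_g[OF assms(2)] S_disjoint[OF assms]]
    cycles_on_g assms by simp

lemma T_quot_eq:
  "T_quot ms P J = part_graph g (restrict_partition P (\<Union>l\<in>J. S l)) (\<Union>l\<in>J. S l)"
  by (simp add: T_quot_def quotient_graph_def T_graph_def part_graph_def)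

text \<open>The circuit condition supplies one loop arc from each segment. Deleting this class turns
  the unicircuit graph into a double tree, and the right-hand side has the form used for the other
  component.\<close>

lemma unicircuit_loop_iff:
  assumes jk: "j \<in> {0, 1, 2}" "k \<in> {0, 1, 2}" "j \<noteq> k"
    and Q: "partition_on (S j \<union> S k) Q" "Q = restrict_partition P (S j \<union> S k)"
  shows "double_unicircuit ms P j k \<and> circuit_is_loop_at (elementarization (T_quot ms P {j, k})) w \<longleftrightarrow>
    (\<exists>a\<in>S j. \<exists>b\<in>S k. block_of Q a = w \<and> block_of Q (g a) = w \<and> block_of Q b = w \<and> block_of Q (g b) = w \<and>
      double_tree (part_graph g Q (S j \<union> S k - {a, b})))"
    (is "?L \<longleftrightarrow> ?R")
proof -
  let ?T = "S j \<union> S k"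
  define G where "G = part_graph g Q ?T"
  define H where "H = elementarization G"
  have TG: "T_quot ms P {j, k} = G" using Q(2) by (simp add: T_quot_eq G_def)
  have wf: "dwf G" unfolding G_def by (rule dwf_part_graph[OF Q(1) stab_g_Un[OF jk(1,2)]]) simp
  have uwf: "uwf H" unfolding H_def by (rule uwf_elementarization[OF wf])
  have sub: "part_graph g Q (?T - C) = G\<lparr>arcs := arcs G - C\<rparr>" for C
    by (simp add: G_def part_graph_def)
  have arcs: "arcs G = ?T" and tl: "tail G = (\<lambda>x. block_of Q (g x))" and hd: "head G = block_of Q"
    by (simp_all add: G_def part_graph_def)
  have opp: "opposite (G\<lparr>arcs := A\<rparr>) = opposite G" for A
    by (simp add: opposite_def fun_eq_iff)
  show ?thesis
  proof
    assume ?L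
    then have con: "uconnected H" "\<exists>!K. circuit H K" and dbl: "double_opposite G"
      and mix: "\<And>K C. circuit H K \<Longrightarrow> C \<in> uedges K \<Longrightarrow> \<exists>a\<in>S j. \<exists>b\<in>S k. C = {a, b}"
      and loop: "circuit_is_loop_at H w"
      unfolding double_unicircuit_def TG Let_def H_def by blast+
    obtain K c where K: "circuit H K" "uedges K = {c}" "uends K c = {w}"
      using loop by (auto simp: circuit_is_loop_at_def)
    have K': "usubgraph K H" using K(1) by (simp add: circuit_def)
    have c: "c \<in> uedges H" "uends H c = {w}"
      using K usubgraph_edges[OF K'] usubgraph_ends[OF K'] by auto
    obtain a b where ab: "a \<in> S j" "b \<in> S k" "c = {a, b}" using mix[OF K(1)] K(2) by blast
    obtain x where x: "x \<in> arcs G" "c = arc_class G x"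
      using c(1) by (auto simp: H_def uedges_elementarization)
    have cls: "arc_class G y = c" "y \<in> arcs G" if "y \<in> {a, b}" for y
    proof -
      have "y \<in> arc_class G x" using that ab(3) x(2) by simp
      then show "arc_class G y = c" "y \<in> arcs G"
        using arc_class_eq[of y G x] x(2) by (simp_all add: arc_class_def)
    qed
    have "{tail G y, head G y} = {w}" if "y \<in> {a, b}" for y
      using uends_elementarization[of y G] cls[OF that] c(2) by (simp add: H_def)
    then have ends: "tail G y = w \<and> head G y = w" if "y \<in> {a, b}" for y using that by blast
    have elem: "elementarization (G\<lparr>arcs := arcs G - {a, b}\<rparr>) = H\<lparr>uedges := uedges H - {c}\<rparr>"
      using elementarization_remove_class[OF x(1)] x(2) ab(3) by (simp add: H_def)
    have "utree (elementarization (G\<lparr>arcs := arcs G - {a, b}\<rparr>))"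
      unfolding elem using unique_circuit_loop_iff[OF uwf c] con by blast
    moreover have "double_opposite (G\<lparr>arcs := arcs G - {a, b}\<rparr>)"
      using dbl unfolding double_opposite_def elem opp by (auto simp: H_def)
    ultimately have "double_tree (G\<lparr>arcs := arcs G - {a, b}\<rparr>)" by (simp add: double_tree_def)
    then have "double_tree (part_graph g Q (?T - {a, b}))" by (simp only: sub)
    then show ?R using ab ends[of a] ends[of b] by (auto simp: tl hd)
  next
    assume ?R
    then obtain a b where ab: "a \<in> S j" "b \<in> S k" "block_of Q a = w \<and> block_of Q (g a) = w"
        "block_of Q b = w \<and> block_of Q (g b) = w"
      and dt: "double_tree (G\<lparr>arcs := arcs G - {a, b}\<rparr>)"
      unfolding sub by blast
    have ends: "tail G y = w \<and> head G y = w" if "y \<in> {a, b}" for y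
      using that ab(3,4) unfolding tl hd by blast
    let ?G = "G\<lparr>arcs := arcs G - {a, b}\<rparr>"
    have ne: "a \<noteq> b" using ab S_disjoint[OF jk] by blast
    have wf': "dwf ?G" using wf by (auto simp: dwf_def)
    have aG: "a \<in> arcs G" "b \<in> arcs G" using ab by (auto simp: arcs)
    \<comment> \<open>A further arc in this class would be a loop that remains in the double
      tree.\<close>
    have "x \<in> {a, b}" if x: "x \<in> arc_class G a" for x
    proof (rule ccontr)
      assume nx: "x \<notin> {a, b}"
      have "x \<in> arcs G" "{tail G x, head G x} = {w}" using x ends[of a] by (auto simp: arc_class_def)
      then show False using double_tree_no_loop[OF wf' dt, of x] nx by auto
    qed
    moreover have "b \<in> arc_class G a" using aG ends[of a] ends[of b] by (auto simp: arc_class_def)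
    ultimately have cls: "arc_class G a = {a, b}" using in_arc_class[OF aG(1)] by blast
    have c: "{a, b} \<in> uedges H" "uends H {a, b} = {w}"
      using cls aG uends_elementarization[OF aG(1)] ends[of a]
      by (auto simp: H_def uedges_elementarization)
    have elem: "elementarization ?G = H\<lparr>uedges := uedges H - {{a, b}}\<rparr>"
      using elementarization_remove_class[OF aG(1)] cls by (simp add: H_def)
    have con: "uconnected H" "\<exists>!K. circuit H K"
      using dt unique_circuit_loop_iff[OF uwf c] by (auto simp: double_tree_def elem)
    have loop: "circuit H \<lparr>uverts = {w}, uedges = {{a, b}}, uends = uends H\<rparr>" (is "circuit H ?K")
      by (rule circuit_loop[OF uwf c])
    have "C = {a, b}" if "circuit H K" "C \<in> uedges K" for K C
    proof -
      have "K = ?K" using con(2) that(1) loop by blast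
      then show ?thesis using that(2) by simp
    qed
    then have mix: "\<forall>K. circuit H K \<longrightarrow> (\<forall>C\<in>uedges K. \<exists>a\<in>S j. \<exists>b\<in>S k. C = {a, b})"
      using ab by blast
    have "circuit_is_loop_at H w"
      unfolding circuit_is_loop_at_def using loop c(2) by (intro exI[of _ ?K] exI[of _ "{a, b}"]) simp
    moreover have "double_opposite G"
      unfolding double_opposite_def
    proof
      fix C assume "C \<in> uedges (elementarization G)"
      then have C: "C = {a, b} \<or> C \<in> uedges (elementarization ?G)" by (auto simp: elem H_def)
      have "opposite G x y" if "x \<in> {a, b}" "y \<in> {a, b}" for x y
        using ends[OF that(1)] ends[OF that(2)] by (simp add: opposite_def)
      moreover have "card {a, b} = 2" using ne by simp
      ultimately show "card C = 2 \<and> (\<forall>e\<in>C. \<forall>f\<in>C. e \<noteq> f \<longrightarrow> opposite G e f)"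
        using C dt unfolding double_tree_def double_opposite_def opp by blast
    qed
    ultimately show ?L
      using con mix unfolding double_unicircuit_def TG Let_def H_def by blast
  qed
qed

end

section \<open>Graphs of uniloop type\<close>

context three_cycles
begin

text \<open>The three cycle counts are the largest that \<open>genus_S\<close> permits for two, one
  and one fixed points, so they say that \<open>s\<close> is non-crossing on each segment. The
  condition on \<open>f\<close> puts the loops \<open>e\<close> and \<open>f\<close> at the same
  vertex.\<close>

definition loop_data :: "(nat \<Rightarrow> nat) \<Rightarrow> nat \<Rightarrow> nat \<Rightarrow> nat \<Rightarrow> nat \<Rightarrow> nat \<Rightarrow> nat \<Rightarrow> nat \<Rightarrow> bool" where
  "loop_data s i j k a b e f \<longleftrightarrow> {i, j, k} = {0, 1, 2} \<and>
     s permutes M \<and> pairing_except M {a, b, e, f} s \<and> (\<forall>l\<in>{0, 1, 2}. s ` S l \<subseteq> S l) \<and>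
     a \<in> S j \<and> b \<in> S k \<and> e \<in> S i \<and> f \<in> S i \<and> e \<noteq> f \<and> f \<in> orbit (g \<circ> s) e \<and>
     2 * card (cycles_on (S i) (g \<circ> s)) = card (S i) \<and>
     2 * card (cycles_on (S j) (g \<circ> s)) = card (S j) + 1 \<and>
     2 * card (cycles_on (S k) (g \<circ> s)) = card (S k) + 1"

text \<open>On \<open>S j \<union> S k\<close> the transposition fuses the cycles of
  \<open>a\<close> and \<open>b\<close> into the vertex carrying both loops. The join then
  identifies it with the vertex of \<open>e\<close> and \<open>f\<close>.\<close>

definition glued :: "(nat \<Rightarrow> nat) \<Rightarrow> nat \<Rightarrow> nat \<Rightarrow> nat \<Rightarrow> nat \<Rightarrow> nat \<Rightarrow> nat \<Rightarrow> nat set set" where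
  "glued s i j k a b e = join_at (cycles_on (S i) (g \<circ> s)) (orbit (g \<circ> s) e)
     (cycles_on (S j \<union> S k) (g \<circ> s \<circ> transpose a b)) (orbit (g \<circ> s \<circ> transpose a b) a)"

text \<open>The genus bound for a single cycle of \<open>g\<close>, with the number of cycles of
  \<open>s\<close> expressed through its fixed points.\<close>

lemma genus_S:
  assumes l: "l \<in> {0, 1, 2}" and s: "pairing_except (S l) F s"
  shows "2 * card (cycles_on (S l) (g \<circ> s)) + card F \<le> card (S l) + 2"
proof -
  have st: "stab s (S l)" using pairing_except_stab[OF _ s] by simp
  have "s (s x) = x" if "x \<in> S l" for x using s that by (simp add: pairing_except_def)
  from card_cycles_on_genus[OF stab_g[OF l] st this]
  have "card (cycles_on (S l) s) + card (cycles_on (S l) (g \<circ> s)) \<le> card (S l) + 1"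
    using cycles_on_g[OF l] by simp
  then show ?thesis using card_cycles_on_pairing_except[OF _ s] by simp
qed

text \<open>The merged partition is coarser than the cycles of \<open>h\<close>, so it is still
  constant along \<open>h\<close> itself. This supplies the opposite orientations in the unicircuit
  component, where \<open>h\<close> is \<open>g \<circ> s\<close>.\<close>

lemma block_of_merge:
  assumes h: "stab h T" and ab: "a \<in> T" "b \<in> T" "b \<notin> orbit h a" and x: "x \<in> T"
  shows "block_of (cycles_on T (h \<circ> transpose a b)) (h x) =
    block_of (cycles_on T (h \<circ> transpose a b)) x"
proof -
  let ?t = "h \<circ> transpose a b"
  have t: "stab ?t T" using h ab by (intro stab_comp stab_transpose) (auto simp: stab_finite)
  have step: "orbit ?t (?t y) = orbit ?t y" for y using orbit_eq_stab[OF t orbit.base] .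
  have ab': "orbit ?t b = orbit ?t a" using orbit_eq_stab[OF t orbit_merge[OF h ab(3)]] .
  have "orbit ?t (h x) = orbit ?t x"
  proof -
    consider "x = a" | "x = b" | "x \<noteq> a" "x \<noteq> b" by blast
    then show ?thesis
    proof cases
      case 1 then show ?thesis using step[of b] ab' by simp
    next
      case 2 then show ?thesis using step[of a] ab' by simp
    next
      case 3 then show ?thesis using step[of x] by simp
    qed
  qed
  then show ?thesis using block_of_cycles_on[OF t] x stabD[OF h x] by simp
qed

lemma block_of_cycles_on_step:
  assumes "stab h T" "x \<in> T"
  shows "block_of (cycles_on T h) (h x) = block_of (cycles_on T h) x"
  using block_of_cycles_on[OF assms(1)] orbit_eq_stab[OF assms(1) orbit.base[of h x]] assms stabD
  by metis

section \<open>From labelled involutions to graphs\<close>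

context
  fixes s i j k a b e f
  assumes dat: "loop_data s i j k a b e f"
begin

lemma data_ijk: "i \<noteq> j" "i \<noteq> k" "j \<noteq> k" "i \<in> {0, 1, 2}" "j \<in> {0, 1, 2}" "k \<in> {0, 1, 2}"
  "M = S i \<union> (S j \<union> S k)"
  using dat distinct3[of i j k] M_eq3[of i j k] by (auto simp: loop_data_def)

lemma data_disjoint: "S i \<inter> S j = {}" "S i \<inter> S k = {}" "S j \<inter> S k = {}" "S i \<inter> (S j \<union> S k) = {}"
  using S_disjoint data_ijk by (auto simp: Int_Un_distrib)

lemma data_points: "a \<in> S j" "b \<in> S k" "e \<in> S i" "f \<in> S i" "e \<noteq> f" "a \<noteq> b"
  "a \<noteq> e" "a \<noteq> f" "b \<noteq> e" "b \<noteq> f"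
  using dat data_disjoint unfolding loop_data_def by blast+

lemma data_perm: "s permutes M" "permutation s"
  using dat by (auto simp: loop_data_def permutation_permutes)

lemma data_invol: "s (s x) = x"
  using dat unfolding loop_data_def pairing_except_def permutes_def by metis

lemma data_fix: "{x \<in> M. s x = x} = {a, b, e, f}"
  using dat by (simp add: loop_data_def pairing_except_def)

lemma stab_s: "l \<in> {0, 1, 2} \<Longrightarrow> stab s (S l)"
  using dat data_perm(2) by (auto simp: loop_data_def stab_def)

lemma stab_s_Un: "stab s (S j \<union> S k)"
  using stab_s[OF data_ijk(5)] stab_s[OF data_ijk(6)] by (auto simp: stab_def)

lemma stab_gs: "l \<in> {0, 1, 2} \<Longrightarrow> stab (g \<circ> s) (S l)"
  by (intro stab_comp stab_g stab_s)

lemma stab_gs_Un: "stab (g \<circ> s) (S j \<union> S k)"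
  by (intro stab_comp stab_g_Un stab_s_Un data_ijk)

lemma data_pairing: "pairing_except (S i) {e, f} s" "pairing_except (S j) {a} s"
  "pairing_except (S k) {b} s" "pairing_except (S j \<union> S k) {a, b} s"
proof -
  have p: "pairing_except M {a, b, e, f} s" using dat by (simp add: loop_data_def)
  have inv: "s ` S l \<subseteq> S l" if "l \<in> {0, 1, 2}" for l using dat that unfolding loop_data_def by blast
  have "{a, b, e, f} \<inter> S i = {e, f}" "{a, b, e, f} \<inter> S j = {a}" "{a, b, e, f} \<inter> S k = {b}"
    "{a, b, e, f} \<inter> (S j \<union> S k) = {a, b}"
    using data_points data_disjoint by blast+
  then show "pairing_except (S i) {e, f} s" "pairing_except (S j) {a} s"
    "pairing_except (S k) {b} s" "pairing_except (S j \<union> S k) {a, b} s"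
    using pairing_except_subset[OF p inv] pairing_except_subset[OF p, of "S j \<union> S k"] inv data_ijk
    by (metis Un_upper1 Un_upper2 le_supI1 le_supI2, metis Un_upper1 Un_upper2 le_supI1 le_supI2,
      metis Un_upper1 Un_upper2 le_supI1 le_supI2, metis Un_mono image_Un Un_upper2)
qed

lemma data_b_notin: "b \<notin> orbit (g \<circ> s) a"
  using orbit_subset_stab[OF stab_gs[OF data_ijk(5)] data_points(1)] data_points(2) data_disjoint(3)
  by blast

lemma stab_merged: "stab (g \<circ> s \<circ> transpose a b) (S j \<union> S k)"
  using data_points by (intro stab_comp[OF stab_gs_Un] stab_transpose) auto

lemma data_card_merged:
  "2 * card (cycles_on (S j \<union> S k) (g \<circ> s \<circ> transpose a b)) = card (S j \<union> S k)"
proof -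
  have "card (cycles_on (S j \<union> S k) (g \<circ> s)) =
      card (cycles_on (S j) (g \<circ> s)) + card (cycles_on (S k) (g \<circ> s))"
    using card_cycles_on_Un[OF stab_gs stab_gs data_disjoint(3)] data_ijk by blast
  moreover have "card (cycles_on (S j \<union> S k) (g \<circ> s)) =
      card (cycles_on (S j \<union> S k) (g \<circ> s \<circ> transpose a b)) + 1"
    using card_cycles_on_merge[OF stab_gs_Un _ _ data_b_notin] data_points by blast
  moreover have "card (S j \<union> S k) = card (S j) + card (S k)"
    using data_disjoint by (simp add: card_Un_disjoint)
  ultimately show ?thesis using dat by (simp add: loop_data_def)
qed

abbreviation (input) X where "X \<equiv> cycles_on (S i) (g \<circ> s)"
abbreviation (input) Y where "Y \<equiv> cycles_on (S j \<union> S k) (g \<circ> s \<circ> transpose a b)"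

text \<open>Together with \<open>data_Y\<close> this collects the premises of the double tree
  criterion for the two components.\<close>

lemma data_X: "partition_on (S i) X" "stab g (S i)" "\<forall>x\<in>S i. block_of X (g (s x)) = block_of X x"
  "2 * card X = card (S i)" "e \<in> S i" "\<forall>y\<in>S i. \<exists>z\<in>S i. block_of X z = block_of X e \<and> y \<in> orbit g z"
proof -
  note st = stab_gs[OF data_ijk(4)]
  show "partition_on (S i) X" by (rule partition_cycles_on[OF st])
  show "stab g (S i)" by (rule stab_g[OF data_ijk(4)])
  show "\<forall>x\<in>S i. block_of X (g (s x)) = block_of X x" using block_of_cycles_on_step[OF st] by simp
  show "2 * card X = card (S i)" using dat by (simp add: loop_data_def)
  show "e \<in> S i" by (rule data_points)
  then show "\<forall>y\<in>S i. \<exists>z\<in>S i. block_of X z = block_of X e \<and> y \<in> orbit g z"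
    using orbit_g[OF data_ijk(4)] by blast
qed

lemma data_Y: "partition_on (S j \<union> S k) Y" "stab g (S j \<union> S k)"
  "\<forall>x\<in>S j \<union> S k. block_of Y (g (s x)) = block_of Y x"
  "2 * card Y = card (S j \<union> S k)" "a \<in> S j \<union> S k"
  "\<forall>y\<in>S j \<union> S k. \<exists>z\<in>S j \<union> S k. block_of Y z = block_of Y a \<and> y \<in> orbit g z"
  "block_of Y b = block_of Y a" "block_of Y a = orbit (g \<circ> s \<circ> transpose a b) a"
proof -
  show "partition_on (S j \<union> S k) Y" by (rule partition_cycles_on[OF stab_merged])
  show "stab g (S j \<union> S k)" by (rule stab_g_Un[OF data_ijk(5,6)])
  show "\<forall>x\<in>S j \<union> S k. block_of Y (g (s x)) = block_of Y x"
    using block_of_merge[OF stab_gs_Un _ _ data_b_notin] data_points by simp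
  show "2 * card Y = card (S j \<union> S k)" by (rule data_card_merged)
  show a: "a \<in> S j \<union> S k" using data_points by simp
  show Ya: "block_of Y a = orbit (g \<circ> s \<circ> transpose a b) a" by (rule block_of_cycles_on[OF stab_merged a])
  show Yb: "block_of Y b = block_of Y a"
    using block_of_cycles_on[OF stab_merged, of b] Ya data_points
      orbit_eq_stab[OF stab_merged orbit_merge[OF stab_gs_Un data_b_notin]] by simp
  \<comment> \<open>Walks along \<open>g\<close> start at \<open>a\<close> for \<open>S j\<close>
    and at \<open>b\<close> for \<open>S k\<close>; the two starting points lie in the same
    block.\<close>
  show "\<forall>y\<in>S j \<union> S k. \<exists>z\<in>S j \<union> S k. block_of Y z = block_of Y a \<and> y \<in> orbit g z"
    using orbit_g[OF data_ijk(5) data_points(1)] orbit_g[OF data_ijk(6) data_points(2)] Yb data_points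
    by blast
qed

lemma orbit_e_in: "orbit (g \<circ> s) e \<in> X"
  using data_points by (simp add: cycles_on_def)

lemma orbit_a_in: "orbit (g \<circ> s \<circ> transpose a b) a \<in> Y"
  using data_points by (simp add: cycles_on_def)

lemma glued_restrict: "partition_on M (glued s i j k a b e)"
  "restrict_partition (glued s i j k a b e) (S i) = X"
  "restrict_partition (glued s i j k a b e) (S j \<union> S k) = Y"
  using restrict_join_at[OF data_X(1) orbit_e_in data_Y(1) orbit_a_in data_disjoint(4)] data_ijk(7)
  by (simp_all add: glued_def)

lemma glued_in_UL: "glued s i j k a b e \<in> UL_24 m1 m2 m3"
proof -
  let ?P = "glued s i j k a b e" and ?v = "orbit (g \<circ> s) e" and ?w = "orbit (g \<circ> s \<circ> transpose a b) a"
  have fix_s: "s x = x" if "x \<in> {a, b, e, f}" for x using data_fix that by blast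
  have Ti: "T_quot ms ?P {i} = part_graph g X (S i)"
    using glued_restrict(2) by (simp add: T_quot_eq)
  have v: "block_of X e = ?v" "block_of X f = ?v"
    using block_of_cycles_on[OF stab_gs[OF data_ijk(4)]] data_points dat
      orbit_eq_stab[OF stab_gs[OF data_ijk(4)], of f e] by (simp_all add: loop_data_def)
  have "block_of X (g e) = ?v" "block_of X (g f) = ?v"
    using bspec[OF data_X(3), of e] bspec[OF data_X(3), of f] fix_s[of e] fix_s[of f] data_points v
    by simp_all
  moreover have "double_tree (part_graph g X (S i - {e, f}))"
    by (rule pairing_except_imp_double_tree(1)[OF data_X(1,2) data_pairing(1) data_points(5) data_X(3-6)])
  ultimately have two: "double_tree_with_two_loops (T_quot ms ?P {i}) ?v"
    unfolding double_tree_with_two_loops_def Ti using v data_points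
    by (intro bexI[of _ e] bexI[of _ f]) (simp_all add: part_graph_def)
  have w: "block_of Y a = ?w" "block_of Y b = ?w" using data_Y(7,8) by simp_all
  then have "block_of Y (g a) = ?w" "block_of Y (g b) = ?w"
    using bspec[OF data_Y(3), of a] bspec[OF data_Y(3), of b] fix_s[of a] fix_s[of b] data_points
    by simp_all
  moreover have "double_tree (part_graph g Y (S j \<union> S k - {a, b}))"
    by (rule pairing_except_imp_double_tree(1)[OF data_Y(1,2) data_pairing(4) data_points(6) data_Y(3-6)])
  ultimately have "double_unicircuit ms ?P j k \<and>
      circuit_is_loop_at (elementarization (T_quot ms ?P {j, k})) ?w"
    using unicircuit_loop_iff[OF data_ijk(5,6,3) data_Y(1) glued_restrict(3)[symmetric]] w data_points
    by blast
  moreover have "verts (T_quot ms ?P {0, 1, 2}) =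
      join_at (verts (T_quot ms ?P {i})) ?v (verts (T_quot ms ?P {j, k})) ?w"
    using glued_restrict restrict_partition_self[OF glued_restrict(1)] M_eq
    by (simp add: T_quot_eq part_graph_def Un_assoc) (simp add: glued_def)
  ultimately have "uniloop_24 ms ?P"
    unfolding uniloop_24_def using two dat unfolding loop_data_def by blast
  then show ?thesis using glued_restrict(1) by (simp add: UL_24_def M_def)
qed

end

section \<open>From graphs to labelled involutions\<close>

lemma UL_imp_data:
  assumes "P \<in> UL_24 m1 m2 m3"
  shows "\<exists>s i j k a b e f. loop_data s i j k a b e f \<and> P = glued s i j k a b e"
proof -
  have P: "partition_on M P" and "uniloop_24 ms P" using assms by (auto simp: UL_24_def M_def)
  then obtain i j k v w where ijk: "{i, j, k} = {0, 1, 2}"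
    and two: "double_tree_with_two_loops (T_quot ms P {i}) v"
    and uni: "double_unicircuit ms P j k" "circuit_is_loop_at (elementarization (T_quot ms P {j, k})) w"
    and join: "verts (T_quot ms P {0, 1, 2}) =
      join_at (verts (T_quot ms P {i})) v (verts (T_quot ms P {j, k})) w"
    unfolding uniloop_24_def by blast
  note d = distinct3[OF ijk]
  let ?T = "S j \<union> S k"
  have MT: "M = S i \<union> ?T" by (rule M_eq3[OF ijk])
  have disj: "S i \<inter> S j = {}" "S i \<inter> S k = {}" "S j \<inter> S k = {}" "S i \<inter> ?T = {}"
    using S_disjoint d by (auto simp: Int_Un_distrib)
  let ?X = "restrict_partition P (S i)" and ?Y = "restrict_partition P ?T"
  have X: "partition_on (S i) ?X" and Y: "partition_on ?T ?Y"
    using partition_restrict_partition[OF P] MT by blast+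
  have gi: "stab g (S i)" and gT: "stab g ?T" using stab_g stab_g_Un d by blast+
  obtain e f where ef: "e \<in> S i" "f \<in> S i" "e \<noteq> f" "block_of ?X e = v" "block_of ?X (g e) = v"
      "block_of ?X f = v" "block_of ?X (g f) = v" "double_tree (part_graph g ?X (S i - {e, f}))"
  proof -
    have "part_graph g ?X (S i)\<lparr>arcs := A\<rparr> = part_graph g ?X A" for A
      by (simp add: part_graph_def)
    moreover have "T_quot ms P {i} = part_graph g ?X (S i)" by (simp add: T_quot_eq)
    ultimately show thesis
      using two that unfolding double_tree_with_two_loops_def by (auto simp: part_graph_def)
  qed
  obtain a b where ab: "a \<in> S j" "b \<in> S k" "block_of ?Y a = w" "block_of ?Y (g a) = w"
      "block_of ?Y b = w" "block_of ?Y (g b) = w" "double_tree (part_graph g ?Y (?T - {a, b}))"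
    using unicircuit_loop_iff[OF _ _ _ Y refl, of w] uni d by blast
  have abne: "a \<noteq> b" using ab disj by blast
  have Xef: "block_of ?X (g e) = block_of ?X e" "block_of ?X (g f) = block_of ?X f"
    and Yab: "block_of ?Y (g a) = block_of ?Y a" "block_of ?Y (g b) = block_of ?Y b"
    and abT: "a \<in> ?T" "b \<in> ?T"
    using ef ab by simp_all
  obtain s1 where s1: "s1 permutes S i" "pairing_except (S i) {e, f} s1"
      "\<forall>x\<in>S i. block_of ?X (g (s1 x)) = block_of ?X x" "2 * card ?X = card (S i)"
    by (rule double_tree_imp_pairing_except[OF X gi ef(1) Xef(1) ef(2) Xef(2) ef(3,8)])
  obtain s2 where s2: "s2 permutes ?T" "pairing_except ?T {a, b} s2"
      "\<forall>x\<in>?T. block_of ?Y (g (s2 x)) = block_of ?Y x" "2 * card ?Y = card ?T"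
    by (rule double_tree_imp_pairing_except[OF Y gT abT(1) Yab(1) abT(2) Yab(2) abne ab(7)])
  define s where "s x = (if x \<in> S i then s1 x else s2 x)" for x
  have s_i: "s x = s1 x" if "x \<in> S i" for x using that by (simp add: s_def)
  have s_T: "s x = s2 x" if "x \<in> ?T" for x using that disj(4) by (auto simp: s_def)
  have si_in: "s x \<in> S i" if "x \<in> S i" for x using s_i[OF that] s1(1) that by (simp add: permutes_in_image)
  have sT_in: "s x \<in> ?T" if "x \<in> ?T" for x
    using that by (simp only: s_T permutes_in_image[OF s2(1)])
  have ss: "s (s x) = x" for x
  proof -
    consider "x \<in> S i" | "x \<in> ?T" | "x \<notin> M" using MT by blast
    then show ?thesis
    proof cases
      case 1
      then have "s1 (s1 x) = x" using s1(2) by (simp add: pairing_except_def)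
      then show ?thesis using s_i[OF 1] s_i[OF si_in[OF 1]] by simp
    next
      case 2
      have "s2 (s2 x) = x" using s2(2) bspec[of ?T _ x] 2 unfolding pairing_except_def by blast
      then show ?thesis using s_T[OF 2] s_T[OF sT_in[OF 2]] by simp
    next
      case 3 then show ?thesis using s2(1) MT by (auto simp: s_def permutes_def)
    qed
  qed
  have sM: "s x = x" if "x \<notin> M" for x using that s2(1) MT by (auto simp: s_def permutes_def)
  have "\<exists>!x. s x = y" for y
  proof (rule ex1I[of _ "s y"])
    show "x = s y" if "s x = y" for x using ss[of x] that by simp
  qed (rule ss)
  then have perm: "s permutes M" unfolding permutes_def using sM by blast
  then have permn: "permutation s" using finite_M unfolding permutation_permutes by blast
  have fix1: "{x \<in> S i. s x = x} = {e, f}"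
  proof -
    have "{x \<in> S i. s x = x} = {x \<in> S i. s1 x = x}"
      by (intro Collect_cong conj_cong refl) (simp add: s_i)
    then show ?thesis using s1(2) by (simp add: pairing_except_def)
  qed
  have fix2: "{x \<in> ?T. s x = x} = {a, b}"
  proof -
    have "{x \<in> ?T. s x = x} = {x \<in> ?T. s2 x = x}"
      by (intro Collect_cong conj_cong refl) (simp only: s_T)
    then show ?thesis using s2(2) unfolding pairing_except_def by (simp only:)
  qed
  have pi: "pairing_except (S i) {e, f} s"
    unfolding pairing_except_def using permn si_in ss fix1 by simp
  have pT: "pairing_except ?T {a, b} s"
    unfolding pairing_except_def fix2 using permn sT_in ss by blast
  have "{x \<in> M. s x = x} = {a, b, e, f}" using fix1 fix2 MT by blast
  then have pM: "pairing_except M {a, b, e, f} s"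
    unfolding pairing_except_def using permn ss perm by (simp add: permutes_in_image)
  have sti: "stab s (S i)" and stT: "stab s ?T"
    using pairing_except_stab[OF _ pi] pairing_except_stab[OF _ pT] by simp_all
  have hX: "block_of ?X ((g \<circ> s) x) = block_of ?X x" if "x \<in> S i" for x using s1(3) s_i that by simp
  have hY: "block_of ?Y ((g \<circ> s) x) = block_of ?Y x" if "x \<in> ?T" for x using s2(3) s_T that by simp
  \<comment> \<open>With two fixed points the genus bound for \<open>g \<circ> s\<close> equals the
    number of vertices of the double tree, which forces equality.\<close>
  have cX: "2 * card (cycles_on (S i) (g \<circ> s)) \<le> card (S i)"
    using genus_S[OF _ pi] d ef(3) by simp
  have Xeq: "?X = cycles_on (S i) (g \<circ> s)"
    by (rule card_partition_le_cycles_on(2)[OF X stab_comp[OF gi sti]]) (use hX cX s1(4) in simp_all)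
  then have cX': "2 * card (cycles_on (S i) (g \<circ> s)) = card (S i)" using s1(4) by simp
  have cT: "2 * card (cycles_on ?T s) = card ?T + 2"
    using card_cycles_on_pairing_except[OF _ pT] abne by simp
  \<comment> \<open>A pair joining the two cycles would raise the genus, leaving fewer cycles of \<open>g \<circ> s\<close> than vertices.\<close>
  have nomix: "s x \<in> orbit g x" if x: "x \<in> ?T" for x
  proof (rule ccontr)
    assume "s x \<notin> orbit g x"
    then have "card (cycles_on ?T s) + card (cycles_on ?T (g \<circ> s)) + 2 \<le> card ?T + card (cycles_on ?T g)"
      using card_cycles_on_genus_through[OF gT stT _ x] ss by blast
    moreover have "card ?Y \<le> card (cycles_on ?T (g \<circ> s))"
      by (rule card_partition_le_cycles_on(1)[OF Y stab_comp[OF gT stT]]) (rule hY)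
    ultimately show False using cT s2(4) card_cycles_on_g_Un[of j k] d by simp
  qed
  have dj: "j \<in> {0, 1, 2}" and dk: "k \<in> {0, 1, 2}" using d by blast+
  have "s x \<in> S j" if "x \<in> S j" for x
    using nomix[OF UnI1[OF that]] orbit_g[OF dj that] by simp
  then have sj: "s ` S j \<subseteq> S j" by blast
  have "s x \<in> S k" if "x \<in> S k" for x
    using nomix[OF UnI2[OF that]] orbit_g[OF dk that] by simp
  then have sk: "s ` S k \<subseteq> S k" by blast
  have pj: "pairing_except (S j) {a} s" and pk: "pairing_except (S k) {b} s"
    using pairing_except_subset[OF pT sj] pairing_except_subset[OF pT sk] ab(1,2) disj(3)
    by (auto simp: insert_absorb Int_insert_left split: if_splits)
  have cj: "2 * card (cycles_on (S j) (g \<circ> s)) \<le> card (S j) + 1"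
    and ck: "2 * card (cycles_on (S k) (g \<circ> s)) \<le> card (S k) + 1"
    using genus_S[OF _ pj] genus_S[OF _ pk] d by simp_all
  have stj: "stab (g \<circ> s) (S j)" and stk: "stab (g \<circ> s) (S k)"
    using stab_comp[OF stab_g] pairing_except_stab[OF _ pj] pairing_except_stab[OF _ pk] d finite_S by blast+
  have stgT: "stab (g \<circ> s) ?T" by (rule stab_comp[OF gT stT])
  have bna: "b \<notin> orbit (g \<circ> s) a" using orbit_subset_stab[OF stj ab(1)] ab(2) disj(3) by blast
  let ?h = "g \<circ> s \<circ> transpose a b"
  have sth: "stab ?h ?T" using stab_comp[OF stgT stab_transpose] abT by simp
  \<comment> \<open>Since \<open>a\<close> and \<open>b\<close> are loops at the same vertex,
    exchanging them does not change blocks.\<close>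
  have hY': "block_of ?Y (?h x) = block_of ?Y x" if x: "x \<in> ?T" for x
  proof -
    have "transpose a b x \<in> ?T" using x abT by (simp add: transpose_def)
    then have "block_of ?Y (?h x) = block_of ?Y (transpose a b x)" using hY by simp
    then show ?thesis using ab(3,5) by (simp add: transpose_def split: if_splits)
  qed
  \<comment> \<open>A squeeze: half of \<open>card ?T\<close> equals \<open>card ?Y\<close>, which
    is at most the number of cycles of \<open>?h\<close>; that is one less than the sum over the two
    segments, hence at most half of \<open>card ?T\<close> again. All bounds are attained.\<close>
  have "card (cycles_on ?T (g \<circ> s)) = card (cycles_on ?T ?h) + 1"
    by (rule card_cycles_on_merge[OF stgT abT bna])
  moreover have "card (cycles_on ?T (g \<circ> s)) = card (cycles_on (S j) (g \<circ> s)) + card (cycles_on (S k) (g \<circ> s))"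
    by (rule card_cycles_on_Un[OF stj stk disj(3)])
  moreover have "card ?T = card (S j) + card (S k)" using disj by (simp add: card_Un_disjoint)
  moreover have "card ?Y \<le> card (cycles_on ?T ?h)" by (rule card_partition_le_cycles_on(1)[OF Y sth]) (rule hY')
  ultimately have cj': "2 * card (cycles_on (S j) (g \<circ> s)) = card (S j) + 1"
    and ck': "2 * card (cycles_on (S k) (g \<circ> s)) = card (S k) + 1"
    and "card (cycles_on ?T ?h) \<le> card ?Y"
    using cj ck s2(4) by linarith+
  then have Yeq: "?Y = cycles_on ?T ?h"
    by (intro card_partition_le_cycles_on(2)[OF Y sth] hY')
  have v: "v = orbit (g \<circ> s) e" "v = orbit (g \<circ> s) f"
    using ef block_of_cycles_on[OF stab_comp[OF gi sti]] Xeq by simp_all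
  then have "f \<in> orbit (g \<circ> s) e" using self_in_orbit[OF stab_comp[OF gi sti], of f] by simp
  moreover have "w = orbit ?h a" using ab(3) block_of_cycles_on[OF sth abT(1)] Yeq by simp
  moreover have "P = join_at ?X v ?Y w"
    using join restrict_partition_self[OF P] M_eq by (simp add: T_quot_eq part_graph_def Un_assoc)
  ultimately have "P = glued s i j k a b e" using v(1) Xeq Yeq by (simp add: glued_def)
  moreover have "\<forall>l\<in>{0, 1, 2}. s ` S l \<subseteq> S l" using sj sk si_in ijk[symmetric] by auto
  then have "loop_data s i j k a b e f"
    unfolding loop_data_def
    using ijk perm pM ab(1,2) ef(1-3) \<open>f \<in> orbit (g \<circ> s) e\<close> cX' cj' ck' by blast
  ultimately show ?thesis by blast
qed

section \<open>Recovering the involution from the graph\<close>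

lemma data_parity:
  assumes "loop_data s i j k a b e f"
  shows "even (card (S i))" "odd (card (S j))" "odd (card (S k))"
proof -
  have "2 * card (cycles_on (S i) (g \<circ> s)) = card (S i)"
    "2 * card (cycles_on (S j) (g \<circ> s)) = card (S j) + 1"
    "2 * card (cycles_on (S k) (g \<circ> s)) = card (S k) + 1"
    using assms unfolding loop_data_def by blast+
  then show "even (card (S i))" "odd (card (S j))" "odd (card (S k))" by presburger+
qed

text \<open>Parity identifies \<open>i\<close>, and the fixed points of \<open>s\<close> in the
  segment and in its complement give the rest, but only as unordered pairs.\<close>

lemma data_same_s:
  assumes d: "loop_data s i j k a b e f" and d': "loop_data s i' j' k' a' b' e' f'"
  shows "i' = i" "{a', b'} = {a, b}" "{e', f'} = {e, f}"
proof -
  have "i' \<in> {i, j, k}" using data_ijk(4)[OF d'] d by (auto simp: loop_data_def)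
  then show i: "i' = i" using data_parity[OF d] data_parity[OF d'] by auto
  show "{e', f'} = {e, f}"
    using data_pairing(1)[OF d] data_pairing(1)[OF d'] i by (simp add: pairing_except_def)
  have "S j \<union> S k = M - S i" "S j' \<union> S k' = M - S i"
    using data_ijk(7)[OF d] data_disjoint(4)[OF d] data_ijk(7)[OF d'] data_disjoint(4)[OF d'] i by blast+
  then show "{a', b'} = {a, b}"
    using data_pairing(4)[OF d] data_pairing(4)[OF d'] by (simp add: pairing_except_def)
qed

text \<open>Restricting the glued partition to the two components returns their graphs, each of
  which determines its pairing. Conversely, \<open>e\<close> and \<open>f\<close> lie in one cycle,
  and \<open>a\<close> and \<open>b\<close> in one merged cycle, so a change of labels has no
  effect.\<close>

lemma glued_eq_iff:
  assumes d: "loop_data s i j k a b e f" and d': "loop_data s' i' j' k' a' b' e' f'"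
  shows "glued s i j k a b e = glued s' i' j' k' a' b' e' \<longleftrightarrow> s = s'"
proof
  assume eq: "glued s i j k a b e = glued s' i' j' k' a' b' e'"
  have "i' \<in> {i, j, k}" using data_ijk(4)[OF d'] d by (auto simp: loop_data_def)
  then have i: "i' = i" using data_parity[OF d] data_parity[OF d'] by auto
  have T: "S j' \<union> S k' = S j \<union> S k"
    using data_ijk(7)[OF d] data_disjoint(4)[OF d] data_ijk(7)[OF d'] data_disjoint(4)[OF d'] i by blast
  have X: "cycles_on (S i) (g \<circ> s') = cycles_on (S i) (g \<circ> s)"
    using eq glued_restrict(2)[OF d] glued_restrict(2)[OF d'] i by simp
  have Y: "cycles_on (S j \<union> S k) (g \<circ> s' \<circ> transpose a' b') =
      cycles_on (S j \<union> S k) (g \<circ> s \<circ> transpose a b)"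
    using eq glued_restrict(3)[OF d] glued_restrict(3)[OF d'] T by simp
  have "s x = s' x" if x: "x \<in> S i" for x
    using pairing_except_unique[OF data_X(1,2)[OF d] data_pairing(1)[OF d] data_points(5)[OF d] data_X(3)[OF d]
        _ data_points(5)[OF d'] _ data_X(4-6)[OF d] x]
      data_pairing(1)[OF d'] data_X(3)[OF d'] i X by simp
  moreover have "s x = s' x" if x: "x \<in> S j \<union> S k" for x
    using pairing_except_unique[OF data_Y(1,2)[OF d] data_pairing(4)[OF d] data_points(6)[OF d] data_Y(3)[OF d]
        _ data_points(6)[OF d'] _ data_Y(4-6)[OF d] x]
      data_pairing(4)[OF d'] data_Y(3)[OF d'] T Y by simp
  moreover have "s x = s' x" if "x \<notin> M" for x
    using that data_perm(1)[OF d] data_perm(1)[OF d'] by (simp add: permutes_def)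
  ultimately show "s = s'" using data_ijk(7)[OF d] by blast
next
  assume "s = s'"
  then have d2: "loop_data s i' j' k' a' b' e' f'" using d' by simp
  note same = data_same_s[OF d d2]
  have T: "S j' \<union> S k' = S j \<union> S k"
    using data_ijk(7)[OF d] data_disjoint(4)[OF d] data_ijk(7)[OF d'] data_disjoint(4)[OF d'] same(1) by blast
  have "orbit (g \<circ> s) f = orbit (g \<circ> s) e"
    using d orbit_eq_stab[OF stab_gs[OF d data_ijk(4)[OF d]]] by (simp add: loop_data_def)
  then have oe: "orbit (g \<circ> s) e' = orbit (g \<circ> s) e" using same(3) by (auto simp: doubleton_eq_iff)
  have t: "transpose a' b' = transpose a b" and "a' = a \<or> a' = b"
    using same(2) by (auto simp: doubleton_eq_iff transpose_commute)
  moreover have "orbit (g \<circ> s \<circ> transpose a b) b = orbit (g \<circ> s \<circ> transpose a b) a"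
    using orbit_eq_stab[OF stab_merged[OF d] orbit_merge[OF stab_gs_Un[OF d] data_b_notin[OF d]]] .
  ultimately have "orbit (g \<circ> s \<circ> transpose a' b') a' = orbit (g \<circ> s \<circ> transpose a b) a" by auto
  then show "glued s i j k a b e = glued s' i' j' k' a' b' e'"
    using T oe t same(1) \<open>s = s'\<close> by (simp add: glued_def)
qed

end

section \<open>Partitioned permutations\<close>

lemma involution_of_card_orbit:
  assumes q: "stab q A" and x: "x \<in> A" and c: "card (orbit q x) \<le> 2"
  shows "q (q x) = x"
proof (rule ccontr)
  assume ne: "q (q x) \<noteq> x"
  have inj: "inj q" using q by (simp add: stab_def permutation_bijective bij_is_inj)
  have "q x \<noteq> x" using ne by auto
  moreover have "q (q x) \<noteq> q x" using injD[OF inj] \<open>q x \<noteq> x\<close> by blast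
  ultimately have "card {x, q x, q (q x)} = 3" using ne by auto
  moreover have "{x, q x, q (q x)} \<subseteq> orbit q x"
    using self_in_orbit[OF q] orbit.base[of q x] orbit.step[of "q x" q x] by simp
  moreover have "finite (orbit q x)"
    using orbit_subset_stab[OF q x] stab_finite[OF q] finite_subset by blast
  ultimately have "3 \<le> card (orbit q x)" using card_mono by metis
  then show False using c by simp
qed

lemma all_cycles_card_2_iff:
  assumes q: "stab q A"
  shows "(\<forall>C\<in>cycles_on A q. card C = 2) \<longleftrightarrow> (\<forall>x\<in>A. q (q x) = x \<and> q x \<noteq> x)"
proof
  assume c: "\<forall>C\<in>cycles_on A q. card C = 2"
  have "q (q x) = x \<and> q x \<noteq> x" if x: "x \<in> A" for x
  proof -
    have "card (orbit q x) = 2" using c x by (simp add: cycles_on_def)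
    moreover then have "q (q x) = x" using involution_of_card_orbit[OF q x] by simp
    moreover have "q x \<noteq> x"
    proof
      assume "q x = x"
      then have "orbit q x = {x}" by (simp add: orbit_eq_singleton_iff)
      then show False using \<open>card (orbit q x) = 2\<close> by simp
    qed
    ultimately show ?thesis by blast
  qed
  then show "\<forall>x\<in>A. q (q x) = x \<and> q x \<noteq> x" by blast
next
  assume inv: "\<forall>x\<in>A. q (q x) = x \<and> q x \<noteq> x"
  have "card (orbit q x) = 2" if "x \<in> A" for x
  proof -
    have "q (q x) = x" "x \<noteq> q x" using inv that by metis+
    then show ?thesis using orbit_involution[of q x] by simp
  qed
  then show "\<forall>C\<in>cycles_on A q. card C = 2" by (auto simp: cycles_on_def)
qed

text \<open>Since \<open>B\<close> is a union of cycles, the other blocks must be precisely the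
  cycles outside it. Thus \<open>t\<close> and \<open>B\<close> leave no choice for
  \<open>V\<close>.\<close>

lemma one_merged_block_iff:
  assumes t: "stab t A" and B: "B \<subseteq> A" "B \<noteq> {}" "\<And>x. x \<in> B \<Longrightarrow> t x \<in> B"
  shows "one_merged_block A V t B \<longleftrightarrow> V = insert B (orbit t ` (A - B))"
proof
  assume om: "one_merged_block A V t B"
  then have V: "partition_on A V" "B \<in> V" and cyc: "\<And>D. D \<in> V - {B} \<Longrightarrow> D \<in> cycles_on A t"
    by (auto simp: one_merged_block_def)
  have disj: "D \<inter> B = {}" if "D \<in> V" "D \<noteq> B" for D
    using V that by (auto simp: partition_on_def disjoint_def)
  show "V = insert B (orbit t ` (A - B))"
  proof (intro equalityI subsetI)
    fix D assume D: "D \<in> V"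
    show "D \<in> insert B (orbit t ` (A - B))"
    proof (cases "D = B")
      case False
      then obtain x where "x \<in> A" "D = orbit t x" using cyc D by (auto simp: cycles_on_def)
      then show ?thesis using disj[OF D False] self_in_orbit[OF t, of x] by blast
    qed simp
  next
    fix D assume D: "D \<in> insert B (orbit t ` (A - B))"
    show "D \<in> V"
    proof (cases "D = B")
      case False
      then obtain x where x: "x \<in> A" "x \<notin> B" "D = orbit t x" using D by blast
      then obtain E where E: "E \<in> V" "x \<in> E" using V(1) by (auto simp: partition_on_def)
      then obtain y where "E = orbit t y" using cyc[of E] x(2) by (auto simp: cycles_on_def)
      then show ?thesis using E x(3) orbit_eq_stab[OF t] by simp
    qed (use V(2) in simp)
  qed
next
  assume V: "V = insert B (orbit t ` (A - B))"
  have out: "orbit t x \<inter> B = {}" if "x \<notin> B" for x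
  proof (rule ccontr)
    assume "orbit t x \<inter> B \<noteq> {}"
    then obtain y where y: "y \<in> orbit t x" "y \<in> B" by blast
    then have "orbit t y \<subseteq> B" using B(3) by (intro orbit_closed_subset)
    then show False using orbit_eq_stab[OF t y(1)] self_in_orbit[OF t, of x] that by blast
  qed
  have "partition_on A V"
  proof (rule partition_onI)
    show "\<Union>V = A"
    proof
      have "C \<subseteq> A" if "C \<in> V" for C using that B(1) orbit_subset_stab[OF t] unfolding V by auto
      then show "\<Union>V \<subseteq> A" by blast
      show "A \<subseteq> \<Union>V"
      proof
        fix x assume "x \<in> A"
        then show "x \<in> \<Union>V" unfolding V using self_in_orbit[OF t, of x] by (cases "x \<in> B") auto
      qed
    qed
    show "{} \<notin> V" using B(2) orbit_nonempty[of t] unfolding V by (metis imageE insertE)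
    show "disjnt p q" if "p \<in> V" "q \<in> V" "p \<noteq> q" for p q
    proof -
      have D: "D = B \<or> (\<exists>x. x \<notin> B \<and> D = orbit t x)" if "D \<in> V" for D using that V by blast
      show ?thesis
        using D[OF \<open>p \<in> V\<close>] D[OF \<open>q \<in> V\<close>]
      proof (elim disjE exE conjE)
        fix x y assume "p = orbit t x" "q = orbit t y"
        then show ?thesis using \<open>p \<noteq> q\<close> orbit_eq_stab[OF t] unfolding disjnt_iff by metis
      qed (use \<open>p \<noteq> q\<close> out in \<open>auto simp: disjnt_def\<close>)
    qed
  qed
  then show "one_merged_block A V t B"
    unfolding one_merged_block_def using V by (auto simp: cycles_on_def)
qed

lemma perm_restrict_permutes:
  assumes "stab t A" shows "perm_restrict t A permutes A"
proof (rule bij_imp_permutes)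
  have "inj t" using assms by (simp add: stab_def permutation_bijective bij_is_inj)
  then have "bij_betw t A A"
    unfolding bij_betw_def using stab_image_eq[OF assms] inj_on_subset by blast
  moreover have "bij_betw (perm_restrict t A) A A \<longleftrightarrow> bij_betw t A A"
    by (rule bij_betw_cong) (simp add: perm_restrict_def)
  ultimately show "bij_betw (perm_restrict t A) A A" by blast
qed (simp add: perm_restrict_def)

lemma pairing_except_cong:
  assumes s: "pairing_except A F s" and t: "permutation t" "\<And>x. x \<in> A \<Longrightarrow> t x = s x"
  shows "pairing_except A F t"
proof -
  have "{x \<in> A. t x = x} = {x \<in> A. s x = x}" using t(2) by auto
  moreover have "t x \<in> A \<and> t (t x) = x" if x: "x \<in> A" for x
  proof -
    have "s x \<in> A" "s (s x) = x" using s x by (simp_all add: pairing_except_def)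
    then show ?thesis using t(2)[OF x] t(2)[of "s x"] by simp
  qed
  ultimately show ?thesis using s t(1) by (simp add: pairing_except_def)
qed

lemma pairing_except_Un:
  "pairing_except A F s \<Longrightarrow> pairing_except B G s \<Longrightarrow> pairing_except (A \<union> B) (F \<union> G) s"
  by (auto simp: pairing_except_def)

text \<open>Maps with the same fibres have equinumerous images. This compares the three sets
  although the labels in \<open>D\<close> are redundant.\<close>

lemma card_image_eq_card_image:
  assumes "\<And>x y. x \<in> D \<Longrightarrow> y \<in> D \<Longrightarrow> f x = f y \<longleftrightarrow> h x = h y"
  shows "card (f ` D) = card (h ` D)"
proof (rule bij_betw_same_card)
  let ?p = "\<lambda>z. h (inv_into D f z)"
  have p: "?p (f x) = h x" if "x \<in> D" for x
    using assms[of "inv_into D f (f x)" x] that by (simp add: inv_into_into f_inv_into_f)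
  show "bij_betw ?p (f ` D) (h ` D)"
    unfolding bij_betw_def
  proof
    show "inj_on ?p (f ` D)" by (rule inj_onI) (use p assms in fastforce)
    show "?p ` f ` D = h ` D" using p by (simp add: image_image)
  qed
qed

text \<open>The partition shared by both kinds of partitioned permutations: additional pairs inside
  \<open>F\<close> are invisible to it.\<close>

definition pairs_with :: "'a set \<Rightarrow> ('a \<Rightarrow> 'a) \<Rightarrow> 'a set \<Rightarrow> 'a set set" where
  "pairs_with A s F = insert F ((\<lambda>x. {x, s x}) ` (A - F))"

text \<open>Blocks of size 2 are never the merged block, so they are pairs of both involutions.
  Points in neither kind of pair are fixed by both.\<close>

lemma pairs_with_inj:
  assumes s: "pairing_except A F s" and s': "pairing_except A F' s'"
    and c: "card F \<noteq> 2" "card F' \<noteq> 2" and eq: "pairs_with A s F = pairs_with A s' F'"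
    and x: "x \<in> A"
  shows "s x = s' x"
proof -
  have *: "r x = r' x" if r: "pairing_except A R r" and r': "pairing_except A R' r'" and c: "card R' \<noteq> 2"
    and eq: "pairs_with A r R = pairs_with A r' R'" and x: "x \<in> A - R" for r r' R R' and x :: 'a
  proof -
    have ne: "r x \<noteq> x" using r x unfolding pairing_except_def by blast
    have "{x, r x} \<in> pairs_with A r' R'" using x eq[symmetric] by (simp add: pairs_with_def)
    moreover have "{x, r x} \<noteq> R'" using c ne by auto
    ultimately obtain u where u: "u \<in> A" "{x, r x} = {u, r' u}" by (auto simp: pairs_with_def)
    have "r' (r' u) = u" using r' u(1) by (simp add: pairing_except_def)
    then show ?thesis using u(2) ne by (auto simp: doubleton_eq_iff)
  qed
  show ?thesis
  proof (cases "x \<in> F \<and> x \<in> F'")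
    case True
    then have "s x = x" "s' x = x" using s s' unfolding pairing_except_def by blast+
    then show ?thesis by simp
  next
    case False
    then show ?thesis using *[OF s s' c(2) eq] *[OF s' s c(1) eq[symmetric]] x by force
  qed
qed

lemma one_merged_block_pairs:
  assumes t: "stab t A" and F: "F \<subseteq> A" "F \<noteq> {}" "\<And>x. x \<in> F \<Longrightarrow> t x \<in> F"
    and s: "\<And>x. x \<in> A - F \<Longrightarrow> t x = s x \<and> t (t x) = x"
  shows "one_merged_block A V t F \<longleftrightarrow> V = pairs_with A s F"
proof -
  have "orbit t x = {x, s x}" if "x \<in> A - F" for x using s[OF that] orbit_involution[of t x] by metis
  then have "orbit t ` (A - F) = (\<lambda>x. {x, s x}) ` (A - F)" by (intro image_cong) auto
  then show ?thesis using one_merged_block_iff[OF t F] by (simp add: pairs_with_def)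
qed

context three_cycles
begin

section \<open>Non-crossing conditions as cycle counts\<close>

text \<open>\<open>q\<close> is supported on \<open>A\<close>, whereas \<open>t\<close> also acts
  elsewhere. On \<open>A\<close> the inverse of \<open>q\<close> is \<open>t\<close>, so the
  complement becomes \<open>t \<circ> g\<close>, which has as many cycles as
  \<open>g \<circ> t\<close>.\<close>

lemma card_cycles_inv_comp:
  assumes A: "stab g A" "\<And>x. x \<in> A \<Longrightarrow> c x = g x" and q: "q permutes A" and t: "stab t A"
    and qt: "\<And>x. x \<in> A \<Longrightarrow> q x = t x" and inv: "\<And>x. x \<in> A \<Longrightarrow> t (t x) = x"
  shows "perm_length A q = card A - card (cycles_on A t)"
    "perm_length A (inv q \<circ> c) = card A - card (cycles_on A (g \<circ> t))"
    "perm_length A c = card A - card (cycles_on A g)"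
proof -
  have "inv q x = t x" if "x \<in> A" for x
  proof -
    have "q (t x) = x" using qt[OF stabD[OF t that]] inv[OF that] by simp
    then show ?thesis using permutes_inverses(2)[OF q, of "t x"] by simp
  qed
  then have "cycles_on A (t \<circ> g) = cycles_on A (inv q \<circ> c)"
    using A(2) stabD[OF A(1)] by (intro cycles_on_cong stab_comp t A(1)) auto
  then show "perm_length A (inv q \<circ> c) = card A - card (cycles_on A (g \<circ> t))"
    using card_cycles_on_comp_commute[OF t A(1)] by (simp add: perm_length_def)
  show "perm_length A q = card A - card (cycles_on A t)"
    using cycles_on_cong[OF t, of q] qt by (simp add: perm_length_def)
  show "perm_length A c = card A - card (cycles_on A g)"
    using cycles_on_cong[OF A(1), of c] A(2) by (simp add: perm_length_def)
qed

text \<open>The lengths are turned into cycle counts; the 1 is the single cycle of \<open>g\<close>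
  on the segment.\<close>

lemma NC_iff:
  assumes l: "l \<in> {0, 1, 2}" and q: "q permutes S l" and t: "stab t (S l)"
    and qt: "\<And>x. x \<in> S l \<Longrightarrow> q x = t x" and inv: "\<And>x. x \<in> S l \<Longrightarrow> t (t x) = x"
  shows "q \<in> NC ms l \<longleftrightarrow>
    card (cycles_on (S l) t) + card (cycles_on (S l) (g \<circ> t)) = card (S l) + 1"
proof -
  note pl = card_cycles_inv_comp[OF stab_g[OF l] g_eq[OF l, symmetric] q t qt inv]
  have "card (S l) > 0" using S_nonempty[OF l] by (simp add: card_gt_0_iff)
  moreover have "card (cycles_on (S l) t) \<le> card (S l)" "card (cycles_on (S l) (g \<circ> t)) \<le> card (S l)"
    by (simp_all add: card_cycles_on_le)
  ultimately show ?thesis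
    using q cycles_on_g[OF l] unfolding NC_def by (simp add: pl) linarith
qed

lemma NC2_iff:
  assumes l: "l \<in> {0, 1, 2}" and q: "q permutes S l" and t: "stab t (S l)"
    and qt: "\<And>x. x \<in> S l \<Longrightarrow> q x = t x"
  shows "q \<in> NC2 ms l \<longleftrightarrow> (\<forall>x\<in>S l. t (t x) = x \<and> t x \<noteq> x) \<and>
    2 * card (cycles_on (S l) (g \<circ> t)) = card (S l) + 2"
proof -
  have "cycles_on (S l) q = cycles_on (S l) t" using cycles_on_cong[OF t, of q] qt by simp
  then have "(\<forall>C\<in>cycles_on (S l) q. card C = 2) \<longleftrightarrow> (\<forall>x\<in>S l. t (t x) = x \<and> t x \<noteq> x)"
    using all_cycles_card_2_iff[OF t] by simp
  moreover have "q \<in> NC ms l \<longleftrightarrow> 2 * card (cycles_on (S l) (g \<circ> t)) = card (S l) + 2"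
    if inv: "\<forall>x\<in>S l. t (t x) = x \<and> t x \<noteq> x"
  proof -
    have "{x \<in> S l. t x = x} = {}" using inv by blast
    then have "2 * card (cycles_on (S l) t) = card (S l)"
      using card_cycles_on_involution[OF t] inv by simp
    then show ?thesis using NC_iff[OF l q t qt] inv by auto
  qed
  ultimately show ?thesis unfolding NC2_def by blast
qed

lemma NC21_iff:
  assumes l: "l \<in> {0, 1, 2}" and q: "q permutes S l" and t: "stab t (S l)"
    and qt: "\<And>x. x \<in> S l \<Longrightarrow> q x = t x"
  shows "q \<in> NC21 ms l \<longleftrightarrow> (\<exists>a\<in>S l. pairing_except (S l) {a} t) \<and>
    2 * card (cycles_on (S l) (g \<circ> t)) = card (S l) + 1"
proof -
  have cyc: "cycles_on (S l) q = orbit t ` S l"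
    using cycles_on_cong[OF t, of q] qt by (simp add: cycles_on_def)
  have perm: "permutation t" using t by (simp add: stab_def)
  have "(\<exists>A\<in>cycles_on (S l) q. card A = 1 \<and> (\<forall>C\<in>cycles_on (S l) q - {A}. card C = 2)) \<longleftrightarrow>
      (\<exists>a\<in>S l. pairing_except (S l) {a} t)" (is "?L \<longleftrightarrow> ?R")
  proof
    assume ?L
    then obtain a where a: "a \<in> S l" "card (orbit t a) = 1"
      and c2: "\<And>x. x \<in> S l \<Longrightarrow> orbit t x \<noteq> orbit t a \<Longrightarrow> card (orbit t x) = 2"
      unfolding cyc by blast
    have oa: "orbit t a = {a}" using a(2) self_in_orbit[OF t, of a] by (metis card_1_singletonE singletonD)
    have ta: "t a = a" using oa by (simp add: orbit_eq_singleton_iff)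
    have "t (t x) = x \<and> (t x = x \<longleftrightarrow> x = a)" if x: "x \<in> S l" for x
    proof (cases "x = a")
      case True then show ?thesis using ta by simp
    next
      case False
      then have "orbit t x \<noteq> orbit t a" using oa self_in_orbit[OF t, of x] by auto
      then have c: "card (orbit t x) = 2" by (rule c2[OF x])
      then have "orbit t x \<noteq> {x}" by auto
      then have "t x \<noteq> x" by (simp add: orbit_eq_singleton_iff)
      then show ?thesis using involution_of_card_orbit[OF t x] c False by simp
    qed
    then have "pairing_except (S l) {a} t"
      unfolding pairing_except_def using perm a(1) stabD[OF t] by blast
    then show ?R using a(1) by blast
  next
    assume ?R
    then obtain a where a: "a \<in> S l" "pairing_except (S l) {a} t" by blast
    have fix_iff: "t x = x \<longleftrightarrow> x = a" if "x \<in> S l" for x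
      using a(2) that unfolding pairing_except_def by blast
    have inv: "t (t x) = x" if "x \<in> S l" for x using a(2) that by (simp add: pairing_except_def)
    have oa: "orbit t a = {a}" using fix_iff[OF a(1)] by (simp add: orbit_eq_singleton_iff)
    have "card (orbit t x) = 2" if "x \<in> S l" "x \<noteq> a" for x
      using orbit_involution[of t x, OF inv[OF that(1)]] fix_iff[OF that(1)] that(2) by (simp add: card_insert_if)
    then show ?L unfolding cyc using oa a(1) by (intro bexI[of _ "orbit t a"]) auto
  qed
  moreover have "q \<in> NC ms l \<longleftrightarrow> 2 * card (cycles_on (S l) (g \<circ> t)) = card (S l) + 1"
    if a: "pairing_except (S l) {a} t" for a
  proof -
    have "2 * card (cycles_on (S l) t) = card (S l) + 1"
      using card_cycles_on_pairing_except[OF _ a] by simp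
    then show ?thesis using NC_iff[OF l q t qt] a by (auto simp: pairing_except_def)
  qed
  ultimately show ?thesis unfolding NC21_def by blast
qed

lemma comp_three:
  assumes q: "\<And>l. l \<in> {0, 1, 2} \<Longrightarrow> q l permutes S l"
  shows "q 0 \<circ> q 1 \<circ> q 2 permutes M" "\<And>l x. l \<in> {0, 1, 2} \<Longrightarrow> x \<in> S l \<Longrightarrow> (q 0 \<circ> q 1 \<circ> q 2) x = q l x"
proof -
  have "q l permutes M" if "l \<in> {0, 1, 2}" for l
    using permutes_subset[OF q[OF that]] M_eq that by blast
  then show "q 0 \<circ> q 1 \<circ> q 2 permutes M" by (intro permutes_compose) auto
  show "(q 0 \<circ> q 1 \<circ> q 2) x = q l x" if l: "l \<in> {0, 1, 2}" and x: "x \<in> S l" for l x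
  proof -
    have o: "q j y = y" if "y \<in> S l" "j \<in> {0, 1, 2}" "j \<noteq> l" for j y
    proof -
      have "S l \<inter> S j = {}" using that l by (intro S_disjoint) auto
      then show ?thesis using q[OF that(2)] that(1) unfolding permutes_def by blast
    qed
    have "q l x \<in> S l" using q[OF l] x by (simp add: permutes_in_image)
    note o' = o[OF x] o[OF this]
    consider "l = 0" | "l = 1" | "l = 2" using l by blast
    then show ?thesis by cases (use o' in simp_all)
  qed
qed

lemma comp_two:
  assumes A: "A \<inter> B = {}" and p: "p permutes A" "q permutes B"
  shows "p \<circ> q permutes A \<union> B" "x \<in> A \<Longrightarrow> (p \<circ> q) x = p x" "x \<in> B \<Longrightarrow> (p \<circ> q) x = q x"
proof -
  show "p \<circ> q permutes A \<union> B"
    using permutes_subset[OF p(1), of "A \<union> B"] permutes_subset[OF p(2), of "A \<union> B"]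
    by (intro permutes_compose) auto
  show "(p \<circ> q) x = p x" if "x \<in> A" using p(2) A that by (auto simp: permutes_def)
  show "(p \<circ> q) x = q x" if "x \<in> B"
  proof -
    have "q x \<in> B" using p(2) that by (simp add: permutes_in_image)
    then show ?thesis using p(1) A by (auto simp: permutes_def)
  qed
qed

text \<open>In the quotient graph, unpairing \<open>e\<close> and \<open>f\<close> contracts their double edge to two loops at one vertex.\<close>

lemma NC2_unpair_iff:
  assumes i: "i \<in> {0, 1, 2}" and s: "pairing_except (S i) {e, f} s" and ef: "e \<noteq> f"
  shows "2 * card (cycles_on (S i) (g \<circ> s \<circ> transpose e f)) = card (S i) + 2 \<longleftrightarrow>
    f \<in> orbit (g \<circ> s) e \<and> 2 * card (cycles_on (S i) (g \<circ> s)) = card (S i)"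
proof -
  have efS: "e \<in> S i" "f \<in> S i" using s unfolding pairing_except_def by blast+
  have st: "stab (g \<circ> s) (S i)"
    by (intro stab_comp stab_g[OF i] pairing_except_stab[OF _ s]) simp
  have le: "2 * card (cycles_on (S i) (g \<circ> s)) \<le> card (S i)"
    using genus_S[OF i s] ef by simp
  show ?thesis
    using card_cycles_on_split[OF st efS _ ef] card_cycles_on_merge[OF st efS] le
    by (cases "f \<in> orbit (g \<circ> s) e") auto
qed

section \<open>Partitioned permutations of the two kinds\<close>

context
  fixes s i j k a b e f
  assumes dat: "loop_data s i j k a b e f"
begin

lemma data_card_F: "card {a, b, e, f} = 4"
  using data_points[OF dat] by auto

lemma data_F: "{a, b, e, f} \<subseteq> M"
  using data_points[OF dat] data_ijk(7)[OF dat] by blast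

lemma data_fixed: "s a = a" "s b = b" "s e = e" "s f = f"
  using data_fix[OF dat] by blast+

lemma data_moved: "x \<in> M \<Longrightarrow> x \<notin> {a, b, e, f} \<Longrightarrow> s x \<noteq> x \<and> s x \<in> M - {a, b, e, f}"
proof -
  assume x: "x \<in> M" "x \<notin> {a, b, e, f}"
  have "s x \<noteq> x" using data_fix[OF dat] x by blast
  moreover have "s x \<in> M" using x(1) data_perm(1)[OF dat] by (simp add: permutes_in_image)
  moreover have "s x \<notin> {a, b, e, f}" using data_fixed data_invol[OF dat, of x] x(2) by force
  ultimately show ?thesis by blast
qed

lemma transpose_in_S:
  "l \<in> {0, 1, 2} \<Longrightarrow> x \<in> S l \<Longrightarrow> transpose e f x \<in> S l"
proof -
  assume l: "l \<in> {0, 1, 2}" and x: "x \<in> S l"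
  show ?thesis
  proof (cases "l = i")
    case True then show ?thesis using x data_points[OF dat] by (simp add: transpose_def)
  next
    case False
    then have "S l \<inter> S i = {}" using S_disjoint[OF l data_ijk(4)[OF dat]] by simp
    then have "x \<noteq> e" "x \<noteq> f" using x data_points[OF dat] by blast+
    then show ?thesis using x by simp
  qed
qed

lemma stab_t: "l \<in> {0, 1, 2} \<Longrightarrow> stab (s \<circ> transpose e f) (S l)"
  using transpose_in_S stabD[OF stab_s[OF dat]] data_perm(2)[OF dat]
  by (auto simp: stab_def permutation_compose permutation_swap_id)

lemma t_simps: "x \<notin> {e, f} \<Longrightarrow> (s \<circ> transpose e f) x = s x"
  "(s \<circ> transpose e f) e = f" "(s \<circ> transpose e f) f = e"
  using data_fixed by auto

text \<open>Only the values on \<open>S i\<close> matter, so this serves both families, whether or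
  not \<open>a\<close> and \<open>b\<close> are paired as well.\<close>

lemma t_in_NC2:
  assumes q: "q permutes S i" "\<And>x. x \<in> S i \<Longrightarrow> q x = (s \<circ> transpose e f) x"
  shows "q \<in> NC2 ms i"
proof -
  let ?t = "s \<circ> transpose e f"
  note i = data_ijk(4)[OF dat]
  have "?t (?t x) = x \<and> ?t x \<noteq> x" if x: "x \<in> S i" for x
  proof (cases "x \<in> {e, f}")
    case True then show ?thesis using t_simps data_points[OF dat] by auto
  next
    case False
    have "{x \<in> S i. s x = x} = {e, f}" using data_pairing(1)[OF dat] by (simp add: pairing_except_def)
    then have "s x \<noteq> x" using False x by blast
    moreover have "s x \<notin> {e, f}" using False data_fixed data_invol[OF dat, of x] by force
    ultimately show ?thesis using t_simps(1)[OF False] t_simps(1)[of "s x"] data_invol[OF dat] by simp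
  qed
  moreover have "2 * card (cycles_on (S i) (g \<circ> ?t)) = card (S i) + 2"
    using NC2_unpair_iff[OF i data_pairing(1)[OF dat] data_points(5)[OF dat]] dat
    by (simp add: loop_data_def comp_assoc)
  ultimately show ?thesis using NC2_iff[OF i q(1) stab_t[OF i] q(2)] by blast
qed

lemma data_in_PS_111:
  "(pairs_with M s {a, b, e, f}, s \<circ> transpose e f) \<in> PS_111_NC211 m1 m2 m3"
proof -
  let ?t = "s \<circ> transpose e f"
  \<comment> \<open>The factors have to be the identity off their own segment, which
    \<open>perm_restrict\<close> provides.\<close>
  define q where "q l = perm_restrict ?t (S l)" for l
  have qp: "q l permutes S l" if "l \<in> {0, 1, 2}" for l
    unfolding q_def by (rule perm_restrict_permutes[OF stab_t[OF that]])
  have qt: "q l x = ?t x" if "x \<in> S l" for l x using that by (simp add: q_def perm_restrict_def)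
  have tM: "?t permutes M"
    using data_perm(1)[OF dat] data_F by (intro permutes_compose permutes_swap_id) auto
  have "?t = q 0 \<circ> q 1 \<circ> q 2"
  proof
    fix x
    show "?t x = (q 0 \<circ> q 1 \<circ> q 2) x"
    proof (cases "x \<in> M")
      case True
      then obtain l where "l \<in> {0, 1, 2}" "x \<in> S l" using M_eq by blast
      then show ?thesis using comp_three(2)[of q l x] qp qt by simp
    next
      case False
      then show ?thesis using tM comp_three(1)[of q] qp unfolding permutes_def by metis
    qed
  qed
  note ijk = data_ijk(4-6)[OF dat]
  note pts = data_points[OF dat]
  have st: "?t x = s x" if "x \<in> S j \<union> S k" for x
    using t_simps(1)[of x] pts data_disjoint(4)[OF dat] that by blast
  have cycs: "cycles_on (S l) (g \<circ> ?t) = cycles_on (S l) (g \<circ> s)" if "l \<in> {j, k}" for l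
  proof (rule cycles_on_cong)
    have l: "l \<in> {0, 1, 2}" using that ijk by blast
    show "stab (g \<circ> ?t) (S l)" by (rule stab_comp[OF stab_g[OF l] stab_t[OF l]])
    show "(g \<circ> ?t) x = (g \<circ> s) x" if "x \<in> S l" for x
      using st[of x] that \<open>l \<in> {j, k}\<close> by auto
  qed
  have "permutation ?t" using stab_t[OF ijk(1)] by (simp add: stab_def)
  then have pe: "pairing_except (S j) {a} ?t" "pairing_except (S k) {b} ?t"
    using pairing_except_cong[OF data_pairing(2)[OF dat]] pairing_except_cong[OF data_pairing(3)[OF dat]] st
    by simp_all
  have NC2: "q i \<in> NC2 ms i" using t_in_NC2[OF qp qt] ijk by blast
  have cnt: "2 * card (cycles_on (S j) (g \<circ> ?t)) = card (S j) + 1"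
    "2 * card (cycles_on (S k) (g \<circ> ?t)) = card (S k) + 1"
    using cycs[of j] cycs[of k] dat unfolding loop_data_def by simp_all
  have NC21: "q l \<in> NC21 ms l \<longleftrightarrow> (\<exists>a\<in>S l. pairing_except (S l) {a} ?t) \<and>
      2 * card (cycles_on (S l) (g \<circ> ?t)) = card (S l) + 1" if "l \<in> {0, 1, 2}" for l
    by (rule NC21_iff[OF that qp[OF that] stab_t[OF that] qt])
  have NCj: "q j \<in> NC21 ms j" using NC21[OF ijk(2)] pe(1) pts(1) cnt(1) by blast
  have NCk: "q k \<in> NC21 ms k" using NC21[OF ijk(3)] pe(2) pts(2) cnt(2) by blast
  have set3: "{i, j, k} = {0, 1, 2}" using dat unfolding loop_data_def by (elim conjE)
  then have set3': "{j, k, i} = {0, 1, 2}" by (simp only: insert_commute)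
  have NC: "\<forall>l\<in>{0, 1, 2}. q l \<in> NC ms l"
    using NC2 NCj NCk set3 unfolding NC2_def NC21_def by (metis (no_types, lifting) insertE mem_Collect_eq singletonD)
  have "q j a = a" "q k b = b"
    using qt[OF pts(1)] qt[OF pts(2)] st[of a] st[of b] data_fixed pts by simp_all
  then have "orbit (q j) a = {a}" "orbit (q k) b = {b}" by (simp_all add: orbit_eq_singleton_iff)
  then have A1: "{a} \<in> cycles_on (S j) (q j)" and A2: "{b} \<in> cycles_on (S k) (q k)"
    unfolding cycles_on_def using pts by (metis imageI)+
  have "q i e = f" "q i f = e" using qt[OF pts(3)] qt[OF pts(4)] t_simps(2,3) by simp_all
  then have "orbit (q i) e = {e, f}" using orbit_involution[of "q i" e] by simp
  then have C: "{e, f} \<in> cycles_on (S i) (q i)" unfolding cycles_on_def using pts(3) by (metis imageI)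
  have "one_merged_block M (pairs_with M s {a, b, e, f}) ?t {a, b, e, f}"
  proof -
    have "stab ?t M" by (rule permutes_stab[OF finite_M tM])
    moreover have "?t x = s x \<and> ?t (?t x) = x" if "x \<in> M - {a, b, e, f}" for x
      using data_moved[of x] that t_simps(1)[of x] t_simps(1)[of "s x"] data_invol[OF dat] by auto
    moreover have "?t x \<in> {a, b, e, f}" if "x \<in> {a, b, e, f}" for x
      using that st[of a] st[of b] pts data_fixed t_simps by auto
    ultimately show ?thesis using one_merged_block_pairs[OF _ data_F] by blast
  qed
  moreover have "{a, b, e, f} = {a} \<union> {b} \<union> {e, f}" by blast
  ultimately have "one_merged_block {1..m1 + m2 + m3} (pairs_with M s {a, b, e, f}) ?t ({a} \<union> {b} \<union> {e, f})"
    by (simp add: M_def)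
  then show ?thesis
    unfolding PS_111_NC211_def Let_def using \<open>?t = q 0 \<circ> q 1 \<circ> q 2\<close> NC NC2 NCj NCk A1 A2 C set3'
    by (intro CollectI case_prodI exI[of _ q] conjI exI[of _ j] exI[of _ k] exI[of _ i]
      bexI[OF _ A1] bexI[OF _ A2] bexI[OF _ C]) simp_all
qed

end

lemma annular_gamma:
  assumes "j \<in> {0, 1, 2}" "k \<in> {0, 1, 2}" "j \<noteq> k" "x \<in> S j \<union> S k"
  shows "(gc j \<circ> gc k) x = g x"
  using comp_two(2,3)[OF S_disjoint[OF assms(1-3)] gc_permutes gc_permutes, of x] assms(4)
    g_eq[OF assms(1), of x] g_eq[OF assms(2), of x] by auto

text \<open>One crossing pair links the two cycles: every point reaches \<open>a\<close> through its
  own cycle and, if necessary, through that pair.\<close>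

lemma partition_join_annular:
  assumes jk: "j \<in> {0, 1, 2}" "k \<in> {0, 1, 2}" "j \<noteq> k"
    and p: "stab p (S j \<union> S k)" and a: "a \<in> S j" "p a \<in> S k"
  shows "partition_join (cycles_on (S j \<union> S k) p) (cycles_on (S j \<union> S k) (gc j \<circ> gc k)) = {S j \<union> S k}"
proof -
  let ?T = "S j \<union> S k" and ?c = "gc j \<circ> gc k"
  let ?P = "cycles_on ?T p" and ?Q = "cycles_on ?T ?c"
  let ?r = "{(x, y). \<exists>B\<in>?P \<union> ?Q. x \<in> B \<and> y \<in> B}"
  have gT: "stab g ?T" by (rule stab_g_Un[OF jk(1,2)])
  have Q: "?Q = cycles_on ?T g"
    using cycles_on_cong[OF gT] annular_gamma[OF jk] by (metis (no_types, lifting))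
  have UP: "\<Union>?P = ?T" "\<Union>?Q = ?T"
    using partition_cycles_on[OF p] partition_cycles_on[OF gT] Q by (simp_all add: partition_on_def)
  have SQ: "S j \<in> ?Q" "S k \<in> ?Q"
    using cycles_on_g[OF jk(1)] cycles_on_g[OF jk(2)] Q by (simp_all add: cycles_on_Un)
  have aP: "orbit p a \<in> ?P" using a(1) by (simp add: cycles_on_def)
  have link: "(a, p a) \<in> ?r" "(p a, a) \<in> ?r"
    using aP self_in_orbit[OF p, of a] orbit.base[of p a] by blast+
  have to_a: "(x, a) \<in> ?r\<^sup>+ \<and> (a, x) \<in> ?r\<^sup>+" if x: "x \<in> ?T" for x
  proof (cases "x \<in> S j")
    case True
    then have "(x, a) \<in> ?r" "(a, x) \<in> ?r" using SQ(1) a(1) by blast+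
    then show ?thesis by blast
  next
    case False
    then have "(x, p a) \<in> ?r" "(p a, x) \<in> ?r" using SQ(2) a(2) x by blast+
    then show ?thesis using link by (meson r_into_trancl trancl_trans)
  qed
  have sub: "?r \<subseteq> ?T \<times> ?T" using UP by blast
  have "?r\<^sup>+ `` {x} = ?T" if x: "x \<in> ?T" for x
  proof
    show "?r\<^sup>+ `` {x} \<subseteq> ?T" using trancl_subset_Sigma[OF sub] by blast
    show "?T \<subseteq> ?r\<^sup>+ `` {x}"
    proof
      fix y assume "y \<in> ?T"
      then have "(x, y) \<in> ?r\<^sup>+" using to_a[OF x] to_a by (meson trancl_trans)
      then show "y \<in> ?r\<^sup>+ `` {x}" by simp
    qed
  qed
  then have "?T // ?r\<^sup>+ = {?T}" using a(1) unfolding quotient_def by auto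
  then show ?thesis using UP by (simp add: partition_join_def)
qed

text \<open>The summand 2 in the annular condition cancels the two cycles of \<open>g\<close>,
  leaving that \<open>t\<close> and \<open>g \<circ> t\<close> have
  \<open>card (S j \<union> S k)\<close> cycles together; the pairing \<open>t\<close> contributes
  half of them.\<close>

lemma NC2_annular_iff:
  assumes jk: "j \<in> {0, 1, 2}" "k \<in> {0, 1, 2}" "j \<noteq> k"
    and p: "p permutes S j \<union> S k" and t: "stab t (S j \<union> S k)"
    and pt: "\<And>x. x \<in> S j \<union> S k \<Longrightarrow> p x = t x" and a: "a \<in> S j" "t a \<in> S k"
  shows "p \<in> NC2_annular ms j k \<longleftrightarrow> (\<forall>x\<in>S j \<union> S k. t (t x) = x \<and> t x \<noteq> x) \<and>
    2 * card (cycles_on (S j \<union> S k) (g \<circ> t)) = card (S j \<union> S k)"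
proof -
  let ?T = "S j \<union> S k"
  have fin: "finite ?T" by simp
  have pst: "stab p ?T" by (rule permutes_stab[OF fin p])
  have "p a \<in> S k" using pt[of a] a by simp
  then have join: "partition_join (cycles_on ?T p) (cycles_on ?T (gc j \<circ> gc k)) = {?T}"
    by (rule partition_join_annular[OF jk pst a(1)])
  have "cycles_on ?T p = cycles_on ?T t" using cycles_on_cong[OF pst pt] .
  then have two: "(\<forall>C\<in>cycles_on ?T p. card C = 2) \<longleftrightarrow> (\<forall>x\<in>?T. t (t x) = x \<and> t x \<noteq> x)"
    using all_cycles_card_2_iff[OF t] by simp
  have "perm_length ?T p + perm_length ?T (inv p \<circ> (gc j \<circ> gc k)) = perm_length ?T (gc j \<circ> gc k) + 2
      \<longleftrightarrow> 2 * card (cycles_on ?T (g \<circ> t)) = card ?T"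
    if inv: "\<forall>x\<in>?T. t (t x) = x \<and> t x \<noteq> x"
  proof -
    note pl = card_cycles_inv_comp[OF stab_g_Un[OF jk(1,2)] annular_gamma[OF jk] p t pt]
    have "{x \<in> ?T. t x = x} = {}" using inv by blast
    then have "2 * card (cycles_on ?T t) = card ?T"
      using card_cycles_on_involution[OF t] inv by simp
    moreover have "card (cycles_on ?T (g \<circ> t)) \<le> card ?T" "card (cycles_on ?T g) \<le> card ?T"
      by (simp_all add: card_cycles_on_le)
    moreover have "card (cycles_on ?T g) = 2" by (rule card_cycles_on_g_Un[OF jk])
    moreover have "perm_length ?T p = card ?T - card (cycles_on ?T t)"
      "perm_length ?T (inv p \<circ> (gc j \<circ> gc k)) = card ?T - card (cycles_on ?T (g \<circ> t))"
      "perm_length ?T (gc j \<circ> gc k) = card ?T - card (cycles_on ?T g)"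
      using pl inv by blast+
    ultimately show ?thesis by linarith
  qed
  then show ?thesis unfolding NC2_annular_def Let_def using p two join by blast
qed

text \<open>The involution \<open>s\<close> is quantified in the conclusion because the two families
  build it by different products, which agree on \<open>S i\<close>.\<close>

lemma NC2_unpair:
  assumes i: "i \<in> {0, 1, 2}" and q: "q \<in> NC2 ms i" and t: "stab t (S i)"
    and qt: "\<And>x. x \<in> S i \<Longrightarrow> q x = t x" and C: "C \<in> cycles_on (S i) q"
  obtains e f where "C = {e, f}" "e \<noteq> f" "e \<in> S i" "f \<in> S i"
    "\<forall>s. permutation s \<longrightarrow> (\<forall>x\<in>S i. s x = t (transpose e f x)) \<longrightarrow>
      pairing_except (S i) {e, f} s \<and> f \<in> orbit (g \<circ> s) e \<and>
      2 * card (cycles_on (S i) (g \<circ> s)) = card (S i)"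
proof -
  have qp: "q permutes S i" using q by (simp add: NC2_def NC_def)
  have tt: "\<forall>x\<in>S i. t (t x) = x \<and> t x \<noteq> x"
    and cnt: "2 * card (cycles_on (S i) (g \<circ> t)) = card (S i) + 2"
    using NC2_iff[OF i qp t qt] q by blast+
  obtain e where e: "e \<in> S i" "C = orbit q e" using C by (auto simp: cycles_on_def)
  define f where "f = t e"
  have f: "f \<in> S i" "t f = e" "f \<noteq> e" using stabD[OF t e(1)] tt e(1) by (auto simp: f_def)
  have "C = {e, f}"
    using e orbit_involution[of q e] qt[OF e(1)] qt[OF f(1)] f by (simp add: f_def)
  moreover have "pairing_except (S i) {e, f} s \<and> f \<in> orbit (g \<circ> s) e \<and>
      2 * card (cycles_on (S i) (g \<circ> s)) = card (S i)"
    if s: "permutation s" "\<forall>x\<in>S i. s x = t (transpose e f x)" for s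
  proof -
    have tr: "transpose e f x \<in> S i" if "x \<in> S i" for x using that e f by (simp add: transpose_def)
    have sef: "s e = e" "s f = f" using s(2) e(1) f by (simp_all add: f_def)
    have so: "s x = t x \<and> t x \<in> S i \<and> t x \<notin> {e, f} \<and> t (t x) = x \<and> t x \<noteq> x" if x: "x \<in> S i - {e, f}" for x
    proof -
      have "t x \<noteq> e" "t x \<noteq> f" using tt x f by (auto simp: f_def)
      then show ?thesis using x s(2) tt stabD[OF t] by auto
    qed
    have "s x \<in> S i \<and> s (s x) = x" if "x \<in> S i" for x
    proof (cases "x \<in> {e, f}")
      case True then show ?thesis using sef e f by auto
    next
      case False then show ?thesis using so[of x] so[of "t x"] that by auto
    qed
    moreover have "{x \<in> S i. s x = x} = {e, f}" using sef so e f by force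
    ultimately have pe: "pairing_except (S i) {e, f} s" using s(1) by (simp add: pairing_except_def)
    have "cycles_on (S i) (g \<circ> t) = cycles_on (S i) (g \<circ> s \<circ> transpose e f)"
      using s(2) tr by (intro cycles_on_cong stab_comp stab_g[OF i] t) simp
    then show ?thesis using NC2_unpair_iff[OF i pe] f(3) cnt pe by simp
  qed
  ultimately show ?thesis using that[of e f] e f by blast
qed

lemma NC21_single:
  assumes l: "l \<in> {0, 1, 2}" and q: "q \<in> NC21 ms l" and t: "stab t (S l)"
    and qt: "\<And>x. x \<in> S l \<Longrightarrow> q x = t x" and A: "A \<in> cycles_on (S l) q" "card A = 1"
  obtains a where "A = {a}" "a \<in> S l" "pairing_except (S l) {a} t"
    "2 * card (cycles_on (S l) (g \<circ> t)) = card (S l) + 1"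
proof -
  have qp: "q permutes S l" using q by (simp add: NC21_def NC_def)
  obtain a where a: "a \<in> S l" "pairing_except (S l) {a} t"
    and cnt: "2 * card (cycles_on (S l) (g \<circ> t)) = card (S l) + 1"
    using NC21_iff[OF l qp t qt] q by blast
  obtain x where x: "x \<in> S l" "A = orbit q x" using A(1) by (auto simp: cycles_on_def)
  have "x \<in> A" using x self_in_orbit[OF permutes_stab[OF finite_S qp]] by simp
  then have "A = {x}" using A(2) by (metis card_1_singletonE singletonD)
  then have "t x = x" using x qt by (simp add: orbit_eq_singleton_iff)
  then have "x = a" using a(2) x(1) unfolding pairing_except_def by blast
  then show ?thesis using that \<open>A = {x}\<close> a cnt by blast
qed

lemma loop_dataI:
  assumes ijk: "{i, j, k} = {0, 1, 2}" and perm: "s permutes M"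
    and pe: "pairing_except (S i) {e, f} s" "pairing_except (S j) {a} s" "pairing_except (S k) {b} s"
    and ef: "e \<noteq> f" "f \<in> orbit (g \<circ> s) e"
    and cnt: "2 * card (cycles_on (S i) (g \<circ> s)) = card (S i)"
      "2 * card (cycles_on (S j) (g \<circ> s)) = card (S j) + 1"
      "2 * card (cycles_on (S k) (g \<circ> s)) = card (S k) + 1"
  shows "loop_data s i j k a b e f"
proof -
  have "pairing_except (S i \<union> (S j \<union> S k)) ({e, f} \<union> ({a} \<union> {b})) s"
    by (intro pairing_except_Un pe)
  moreover have "{e, f} \<union> ({a} \<union> {b}) = {a, b, e, f}" by blast
  ultimately have "pairing_except M {a, b, e, f} s" using M_eq3[OF ijk] by simp
  moreover have "\<forall>l\<in>{i, j, k}. s ` S l \<subseteq> S l" using pe by (auto simp: pairing_except_def)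
  moreover have "e \<in> S i" "f \<in> S i" "a \<in> S j" "b \<in> S k" using pe unfolding pairing_except_def by blast+
  ultimately show ?thesis unfolding loop_data_def using ijk perm ef cnt by simp
qed

lemma data_one_merged_block:
  assumes dat: "loop_data s i j k a b e f" and t: "t permutes M"
    and F: "\<And>x. x \<in> {a, b, e, f} \<Longrightarrow> t x \<in> {a, b, e, f}"
    and ts: "\<And>x. x \<notin> {a, b, e, f} \<Longrightarrow> t x = s x"
  shows "one_merged_block M V t {a, b, e, f} \<longleftrightarrow> V = pairs_with M s {a, b, e, f}"
proof (rule one_merged_block_pairs[OF permutes_stab[OF finite_M t] data_F[OF dat] _ F])
  show "t x = s x \<and> t (t x) = x" if "x \<in> M - {a, b, e, f}" for x
  proof -
    have "s x \<notin> {a, b, e, f}" using data_moved[OF dat, of x] that by blast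
    then show ?thesis using ts[of x] ts[of "s x"] data_invol[OF dat, of x] that by simp
  qed
qed simp_all

text \<open>The pair merged with the two singletons is the one to be undone: its points become the
  loops \<open>e\<close> and \<open>f\<close>, and the singletons are already the loops
  \<open>a\<close> and \<open>b\<close>.\<close>

lemma PS_111_imp_data:
  assumes "(V, t) \<in> PS_111_NC211 m1 m2 m3"
  shows "\<exists>s i j k a b e f. loop_data s i j k a b e f \<and> V = pairs_with M s {a, b, e, f} \<and> t = s \<circ> transpose e f"
  using assms unfolding PS_111_NC211_def Let_def mem_Collect_eq prod.case
proof (elim exE conjE bexE)
  fix q j k i A1 A2 C
  assume tq: "t = q 0 \<circ> q 1 \<circ> q 2" and q: "\<forall>l\<in>{0, 1, 2}. q l \<in> NC ms l"
    and jki: "{j, k, i} = {0, 1, 2}"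
    and qj: "q j \<in> NC21 ms j" and qk: "q k \<in> NC21 ms k" and qi: "q i \<in> NC2 ms i"
    and A1: "A1 \<in> cycles_on (S j) (q j)" "card A1 = 1" and A2: "A2 \<in> cycles_on (S k) (q k)" "card A2 = 1"
    and C: "C \<in> cycles_on (S i) (q i)" and om: "one_merged_block {1..m1 + m2 + m3} V t (A1 \<union> A2 \<union> C)"
  have ijk: "{i, j, k} = {0, 1, 2}" using jki by (simp only: insert_commute)
  note d = distinct3[OF ijk]
  have di: "i \<in> {0, 1, 2}" and dj: "j \<in> {0, 1, 2}" and dk: "k \<in> {0, 1, 2}" using d by blast+
  have qp: "q l permutes S l" if "l \<in> {0, 1, 2}" for l
    using bspec[OF q that] by (simp add: NC_def)
  have tM: "t permutes M" and tx: "\<And>l x. l \<in> {0, 1, 2} \<Longrightarrow> x \<in> S l \<Longrightarrow> q l x = t x"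
    using comp_three[of q] qp unfolding tq by auto
  have tp: "permutation t" using tM finite_M unfolding permutation_permutes by blast
  have tst: "stab t (S l)" if l: "l \<in> {0, 1, 2}" for l
    using tp tx[OF l] permutes_in_image[OF qp[OF l]] unfolding stab_def by (metis finite_S image_subsetI)
  obtain a where a: "A1 = {a}" "a \<in> S j" "pairing_except (S j) {a} t"
      "2 * card (cycles_on (S j) (g \<circ> t)) = card (S j) + 1"
    by (rule NC21_single[OF dj qj tst[OF dj] tx[OF dj] A1])
  obtain b where b: "A2 = {b}" "b \<in> S k" "pairing_except (S k) {b} t"
      "2 * card (cycles_on (S k) (g \<circ> t)) = card (S k) + 1"
    by (rule NC21_single[OF dk qk tst[OF dk] tx[OF dk] A2])
  obtain e f where ef: "C = {e, f}" "e \<noteq> f" "e \<in> S i" "f \<in> S i"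
    and un: "\<forall>s. permutation s \<longrightarrow> (\<forall>x\<in>S i. s x = t (transpose e f x)) \<longrightarrow>
      pairing_except (S i) {e, f} s \<and> f \<in> orbit (g \<circ> s) e \<and>
      2 * card (cycles_on (S i) (g \<circ> s)) = card (S i)"
    by (rule NC2_unpair[OF di qi tst[OF di] tx[OF di] C])
  define s where "s = t \<circ> transpose e f"
  have efM: "e \<in> M" "f \<in> M" using ef M_eq3[OF ijk] by blast+
  have sM: "s permutes M" unfolding s_def using efM tM by (intro permutes_compose permutes_swap_id)
  then have sp: "permutation s" using finite_M unfolding permutation_permutes by blast
  have disj: "S i \<inter> S j = {}" "S i \<inter> S k = {}" using S_disjoint d by blast+
  have sj: "s x = t x" if "x \<in> S j \<union> S k" for x
  proof -
    have "x \<noteq> e" "x \<noteq> f" using that ef disj by blast+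
    then show ?thesis by (simp add: s_def)
  qed
  have cyc: "cycles_on (S l) (g \<circ> t) = cycles_on (S l) (g \<circ> s)" if "l \<in> {0, 1, 2}" "S l \<subseteq> S j \<union> S k" for l
    using sj that by (intro cycles_on_cong stab_comp stab_g tst) auto
  have dat: "loop_data s i j k a b e f"
  proof (rule loop_dataI[OF ijk sM])
    show "pairing_except (S j) {a} s" by (rule pairing_except_cong[OF a(3) sp]) (simp add: sj)
    show "pairing_except (S k) {b} s" by (rule pairing_except_cong[OF b(3) sp]) (simp add: sj)
    show "2 * card (cycles_on (S j) (g \<circ> s)) = card (S j) + 1" using cyc[OF dj] a(4) by simp
    show "2 * card (cycles_on (S k) (g \<circ> s)) = card (S k) + 1" using cyc[OF dk] b(4) by simp
  qed (use un[rule_format, OF sp] ef in \<open>auto simp: s_def\<close>)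
  have ts: "t = s \<circ> transpose e f" by (simp add: s_def comp_assoc)
  have "one_merged_block M V t {a, b, e, f}"
  proof -
    have "A1 \<union> A2 \<union> C = {a, b, e, f}" using a b ef by blast
    then show ?thesis using om by (simp add: M_def)
  qed
  moreover have "t x \<in> {a, b, e, f}" if "x \<in> {a, b, e, f}" for x
    using that data_fixed[OF dat] t_simps[OF dat, folded ts] data_points[OF dat] by auto
  moreover have "t x = s x" if "x \<notin> {a, b, e, f}" for x
    using t_simps(1)[OF dat, folded ts, of x] that by blast
  ultimately have "V = pairs_with M s {a, b, e, f}" using data_one_merged_block[OF dat tM] by blast
  then show ?thesis using dat ts by blast
qed

lemma data_in_PS_11t:
  assumes dat: "loop_data s i j k a b e f"
  shows "(pairs_with M s {a, b, e, f}, s \<circ> transpose e f \<circ> transpose a b) \<in> PS_11t_NC2 m1 m2 m3"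
proof -
  let ?t = "s \<circ> transpose e f \<circ> transpose a b" and ?T = "S j \<union> S k"
  note ijk = data_ijk(4-6)[OF dat] and pts = data_points[OF dat] and jk = data_ijk(5,6,3)[OF dat]
    and disj = data_disjoint[OF dat] and fx = data_fixed[OF dat]
  have tab: "?t a = b" "?t b = a" using fx pts by simp_all
  have tT: "?t x = s x" if "x \<in> ?T - {a, b}" for x
  proof -
    have "x \<noteq> e" "x \<noteq> f" using that pts disj by blast+
    then show ?thesis using that by simp
  qed
  have ti: "?t x = (s \<circ> transpose e f) x" if "x \<in> S i" for x
  proof -
    have "x \<noteq> a" "x \<noteq> b" using that pts disj by blast+
    then show ?thesis by simp
  qed
  have pT: "pairing_except ?T {a, b} s" by (rule data_pairing(4)[OF dat])
  have so: "s x \<in> ?T - {a, b} \<and> s x \<noteq> x \<and> s (s x) = x" if "x \<in> ?T - {a, b}" for x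
  proof -
    have "s x \<in> ?T" "s (s x) = x" "s x \<noteq> x" using pT that unfolding pairing_except_def by blast+
    moreover have "s x \<noteq> a" "s x \<noteq> b" using fx \<open>s (s x) = x\<close> that by force+
    ultimately show ?thesis by blast
  qed
  have tinv: "?t x \<in> ?T \<and> ?t (?t x) = x \<and> ?t x \<noteq> x" if x: "x \<in> ?T" for x
  proof (cases "x \<in> {a, b}")
    case True then show ?thesis using tab pts by auto
  next
    case False
    then have "x \<in> ?T - {a, b}" using x by blast
    from so[OF this] tT[OF this] show ?thesis using tT[of "s x"] by auto
  qed
  have abefM: "a \<in> M" "b \<in> M" "e \<in> M" "f \<in> M" using data_F[OF dat] by blast+
  have tM: "?t permutes M"
    using data_perm(1)[OF dat] abefM by (intro permutes_compose permutes_swap_id)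
  then have tp: "permutation ?t" using finite_M unfolding permutation_permutes by blast
  have stT: "stab ?t ?T"
    unfolding stab_def using tp tinv by (intro conjI image_subsetI) simp_all
  have sti: "stab ?t (S i)"
    using tp ti stabD[OF stab_t[OF dat ijk(1)]] unfolding stab_def by (metis finite_S image_subsetI)
  define p1 p2 where "p1 = perm_restrict ?t ?T" and "p2 = perm_restrict ?t (S i)"
  have p1: "p1 permutes ?T" and p2: "p2 permutes S i"
    unfolding p1_def p2_def by (rule perm_restrict_permutes[OF stT], rule perm_restrict_permutes[OF sti])
  have p1t: "p1 x = ?t x" if "x \<in> ?T" for x using that by (simp add: p1_def perm_restrict_def)
  have p2t: "p2 x = ?t x" if "x \<in> S i" for x using that by (simp add: p2_def perm_restrict_def)
  have disj': "?T \<inter> S i = {}" using disj by blast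
  have MT: "M = ?T \<union> S i" using data_ijk(7)[OF dat] by blast
  have tp12: "?t = p1 \<circ> p2"
  proof
    fix x
    consider "x \<in> ?T" | "x \<in> S i" | "x \<notin> M" using MT by blast
    then show "?t x = (p1 \<circ> p2) x"
    proof cases
      case 1 then show ?thesis using comp_two(2)[OF disj' p1 p2 1] p1t[OF 1] by metis
    next
      case 2 then show ?thesis using comp_two(3)[OF disj' p1 p2 2] p2t[OF 2] by metis
    next
      case 3 then show ?thesis
        using comp_two(1)[OF disj' p1 p2] tM MT unfolding permutes_def by metis
    qed
  qed
  \<comment> \<open>On these two segments \<open>\<gamma> \<circ> t\<close> has as its cycles
    exactly the vertices of the unicircuit graph, so the annular count is already known.\<close>
  have "cycles_on ?T (g \<circ> ?t) = cycles_on ?T (g \<circ> s \<circ> transpose a b)"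
  proof (rule cycles_on_cong[OF stab_comp[OF stab_g_Un[OF jk(1,2)] stT]])
    fix x assume x: "x \<in> ?T"
    then have "transpose a b x \<in> ?T" using pts by (simp add: transpose_def)
    then have "transpose a b x \<noteq> e" "transpose a b x \<noteq> f" using pts disj by blast+
    then show "(g \<circ> ?t) x = (g \<circ> s \<circ> transpose a b) x" by simp
  qed
  then have "2 * card (cycles_on ?T (g \<circ> ?t)) = card ?T" using data_card_merged[OF dat] by simp
  then have N1: "p1 \<in> NC2_annular ms j k"
    using NC2_annular_iff[where t = ?t, OF jk p1 stT p1t pts(1)] unfolding tab(1) using pts(2) tinv by blast
  have N2: "p2 \<in> NC2 ms i" by (rule t_in_NC2[OF dat p2]) (use p2t ti in simp)
  have orb: "orbit p1 x = {x, ?t x}" if x: "x \<in> ?T" for x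
    using orbit_involution[of p1 x] p1t tinv[OF x] x by (metis (no_types, lifting))
  \<comment> \<open>Every pair other than the one made of \<open>a\<close> and \<open>b\<close>
    comes from \<open>s\<close>, which preserves each segment.\<close>
  have "C = {a, b}" if C: "C \<in> through_strings ms j k p1" for C
  proof -
    obtain x where x: "x \<in> ?T" "C = {x, ?t x}" and meet: "C \<inter> S j \<noteq> {}" "C \<inter> S k \<noteq> {}"
      using C orb unfolding through_strings_def cycles_on_def by blast
    have "x \<in> {a, b}"
    proof (rule ccontr)
      assume nx: "x \<notin> {a, b}"
      then have "C = {x, s x}" using x tT[of x] by simp
      moreover have "s x \<in> S l" if "x \<in> S l" "l \<in> {0, 1, 2}" for l
        using stabD[OF stab_s[OF dat that(2)] that(1)] .
      ultimately show False using x(1) meet disj(3) ijk by blast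
    qed
    then show ?thesis using x(2) tab by auto
  qed
  moreover have "{a, b} \<in> through_strings ms j k p1"
  proof -
    have "{a, b} = orbit p1 a" using orb[of a] tab pts by simp
    then show ?thesis using pts unfolding through_strings_def cycles_on_def by blast
  qed
  ultimately have thr: "through_strings ms j k p1 = {{a, b}}" by blast
  have "p2 e = f" "p2 f = e" using p2t[of e] p2t[of f] ti[of e] ti[of f] t_simps[OF dat] pts by simp_all
  then have "orbit p2 e = {e, f}" using orbit_involution[of p2 e] by simp
  then have Cc: "{e, f} \<in> cycles_on (S i) p2" using pts(3) unfolding cycles_on_def by blast
  have "one_merged_block M (pairs_with M s {a, b, e, f}) ?t {a, b, e, f}"
  proof -
    have "?t x \<in> {a, b, e, f}" if "x \<in> {a, b, e, f}" for x
      using that tab ti[of e] ti[of f] t_simps[OF dat] pts by auto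
    moreover have "?t x = s x" if "x \<notin> {a, b, e, f}" for x using that by simp
    ultimately show ?thesis using data_one_merged_block[OF dat tM] by blast
  qed
  moreover have "{a, b, e, f} = {a, b} \<union> {e, f}" by blast
  ultimately have om: "one_merged_block {1..m1 + m2 + m3} (pairs_with M s {a, b, e, f}) ?t ({a, b} \<union> {e, f})"
    by (simp add: M_def)
  have "{i, j, k} = {0, 1, 2}" using dat unfolding loop_data_def by (elim conjE)
  then have "{j, k, i} = {0, 1, 2}" by (simp only: insert_commute)
  then show ?thesis
    unfolding PS_11t_NC2_def Let_def using tp12 N1 N2 thr Cc om
    by (intro CollectI case_prodI exI[of _ j] exI[of _ k] exI[of _ i] exI[of _ p1] exI[of _ p2] conjI
      bexI[of _ "{a, b}"] bexI[OF _ Cc]) simp_all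
qed

text \<open>Undoing the through string and the pair merged with it produces the four loops. The
  single annular count must then be shown to split into the two separate counts.\<close>

lemma PS_11t_imp_data:
  assumes "(V, t) \<in> PS_11t_NC2 m1 m2 m3"
  shows "\<exists>s i j k a b e f. loop_data s i j k a b e f \<and> V = pairs_with M s {a, b, e, f} \<and>
    t = s \<circ> transpose e f \<circ> transpose a b"
  using assms unfolding PS_11t_NC2_def Let_def mem_Collect_eq prod.case
proof (elim exE conjE bexE)
  fix j k i p1 p2 A C
  assume jki: "{j, k, i} = {0, 1, 2}" and tp: "t = p1 \<circ> p2"
    and N1: "p1 \<in> NC2_annular ms j k" and c1: "card (through_strings ms j k p1) = 1"
    and N2: "p2 \<in> NC2 ms i" and A: "A \<in> through_strings ms j k p1" and C: "C \<in> cycles_on (S i) p2"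
    and om: "one_merged_block {1..m1 + m2 + m3} V t (A \<union> C)"
  let ?T = "S j \<union> S k"
  have ijk: "{i, j, k} = {0, 1, 2}" using jki by (simp only: insert_commute)
  note d = distinct3[OF ijk]
  have di: "i \<in> {0, 1, 2}" and dj: "j \<in> {0, 1, 2}" and dk: "k \<in> {0, 1, 2}" and djk: "j \<noteq> k"
    using d by blast+
  have disj: "S i \<inter> S j = {}" "S i \<inter> S k = {}" "S j \<inter> S k = {}" "?T \<inter> S i = {}"
    using S_disjoint d by auto
  have MT: "M = ?T \<union> S i" using M_eq3[OF ijk] by blast
  have p1: "p1 permutes ?T" and cyc2: "\<forall>C\<in>cycles_on ?T p1. card C = 2"
    using N1 by (auto simp: NC2_annular_def Let_def)
  have p2: "p2 permutes S i" using N2 by (simp add: NC2_def NC_def)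
  have tM: "t permutes M" and tT: "\<And>x. x \<in> ?T \<Longrightarrow> p1 x = t x" and ti: "\<And>x. x \<in> S i \<Longrightarrow> p2 x = t x"
    using comp_two[OF disj(4) p1 p2] MT unfolding tp by simp_all
  have tperm: "permutation t" using tM finite_M unfolding permutation_permutes by blast
  have stT: "stab t ?T"
    using tperm tT permutes_in_image[OF p1] unfolding stab_def by (metis finite_S finite_Un image_subsetI)
  have sti: "stab t (S i)"
    using tperm ti permutes_in_image[OF p2] unfolding stab_def by (metis finite_S image_subsetI)
  have "cycles_on ?T p1 = cycles_on ?T t" using cycles_on_cong[OF stT, of p1] tT by simp
  then have inv: "t (t x) = x \<and> t x \<noteq> x" if "x \<in> ?T" for x
    using all_cycles_card_2_iff[OF stT] cyc2 that by simp
  have orb: "orbit p1 x = {x, t x}" if x: "x \<in> ?T" for x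
    using orbit_involution[of p1 x] tT[OF x] tT[OF stabD[OF stT x]] inv[OF x] by simp
  have thr: "through_strings ms j k p1 = {A}" using c1 A by (metis card_1_singletonE singletonD)
  obtain x0 a b where x0: "x0 \<in> ?T" "A = {x0, t x0}" and ab: "a \<in> A" "a \<in> S j" "b \<in> A" "b \<in> S k"
    using A orb unfolding through_strings_def cycles_on_def by blast
  have "a \<noteq> b" using ab disj by blast
  then have Aab: "A = {a, b}" and tab: "t a = b" "t b = a"
    using x0 ab inv[OF x0(1)] by auto
  obtain e f where ef: "C = {e, f}" "e \<noteq> f" "e \<in> S i" "f \<in> S i"
    and un: "\<forall>s. permutation s \<longrightarrow> (\<forall>x\<in>S i. s x = t (transpose e f x)) \<longrightarrow>
      pairing_except (S i) {e, f} s \<and> f \<in> orbit (g \<circ> s) e \<and>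
      2 * card (cycles_on (S i) (g \<circ> s)) = card (S i)"
    by (rule NC2_unpair[OF di N2 sti ti C])
  define s where "s = t \<circ> transpose a b \<circ> transpose e f"
  have abef: "a \<in> M" "b \<in> M" "e \<in> M" "f \<in> M" using ef ab MT by blast+
  have sM: "s permutes M" unfolding s_def using abef tM by (intro permutes_compose permutes_swap_id)
  then have sp: "permutation s" using finite_M unfolding permutation_permutes by blast
  have ne: "a \<noteq> e" "a \<noteq> f" "b \<noteq> e" "b \<noteq> f" using ab ef disj by blast+
  have s_i: "s x = t (transpose e f x)" if "x \<in> S i" for x
  proof -
    have "transpose e f x \<in> S i" using that ef by (simp add: transpose_def)
    then have "transpose e f x \<noteq> a" "transpose e f x \<noteq> b" using ab disj by blast+
    then show ?thesis by (simp add: s_def)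
  qed
  have s_T: "s x = t (transpose a b x)" if "x \<in> ?T" for x
  proof -
    have "x \<noteq> e" "x \<noteq> f" using that ef disj by blast+
    then show ?thesis by (simp add: s_def)
  qed
  have sab: "s a = a" "s b = b" using s_T[of a] s_T[of b] ab tab by simp_all
  \<comment> \<open>Any other crossing pair would be a second through string.\<close>
  have same: "t x \<in> S l" if l: "(l, c) \<in> {(j, a), (k, b)}" and x: "x \<in> S l" "x \<noteq> c" for l c x
  proof (rule ccontr)
    assume n: "t x \<notin> S l"
    have xT: "x \<in> ?T" using l x by blast
    then have txT: "t x \<in> ?T" by (rule stabD[OF stT])
    have "{x, t x} \<inter> S j \<noteq> {}" "{x, t x} \<inter> S k \<noteq> {}" using l x n txT by blast+
    then have "{x, t x} \<in> through_strings ms j k p1"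
      using orb[OF xT] xT unfolding through_strings_def cycles_on_def by blast
    then have "x \<in> {a, b}" using thr Aab by blast
    then show False using l x ab disj by blast
  qed
  have half: "pairing_except (S l) {c} s" if l: "(l, c) \<in> {(j, a), (k, b)}" for l c
  proof -
    have "a \<notin> S k" "b \<notin> S j" using ab disj by blast+
    then have c: "c \<in> S l" "s c = c" "t c \<notin> S l" using l ab sab tab by auto
    have lT: "S l \<subseteq> ?T" using l by blast
    have o: "s x = t x \<and> t x \<in> S l \<and> t x \<noteq> x \<and> t (t x) = x \<and> t x \<noteq> c" if x: "x \<in> S l" "x \<noteq> c" for x
    proof -
      have xT: "x \<in> ?T" using x lT by blast
      have "x \<noteq> a" "x \<noteq> b" using l x ab disj by blast+
      then have "s x = t x" using s_T[OF xT] by simp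
      moreover have "t x \<noteq> c"
      proof
        assume "t x = c"
        then have "t c = x" using inv[OF xT] by simp
        then show False using c(3) x(1) by simp
      qed
      ultimately show ?thesis using same[OF l x] inv[OF xT] by simp
    qed
    have "s x \<in> S l \<and> s (s x) = x" if x: "x \<in> S l" for x
    proof (cases "x = c")
      case False then show ?thesis using o[OF x False] o[of "t x"] by simp
    qed (use c in simp)
    moreover have "{x \<in> S l. s x = x} = {c}" using o c by force
    ultimately show ?thesis using sp by (simp add: pairing_except_def)
  qed
  have pj: "pairing_except (S j) {a} s" and pk: "pairing_except (S k) {b} s"
    by (rule half, simp)+
  have stj: "stab (g \<circ> s) (S j)" and stk: "stab (g \<circ> s) (S k)"
    using stab_comp[OF stab_g[OF dj] pairing_except_stab[OF finite_S pj]]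
      stab_comp[OF stab_g[OF dk] pairing_except_stab[OF finite_S pk]] .
  have stgT: "stab (g \<circ> s) ?T" using stj stk by (auto simp: stab_def)
  have abT: "a \<in> ?T" "b \<in> ?T" using ab by blast+
  have bna: "b \<notin> orbit (g \<circ> s) a" using orbit_subset_stab[OF stj ab(2)] ab(4) disj(3) by blast
  \<comment> \<open>Removing the through string raises the number of cycles by one, which brings it
    to the sum of the two genus bounds. Hence both segments attain their bound.\<close>
  have "2 * card (cycles_on ?T (g \<circ> t)) = card ?T"
    using NC2_annular_iff[OF dj dk djk p1 stT tT ab(2)] tab(1) ab(4) N1 by simp
  moreover have "cycles_on ?T (g \<circ> t) = cycles_on ?T (g \<circ> s \<circ> transpose a b)"
  proof (rule cycles_on_cong[OF stab_comp[OF stab_g_Un[OF dj dk] stT]])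
    fix x assume "x \<in> ?T"
    then have "transpose a b x \<in> ?T" using abT by (simp add: transpose_def)
    then show "(g \<circ> t) x = (g \<circ> s \<circ> transpose a b) x" using s_T by simp
  qed
  moreover have "card (cycles_on ?T (g \<circ> s)) = card (cycles_on ?T (g \<circ> s \<circ> transpose a b)) + 1"
    by (rule card_cycles_on_merge[OF stgT abT bna])
  moreover have "card (cycles_on ?T (g \<circ> s)) = card (cycles_on (S j) (g \<circ> s)) + card (cycles_on (S k) (g \<circ> s))"
    by (rule card_cycles_on_Un[OF stj stk disj(3)])
  moreover have "card ?T = card (S j) + card (S k)" using disj by (simp add: card_Un_disjoint)
  moreover have "2 * card (cycles_on (S j) (g \<circ> s)) \<le> card (S j) + 1"
    "2 * card (cycles_on (S k) (g \<circ> s)) \<le> card (S k) + 1"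
    using genus_S[OF dj pj] genus_S[OF dk pk] by simp_all
  ultimately have cnt: "2 * card (cycles_on (S j) (g \<circ> s)) = card (S j) + 1"
    "2 * card (cycles_on (S k) (g \<circ> s)) = card (S k) + 1" by simp_all
  have dat: "loop_data s i j k a b e f"
    by (rule loop_dataI[OF ijk sM _ pj pk ef(2) _ _ cnt]) (use un sp s_i in blast)+
  have ts: "t = s \<circ> transpose e f \<circ> transpose a b"
    by (simp add: s_def fun_eq_iff)
  have "A \<union> C = {a, b, e, f}" using Aab ef by blast
  then have "one_merged_block M V t {a, b, e, f}" using om by (simp add: M_def)
  moreover have "t x \<in> {a, b, e, f}" if "x \<in> {a, b, e, f}" for x
    using that tab data_fixed[OF dat] ne unfolding ts by auto
  moreover have "t x = s x" if "x \<notin> {a, b, e, f}" for x using that unfolding ts by simp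
  ultimately have "V = pairs_with M s {a, b, e, f}" using data_one_merged_block[OF dat tM] by blast
  then show ?thesis using dat ts by blast
qed

section \<open>Comparison of the three sets\<close>

text \<open>The partition alone recovers \<open>s\<close>, because its merged block has four points
  and all others have two. In the other direction, relabelling leaves the set of loops and both
  transpositions unchanged.\<close>

lemma data_eq_iff:
  assumes d: "loop_data s i j k a b e f" and d': "loop_data s' i' j' k' a' b' e' f'"
  shows "(pairs_with M s {a, b, e, f}, s \<circ> transpose e f) =
      (pairs_with M s' {a', b', e', f'}, s' \<circ> transpose e' f') \<longleftrightarrow> s = s'" (is "?L \<longleftrightarrow> _")
    and "(pairs_with M s {a, b, e, f}, s \<circ> transpose e f \<circ> transpose a b) =
      (pairs_with M s' {a', b', e', f'}, s' \<circ> transpose e' f' \<circ> transpose a' b') \<longleftrightarrow> s = s'" (is "?R \<longleftrightarrow> _")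
proof -
  have pe: "pairing_except M {a, b, e, f} s" "pairing_except M {a', b', e', f'} s'"
    using d d' by (simp_all add: loop_data_def)
  have 1: "s = s'" if "pairs_with M s {a, b, e, f} = pairs_with M s' {a', b', e', f'}"
  proof
    fix x
    show "s x = s' x"
    proof (cases "x \<in> M")
      case True
      then show ?thesis using pairs_with_inj[OF pe _ _ that] data_card_F[OF d] data_card_F[OF d'] by simp
    next
      case False
      then show ?thesis using data_perm(1)[OF d] data_perm(1)[OF d'] by (simp add: permutes_def)
    qed
  qed
  have 2: "{a', b', e', f'} = {a, b, e, f} \<and> transpose e' f' = transpose e f \<and> transpose a' b' = transpose a b"
    if "s = s'"
  proof -
    have "loop_data s i' j' k' a' b' e' f'" using d' that by simp
    note same = data_same_s(2,3)[OF d this]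
    have "{a', b', e', f'} = {a', b'} \<union> {e', f'}" "{a, b, e, f} = {a, b} \<union> {e, f}" by blast+
    then show ?thesis using same by (auto simp: doubleton_eq_iff transpose_commute)
  qed
  show "?L \<longleftrightarrow> s = s'" "?R \<longleftrightarrow> s = s'" using 1 2 by auto
qed

text \<open>The labelled data in \<open>D\<close> parametrize all three sets redundantly. Each map
  has the fibres of the projection to \<open>s\<close>, so the images are equinumerous.\<close>

lemma card_UL_24_PS:
  "card (UL_24 m1 m2 m3) = card (PS_111_NC211 m1 m2 m3) \<and>
    card (PS_111_NC211 m1 m2 m3) = card (PS_11t_NC2 m1 m2 m3)"
proof -
  define D where "D = {(s, i, j, k, a, b, e, f). loop_data s i j k a b e f}"
  let ?u = "\<lambda>(s, i, j, k, a, b, e, f::nat). glued s i j k a b e"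
  let ?p = "\<lambda>(s, i::nat, j::nat, k::nat, a, b, e, f). (pairs_with M s {a, b, e, f}, s \<circ> transpose e f)"
  let ?q = "\<lambda>(s, i::nat, j::nat, k::nat, a, b, e, f).
    (pairs_with M s {a, b, e, f}, s \<circ> transpose e f \<circ> transpose a b)"
  have "UL_24 m1 m2 m3 = ?u ` D"
    using UL_imp_data glued_in_UL unfolding D_def by (fastforce simp: image_iff)
  moreover have "PS_111_NC211 m1 m2 m3 = ?p ` D"
    using PS_111_imp_data data_in_PS_111 unfolding D_def by (fastforce simp: image_iff)
  moreover have "PS_11t_NC2 m1 m2 m3 = ?q ` D"
    using PS_11t_imp_data data_in_PS_11t unfolding D_def by (fastforce simp: image_iff)
  moreover have "?u x = ?u y \<longleftrightarrow> fst x = fst y" "?p x = ?p y \<longleftrightarrow> fst x = fst y"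
    "?q x = ?q y \<longleftrightarrow> fst x = fst y" if "x \<in> D" "y \<in> D" for x y
    using that glued_eq_iff data_eq_iff unfolding D_def by (simp_all add: case_prod_beta)
  then have "card (?u ` D) = card (?p ` D)" "card (?p ` D) = card (?q ` D)"
    by (intro card_image_eq_card_image, simp)+
  ultimately show ?thesis by simp
qed

end

theorem lemma8p31:
  fixes m1 m2 m3 :: nat
  assumes "m1 \<ge> 1" and "m2 \<ge> 1" and "m3 \<ge> 1"
  shows "card (UL_24 m1 m2 m3) = card (PS_111_NC211 m1 m2 m3) \<and>
         card (PS_111_NC211 m1 m2 m3) = card (PS_11t_NC2 m1 m2 m3)"
  by (rule three_cycles.card_UL_24_PS) (rule three_cycles.intro[OF assms])

end
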